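(* For $\varepsilon\in(0,1)$ there is a $(1+\varepsilon)$-approximation algorithm for Entrywise $\ell_0$-Rank-$k$ Approximation over $\mathbb{F}_q$ running in time $n\cdot d^{\mathrm{poly}(k/\varepsilon)}$.
   Context: Entrywise $\ell_0$-Rank-$k$ Approximation over $\mathbb{F}_q$: $q$ is a constant prime power; given an $n\times d$ matrix $A$ with entries in the finite field $\mathbb{F}_q$ and a positive integer $k$, output $U\in\mathbb{F}_q^{n\times k}$ and $V\in\mathbb{F}_q^{k\times d}$ minimizing $\|A-UV\|_0$, the number of nonzero entries of $A-UV$ (all arithmetic in $\mathbb{F}_q$). An algorithm is an $\alpha$-approximation if it outputs $U,V$ with $\|A-UV\|_0\le\alpha\cdot\min_{U'\in\mathbb{F}_q^{n\times k},V'\in\mathbb{F}_q^{k\times d}}\|A-U'V'\|_0$. *)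

theory Defs
  imports "Jordan_Normal_Form.Matrix" "HOL-Library.Cardinality" "HOL-Computational_Algebra.Polynomial"
begin

definition l0_norm :: "'a::zero mat \<Rightarrow> nat" where
  "l0_norm M = card {(i, j). i < dim_row M \<and> j < dim_col M \<and> M $$ (i, j) \<noteq> 0}"

definition l0_rank_opt :: "nat \<Rightarrow> 'a::ring mat \<Rightarrow> nat" where
  "l0_rank_opt k A =
     (INF (U, V) \<in> carrier_mat (dim_row A) k \<times> carrier_mat k (dim_col A). l0_norm (A - U * V))"

text \<open>
  Every program variable is an array of machine words indexed by machine words; the scalar
  \<open>x\<close> is \<open>x[0]\<close>.  A program mentions only finitely many arrays, so this is the usual random
  access machine with indirect addressing, up to constant factors.  Arithmetic is that of the
  natural numbers (with truncated subtraction, and \<open>div\<close> and \<open>mod\<close> as in HOL).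
\<close>

type_synonym vname = string
type_synonym state = "vname \<Rightarrow> nat \<Rightarrow> nat"

datatype aexp =
    Const nat
  | Read vname aexp
  | Add aexp aexp
  | Sub aexp aexp
  | Mul aexp aexp
  | Div aexp aexp
  | Mod aexp aexp

datatype bexp = Less aexp aexp | Neg bexp | Conj bexp bexp

datatype com =
    Skip
  | Write vname aexp aexp
  | Seq com com
  | Cond bexp com com
  | While bexp com

fun aval :: "aexp \<Rightarrow> state \<Rightarrow> nat" where
  "aval (Const m) s = m"
| "aval (Read x a) s = s x (aval a s)"
| "aval (Add a b) s = aval a s + aval b s"
| "aval (Sub a b) s = aval a s - aval b s"
| "aval (Mul a b) s = aval a s * aval b s"
| "aval (Div a b) s = aval a s div aval b s"
| "aval (Mod a b) s = aval a s mod aval b s"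

fun bval :: "bexp \<Rightarrow> state \<Rightarrow> bool" where
  "bval (Less a b) s \<longleftrightarrow> aval a s < aval b s"
| "bval (Neg b) s \<longleftrightarrow> \<not> bval b s"
| "bval (Conj b c) s \<longleftrightarrow> bval b s \<and> bval c s"

text \<open>Each node of an expression costs one time unit.\<close>

fun acost :: "aexp \<Rightarrow> nat" where
  "acost (Const m) = 1"
| "acost (Read x a) = 1 + acost a"
| "acost (Add a b) = 1 + acost a + acost b"
| "acost (Sub a b) = 1 + acost a + acost b"
| "acost (Mul a b) = 1 + acost a + acost b"
| "acost (Div a b) = 1 + acost a + acost b"
| "acost (Mod a b) = 1 + acost a + acost b"

fun bcost :: "bexp \<Rightarrow> nat" where
  "bcost (Less a b) = 1 + acost a + acost b"
| "bcost (Neg b) = 1 + bcost b"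
| "bcost (Conj b c) = 1 + bcost b + bcost c"

text \<open>
  Unit cost arithmetic is only reasonable on short words.  Words are the numbers below \<open>W\<close>, and
  an expression may be evaluated only if all intermediate results, addresses included, are words.
\<close>

fun afits :: "nat \<Rightarrow> aexp \<Rightarrow> state \<Rightarrow> bool" where
  "afits W (Const m) s \<longleftrightarrow> m < W"
| "afits W (Read x a) s \<longleftrightarrow> afits W a s \<and> s x (aval a s) < W"
| "afits W (Add a b) s \<longleftrightarrow> afits W a s \<and> afits W b s \<and> aval a s + aval b s < W"
| "afits W (Sub a b) s \<longleftrightarrow> afits W a s \<and> afits W b s"
| "afits W (Mul a b) s \<longleftrightarrow> afits W a s \<and> afits W b s \<and> aval a s * aval b s < W"
| "afits W (Div a b) s \<longleftrightarrow> afits W a s \<and> afits W b s"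
| "afits W (Mod a b) s \<longleftrightarrow> afits W a s \<and> afits W b s"

fun bfits :: "nat \<Rightarrow> bexp \<Rightarrow> state \<Rightarrow> bool" where
  "bfits W (Less a b) s \<longleftrightarrow> afits W a s \<and> afits W b s"
| "bfits W (Neg b) s \<longleftrightarrow> bfits W b s"
| "bfits W (Conj b c) s \<longleftrightarrow> bfits W b s \<and> bfits W c s"

text \<open>
  \<open>exec W c s t s'\<close>: started in \<open>s\<close> on the machine with words below \<open>W\<close>, the program \<open>c\<close>
  terminates after \<open>t\<close> time units in \<open>s'\<close>.  A run that leaves the word range is stuck.
\<close>

inductive exec :: "nat \<Rightarrow> com \<Rightarrow> state \<Rightarrow> nat \<Rightarrow> state \<Rightarrow> bool" for W where
  Skip: "exec W Skip s 1 s"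
| Write: "afits W a s \<Longrightarrow> afits W b s \<Longrightarrow>
    exec W (Write x a b) s (1 + acost a + acost b) (s(x := (s x)(aval a s := aval b s)))"
| Seq: "exec W c1 s t1 s1 \<Longrightarrow> exec W c2 s1 t2 s2 \<Longrightarrow> exec W (Seq c1 c2) s (t1 + t2) s2"
| CondTrue: "bfits W b s \<Longrightarrow> bval b s \<Longrightarrow> exec W c1 s t s' \<Longrightarrow>
    exec W (Cond b c1 c2) s (1 + bcost b + t) s'"
| CondFalse: "bfits W b s \<Longrightarrow> \<not> bval b s \<Longrightarrow> exec W c2 s t s' \<Longrightarrow>
    exec W (Cond b c1 c2) s (1 + bcost b + t) s'"
| WhileTrue: "bfits W b s \<Longrightarrow> bval b s \<Longrightarrow> exec W c s t1 s1 \<Longrightarrow> exec W (While b c) s1 t2 s2 \<Longrightarrow>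
    exec W (While b c) s (1 + bcost b + t1 + t2) s2"
| WhileFalse: "bfits W b s \<Longrightarrow> \<not> bval b s \<Longrightarrow> exec W (While b c) s (1 + bcost b) s"

inductive_cases exec_SkipE: "exec W Skip s t s'"
inductive_cases exec_WriteE: "exec W (Write x a b) s t s'"
inductive_cases exec_SeqE: "exec W (Seq c1 c2) s t s'"
inductive_cases exec_CondE: "exec W (Cond b c1 c2) s t s'"
inductive_cases exec_WhileE: "exec W (While b c) s t s'"

lemma exec_deterministic:
  "exec W c s t s' \<Longrightarrow> exec W c s u s'' \<Longrightarrow> u = t \<and> s'' = s'"
proof (induction arbitrary: u s'' rule: exec.induct)
  case (Seq c1 s t1 s1 c2 t2 s2)
  from Seq.prems obtain u1 r1 u2 where
    "exec W c1 s u1 r1" "exec W c2 r1 u2 s''" "u = u1 + u2"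
    by (rule exec_SeqE)
  with Seq.IH show ?case by blast
next
  case (CondTrue b s c1 t s' c2)
  from CondTrue.prems CondTrue.hyps obtain v where
    "exec W c1 s v s''" "u = 1 + bcost b + v"
    by - (erule exec_CondE; simp)
  with CondTrue.IH show ?case by simp
next
  case (CondFalse b s c2 t s' c1)
  from CondFalse.prems CondFalse.hyps obtain v where
    "exec W c2 s v s''" "u = 1 + bcost b + v"
    by - (erule exec_CondE; simp)
  with CondFalse.IH show ?case by simp
next
  case (WhileTrue b s c t1 s1 t2 s2)
  from WhileTrue.prems WhileTrue.hyps(2) obtain u1 r1 u2 where
    "exec W c s u1 r1" "exec W (While b c) r1 u2 s''" "u = 1 + bcost b + u1 + u2"
    by - (erule exec_WhileE; simp)
  with WhileTrue.IH show ?case by blast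
next
  case (WhileFalse b s c)
  from WhileFalse.prems WhileFalse.hyps(2) show ?case
    by - (erule exec_WhileE; simp)
qed (erule exec_SkipE exec_WriteE; simp)+

text \<open>
  An element of the field with \<open>q\<close> elements occupies one word, as a number below \<open>q\<close>.  Zero is
  represented by \<open>0\<close>, the initial content of memory.  The machine has no field arithmetic; since
  \<open>q\<close> is constant, a program can contain the operation tables.
\<close>

definition field_encoding :: "('a::{finite,field} \<Rightarrow> nat) \<Rightarrow> bool" where
  "field_encoding enc \<longleftrightarrow> bij_betw enc UNIV {..<CARD('a)} \<and> enc 0 = 0"

definition stores_mat :: "('a \<Rightarrow> nat) \<Rightarrow> state \<Rightarrow> vname \<Rightarrow> 'a mat \<Rightarrow> bool" where
  "stores_mat enc s x M \<longleftrightarrow>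
     (\<forall>i < dim_row M. \<forall>j < dim_col M. s x (i * dim_col M + j) = enc (M $$ (i, j)))"

definition input_state :: "('a \<Rightarrow> nat) \<Rightarrow> 'a mat \<Rightarrow> nat \<Rightarrow> state" where
  "input_state enc A k = (\<lambda>x m.
     if x = ''A'' \<and> m < dim_row A * dim_col A
       then enc (A $$ (m div dim_col A, m mod dim_col A))
     else if x = ''n'' \<and> m = 0 then dim_row A
     else if x = ''d'' \<and> m = 0 then dim_col A
     else if x = ''k'' \<and> m = 0 then k
     else 0)"

text \<open>
  The bound \<open>(w * (n + d + k)) ^ w\<close> on words, with \<open>w\<close> independent of the instance, is a word
  size of \<open>O(log (n + d + k))\<close> bits.
\<close>

definition l0_rank_approx_algorithm ::
  "('a::{finite,field} \<Rightarrow> nat) \<Rightarrow> real \<Rightarrow> (nat \<Rightarrow> nat \<Rightarrow> nat \<Rightarrow> real) \<Rightarrow> com \<Rightarrow> bool" where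
  "l0_rank_approx_algorithm enc \<alpha> T prog \<longleftrightarrow>
     (\<exists>w. \<forall>n d k. \<forall>A \<in> carrier_mat n d. 0 < n \<longrightarrow> 0 < d \<longrightarrow> 0 < k \<longrightarrow>
        (\<exists>t s. exec ((w * (n + d + k)) ^ w) prog (input_state enc A k) t s \<and>
           real t \<le> T n d k \<and>
           (\<exists>U \<in> carrier_mat n k. \<exists>V \<in> carrier_mat k d.
              stores_mat enc s ''U'' U \<and> stores_mat enc s ''V'' V \<and>
              real (l0_norm (A - U * V)) \<le> \<alpha> * real (l0_rank_opt k A))))"

end

theory Submission
  imports Defs "HOL-Analysis.Convex"
begin

text \<open>
  Fix an optimal \<open>U* V*\<close>. If \<open>V*\<close> were known on few suitably weighted columns, each row of \<open>U\<close> could be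
  computed as the one that fits the row of \<open>A\<close> best on these columns, and then each column of \<open>V\<close> as the one
  that fits the column of \<open>A\<close> best; both are searches over \<open>q^k\<close> vectors. So it suffices that
  \<open>t = poly(k/\<epsilon>)\<close> columns, weights in \<open>{1..d}\<close> and the entries of \<open>V*\<close> there exist which make the first
  step lose only a factor \<open>1 + \<epsilon>\<close>: all \<open>(d q)^(t (k + 2))\<close> guesses are tried.

  For existence, sample columns independently. Give column \<open>j\<close> a weight \<open>w j\<close> that is at most the weight of every
  codeword \<open>u V*\<close> that is nonzero at \<open>j\<close>; a greedy choice achieves \<open>\<Sum> 1 / w j \<le> k\<close>, so sampling \<open>j\<close> with
  probability \<open>1 / (k w j)\<close> and counting it \<open>w j\<close> times is unbiased up to the factor \<open>1/k\<close>, and no sample exceeds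
  the weight of the codeword to be estimated. The difference of the errors of two candidates \<open>u, u'\<close> lives on the
  support of the codeword \<open>(u - u') V*\<close>, hence Chernoff bounds and a union bound over the \<open>q^k\<close> candidates control the expected loss.
\<close>

section \<open>Weights for the coordinates of a linear code\<close>

text \<open>The number \<open>t\<close> of samples must depend neither on \<open>n\<close> nor on
  \<open>d\<close>. Uniform sampling would miss a codeword supported on few columns, and rows
  differing by it could not be told apart. With the weights, no term of an estimate exceeds the
  weight of the codeword in question, so the tail bounds do not degrade as \<open>d\<close> grows. A
  union bound over the \<open>n\<close> rows is not affordable either: the expected loss of each row
  is bounded by a multiple of that row's own error, and these bounds add up. Hence the size of the
  loss of a bad candidate has to be controlled, not only its probability. The time bound leaves no
  room for \<open>k\<close> or \<open>q ^ k\<close> when \<open>d = 1\<close>. The case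
  \<open>d \<le> k\<close> is therefore solved exactly in time O(\<open>n * d\<close>); for
  \<open>k < d\<close> one has \<open>d \<ge> 2\<close>, and the factors that depend on
  \<open>k\<close> and \<open>\<epsilon>\<close> can be moved into the exponent of
  \<open>d\<close>.\<close>

definition lincomb :: "nat set \<Rightarrow> (nat \<Rightarrow> nat \<Rightarrow> 'a::field) \<Rightarrow> (nat \<Rightarrow> 'a) \<Rightarrow> nat \<Rightarrow> 'a" where
  "lincomb K V u j = (\<Sum>m\<in>K. u m * V m j)"

lemma lincomb_diff_scale:
  "lincomb K V (\<lambda>m. u m - c * v m) j = lincomb K V u j - c * lincomb K V v j"
  by (simp add: lincomb_def algebra_simps sum_subtractf sum_distrib_left)

text \<open>Greedy choice: the support of a nonzero codeword of minimum weight \<open>c\<close> gets weight \<open>c\<close>; outside of it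
  the code has one dimension less.\<close>

lemma lincomb_weights:
  fixes V :: "nat \<Rightarrow> nat \<Rightarrow> 'a::field"
  assumes "finite K" "finite D"
  shows "\<exists>w :: nat \<Rightarrow> nat. (\<forall>j. 1 \<le> w j \<and> w j \<le> max 1 (card D)) \<and>
     (\<forall>u. \<forall>j\<in>D. lincomb K V u j \<noteq> 0 \<longrightarrow> w j \<le> card {i\<in>D. lincomb K V u i \<noteq> 0}) \<and>
     (\<Sum>j\<in>{j\<in>D. \<exists>u. lincomb K V u j \<noteq> 0}. 1 / real (w j)) \<le> real (card K)"
  using assms
proof (induction "card K" arbitrary: K D rule: less_induct)
  case less
  show ?case
  proof (cases "\<exists>u. {j\<in>D. lincomb K V u j \<noteq> 0} \<noteq> {}")
    case False
    then have "{j\<in>D. \<exists>u. lincomb K V u j \<noteq> 0} = {}" by blast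
    with False show ?thesis
      by (intro exI[of _ "\<lambda>_. 1"]) (simp only: sum.empty, auto)
  next
    case True
    define T where "T u = {j\<in>D. lincomb K V u j \<noteq> 0}" for u
    have finT: "finite (T u)" for u using less.prems by (simp add: T_def)
    obtain v where v: "T v \<noteq> {}" "\<And>u. T u \<noteq> {} \<Longrightarrow> card (T v) \<le> card (T u)"
      using ex_has_least_nat[of "\<lambda>u. T u \<noteq> {}" _ "\<lambda>u. card (T u)"] True T_def by metis
    have TD: "T v \<subseteq> D" by (auto simp: T_def)
    \<comment> \<open>Some coefficient of \<open>v\<close> is nonzero; with its help generator
      \<open>m\<close> is eliminated.\<close>
    obtain m where m: "m \<in> K" "v m \<noteq> 0"
    proof -
      have "\<exists>m\<in>K. v m \<noteq> 0"
      proof (rule ccontr)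
        assume "\<not> ?thesis"
        then have "lincomb K V v j = 0" for j unfolding lincomb_def by (intro sum.neutral) auto
        with v(1) show False unfolding T_def by blast
      qed
      then show ?thesis using that by blast
    qed
    have cK: "card (K - {m}) < card K" "card K = Suc (card (K - {m}))"
      using card_Suc_Diff1[OF less.prems(1) m(1)] by simp_all
    obtain w where w: "\<And>j. 1 \<le> w j \<and> w j \<le> max 1 (card (D - T v))"
      "\<And>u j. j\<in>D - T v \<Longrightarrow> lincomb (K - {m}) V u j \<noteq> 0 \<Longrightarrow> w j \<le> card {i\<in>D - T v. lincomb (K - {m}) V u i \<noteq> 0}"
      "(\<Sum>j\<in>{j\<in>D - T v. \<exists>u. lincomb (K - {m}) V u j \<noteq> 0}. 1 / real (w j)) \<le> real (card (K - {m}))"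
      using less.hyps[OF cK(1), of "D - T v"] less.prems by auto
    \<comment> \<open>Subtracting the multiple of \<open>v\<close> that cancels coefficient
      \<open>m\<close> leaves the codeword unchanged outside \<open>T v\<close>, so there the
      generators \<open>K - {m}\<close> produce the whole code.\<close>
    define red where "red u = (\<lambda>i. u i - u m / v m * v i)" for u
    have red: "lincomb (K - {m}) V (red u) j = lincomb K V u j" if "j \<in> D - T v" for u j
    proof -
      have "lincomb K V (red u) j = lincomb K V u j"
        unfolding red_def lincomb_diff_scale using that by (simp add: T_def)
      moreover have "lincomb K V (red u) j = lincomb (K - {m}) V (red u) j"
        unfolding lincomb_def using m less.prems by (simp add: sum.remove red_def)
      ultimately show ?thesis by simp
    qed
    have cT: "0 < card (T v)" "card (T v) \<le> card D"
      using v(1) finT TD less.prems(2) by (auto simp: card_gt_0_iff intro: card_mono)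
    show ?thesis
    proof (intro exI[of _ "\<lambda>j. if j \<in> T v then card (T v) else w j"] conjI allI ballI impI)
      fix j
      show "1 \<le> (if j \<in> T v then card (T v) else w j)" using cT w(1)[of j] by auto
      have "card (D - T v) \<le> card D" using less.prems by (intro card_mono) auto
      then show "(if j \<in> T v then card (T v) else w j) \<le> max 1 (card D)"
        using cT w(1)[of j] by auto
    next
      fix u j assume j: "j \<in> D" "lincomb K V u j \<noteq> 0"
      show "(if j \<in> T v then card (T v) else w j) \<le> card {i\<in>D. lincomb K V u i \<noteq> 0}"
      proof (cases "j \<in> T v")
        case True
        have "T u \<noteq> {}" using j by (auto simp: T_def)
        from v(2)[OF this] True show ?thesis by (simp add: T_def)
      next
        case False
        \<comment> \<open>Here the weight stems from the code restricted to \<open>D - T v\<close>,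
          where \<open>red u\<close> and \<open>u\<close> give the same codeword; returning to
          \<open>D\<close> can only enlarge the support.\<close>
        have "w j \<le> card {i\<in>D - T v. lincomb (K - {m}) V (red u) i \<noteq> 0}"
          by (rule w(2)) (use False j red in auto)
        also have "\<dots> \<le> card {i\<in>D. lincomb K V u i \<noteq> 0}"
          using less.prems red by (intro card_mono) auto
        finally show ?thesis using False by simp
      qed
    next
      let ?w = "\<lambda>j. if j \<in> T v then card (T v) else w j"
      let ?A = "{j\<in>D - T v. \<exists>u. lincomb (K - {m}) V u j \<noteq> 0}"
      have "(\<Sum>j\<in>{j\<in>D. \<exists>u. lincomb K V u j \<noteq> 0}. 1 / real (?w j)) \<le> (\<Sum>j\<in>T v \<union> ?A. 1 / real (?w j))"
      proof (rule sum_mono2)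
        show "{j\<in>D. \<exists>u. lincomb K V u j \<noteq> 0} \<subseteq> T v \<union> ?A"
          using red by (auto; metis DiffI)
      qed (use finT less.prems in auto)
      also have "\<dots> = (\<Sum>j\<in>T v. 1 / real (?w j)) + (\<Sum>j\<in>?A. 1 / real (?w j))"
        using finT less.prems by (intro sum.union_disjoint) auto
      \<comment> \<open>There are \<open>card (T v)\<close> columns of weight
        \<open>card (T v)\<close>: each round adds one to the sum and uses up one generator, whence
        the bound \<open>card K\<close>.\<close>
      also have "(\<Sum>j\<in>T v. 1 / real (?w j)) = 1" using cT by simp
      also have "(\<Sum>j\<in>?A. 1 / real (?w j)) = (\<Sum>j\<in>?A. 1 / real (w j))"
        by (intro sum.cong) auto
      finally show "(\<Sum>j\<in>{j\<in>D. \<exists>u. lincomb K V u j \<noteq> 0}. 1 / real (?w j)) \<le> real (card K)"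
        using w(3) cK(2) by simp
    qed
  qed
qed

section \<open>Sampling columns\<close>

text \<open>Markov's inequality for the exponential moment, with probabilities written as finite
  sums over tuples. The threshold is already part of \<open>h\<close>, so on the event the
  exponential of the sum is at least 1; independence turns the sum over all tuples into a
  \<open>t\<close>-th power.\<close>

lemma chernoff:
  fixes p h :: "'b \<Rightarrow> real"
  assumes "finite S" "\<And>j. j \<in> S \<Longrightarrow> 0 \<le> p j"
    and mgf: "(\<Sum>j\<in>S. p j * exp (h j)) \<le> exp a"
    and P: "\<And>x. x \<in> PiE {..<t} (\<lambda>_. S) \<Longrightarrow> P x \<Longrightarrow> 0 \<le> (\<Sum>l<t. h (x l))"
  shows "(\<Sum>x\<in>PiE {..<t} (\<lambda>_. S). (\<Prod>l<t. p (x l)) * of_bool (P x)) \<le> exp (real t * a)"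
proof -
  have "(\<Sum>x\<in>PiE {..<t} (\<lambda>_. S). (\<Prod>l<t. p (x l)) * of_bool (P x))
    \<le> (\<Sum>x\<in>PiE {..<t} (\<lambda>_. S). \<Prod>l<t. p (x l) * exp (h (x l)))"
  proof (rule sum_mono)
    fix x assume x: "x \<in> PiE {..<t} (\<lambda>_. S)"
    have "of_bool (P x) \<le> exp (\<Sum>l<t. h (x l))"
      using P[OF x] by (cases "P x") auto
    then have "(\<Prod>l<t. p (x l)) * of_bool (P x) \<le> (\<Prod>l<t. p (x l)) * exp (\<Sum>l<t. h (x l))"
      using x assms(2) by (intro mult_left_mono prod_nonneg) (auto simp: PiE_iff)
    also have "\<dots> = (\<Prod>l<t. p (x l) * exp (h (x l)))"
      by (simp add: exp_sum prod.distrib)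
    finally show "(\<Prod>l<t. p (x l)) * of_bool (P x) \<le> (\<Prod>l<t. p (x l) * exp (h (x l)))" .
  qed
  also have "\<dots> = (\<Prod>l<t. \<Sum>j\<in>S. p j * exp (h j))"
    using assms(1) by (subst prod_sum_PiE) auto
  also have "\<dots> = (\<Sum>j\<in>S. p j * exp (h j)) ^ t" by simp
  also have "\<dots> \<le> exp a ^ t"
    using assms by (intro power_mono mgf sum_nonneg) auto
  finally show ?thesis by (simp add: exp_of_nat_mult)
qed

text \<open>The reason is \<open>(1 + x) * (1 - x + x^2) = 1 + x^3\<close> together with
  \<open>1 + x \<le> exp x\<close>.\<close>

lemma exp_minus_bound: "0 \<le> x \<Longrightarrow> exp (- x) \<le> 1 - x + x\<^sup>2" for x :: real
proof -
  assume x: "0 \<le> x"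
  have "1 \<le> (1 + x) * (1 - x + x\<^sup>2)"
    using x by (simp add: algebra_simps power2_eq_square)
  also have "\<dots> \<le> exp x * (1 - x + x\<^sup>2)"
    using exp_ge_add_one_self[of x] x zero_le_power2[of "x - 1/2"]
    by (intro mult_right_mono) (auto simp: power2_eq_square algebra_simps)
  finally show ?thesis by (simp add: exp_minus field_simps)
qed

lemma real_card_ge_1: "1 \<le> real CARD('a::finite)"
  using zero_less_card_finite[where 'a='a] by linarith

section \<open>The sampling distribution on the columns\<close>

locale column_sampling =
  fixes V :: "nat \<Rightarrow> nat \<Rightarrow> 'a::{finite,field}" and w :: "nat \<Rightarrow> nat" and d k t :: nat
  assumes k_pos: "0 < k" and t_pos: "0 < t"
    and w_ge: "\<And>j. 1 \<le> w j"
    and w_le: "\<And>u j. j < d \<Longrightarrow> lincomb {..<k} V u j \<noteq> 0 \<Longrightarrow> w j \<le> card {i. i < d \<and> lincomb {..<k} V u i \<noteq> 0}"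
    and w_sum: "(\<Sum>j | j < d \<and> (\<exists>u. lincomb {..<k} V u j \<noteq> 0). 1 / real (w j)) \<le> real k"
begin

abbreviation "codeword \<equiv> lincomb {..<k} V"
abbreviation "active \<equiv> {j. j < d \<and> (\<exists>u. codeword u j \<noteq> 0)}"
abbreviation "supp u \<equiv> {j. j < d \<and> codeword u j \<noteq> 0}"

text \<open>The point \<open>d\<close> is no column. It takes the remaining probability and is sampled with zero
  coefficients, so that it contributes the same amount to the estimate of every candidate.\<close>

definition p :: "nat \<Rightarrow> real" where
  "p j = (if j \<in> active then 1 / (real k * real (w j))
          else if j = d then 1 - (\<Sum>i\<in>active. 1 / (real k * real (w i))) else 0)"

abbreviation mass :: "(nat \<Rightarrow> nat) \<Rightarrow> nat set \<Rightarrow> real" where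
  "mass x S \<equiv> (\<Sum>l<t. real (w (x l)) * of_bool (x l \<in> S))"

text \<open>This is where \<open>w_sum\<close> enters: the active columns together receive
  probability at most one, which leaves a nonnegative rest for the point \<open>d\<close>.\<close>

lemma p_nonneg: "0 \<le> p j"
proof -
  have "(\<Sum>i\<in>active. 1 / (real k * real (w i))) = (\<Sum>i\<in>active. 1 / real (w i)) / real k"
    by (simp add: sum_divide_distrib field_simps)
  also have "\<dots> \<le> 1" using w_sum k_pos by simp
  finally show ?thesis unfolding p_def by auto
qed

lemma sum_p_active: "finite B \<Longrightarrow> B \<subseteq> active \<Longrightarrow> (\<And>j. j \<notin> B \<Longrightarrow> f j = 0) \<Longrightarrow>
    (\<Sum>j\<le>d. p j * (real (w j) * f j)) = (\<Sum>j\<in>B. f j) / real k"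
proof -
  assume B: "finite B" "B \<subseteq> active" "\<And>j. j \<notin> B \<Longrightarrow> f j = 0"
  have "(\<Sum>j\<le>d. p j * (real (w j) * f j)) = (\<Sum>j\<in>B. p j * (real (w j) * f j))"
    using B by (intro sum.mono_neutral_right) auto
  also have "\<dots> = (\<Sum>j\<in>B. f j / real k)"
  proof (rule sum.cong)
    fix j assume "j \<in> B"
    then have "j \<in> active" using B by blast
    then show "p j * (real (w j) * f j) = f j / real k"
      using w_ge[of j] by (simp add: p_def)
  qed simp
  finally show ?thesis by (simp add: sum_divide_distrib)
qed

lemma sum_p: "(\<Sum>j\<le>d. p j) = 1"
proof -
  have "(\<Sum>j\<le>d. p j) = (\<Sum>j\<in>insert d active. p j)"
    by (rule sum.mono_neutral_right) (auto simp: p_def)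
  also have "\<dots> = p d + (\<Sum>j\<in>active. p j)" by (subst sum.insert) auto
  also have "(\<Sum>j\<in>active. p j) = (\<Sum>i\<in>active. 1 / (real k * real (w i)))"
    by (rule sum.cong) (auto simp: p_def)
  finally show ?thesis by (simp add: p_def)
qed

definition samples :: "(nat \<Rightarrow> nat) set" where "samples = PiE {..<t} (\<lambda>_. {..d})"

definition pr :: "((nat \<Rightarrow> nat) \<Rightarrow> bool) \<Rightarrow> real" where
  "pr P = (\<Sum>x\<in>samples. (\<Prod>l<t. p (x l)) * of_bool (P x))"

lemma finite_samples: "finite samples" unfolding samples_def by (intro finite_PiE) auto

lemma weight_nonneg: "0 \<le> (\<Prod>l<t. p (x l))" by (intro prod_nonneg) (simp add: p_nonneg)

lemma sum_weight: "(\<Sum>x\<in>samples. (\<Prod>l<t. p (x l))) = 1"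
proof -
  have "(\<Sum>x\<in>samples. (\<Prod>l<t. p (x l))) = (\<Prod>l<t. \<Sum>j\<le>d. p j)"
    unfolding samples_def by (subst prod_sum_PiE) auto
  then show ?thesis by (simp add: sum_p)
qed

section \<open>Tail bounds for the weighted counts of one codeword\<close>

lemma pr_chernoff:
  assumes "(\<Sum>j\<le>d. p j * exp (h j)) \<le> exp a"
    and "\<And>x. x \<in> samples \<Longrightarrow> P x \<Longrightarrow> 0 \<le> (\<Sum>l<t. h (x l))"
  shows "pr P \<le> exp (real t * a)"
  unfolding pr_def samples_def by (rule chernoff) (use assms p_nonneg samples_def in auto)

lemma pr_mono: "(\<And>x. x \<in> samples \<Longrightarrow> P x \<Longrightarrow> Q x) \<Longrightarrow> pr P \<le> pr Q"
  unfolding pr_def by (intro sum_mono mult_left_mono weight_nonneg) auto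

text \<open>By \<open>w_le\<close> one sample contributes at most \<open>b\<close> to the mass.
  After division by \<open>b\<close> the samples lie between 0 and 1 and have mean
  \<open>1 / k\<close>, so the tail depends neither on \<open>b\<close> nor on \<open>d\<close>. The
  threshold is half of the expected mass.\<close>

lemma pr_light:
  assumes b: "b = card (supp u)" "0 < b"
  shows "pr (\<lambda>x. mass x (supp u) < real t * real b / (2 * real k))
     \<le> exp (- real t / (16 * real k))"
proof -
  define y where "y j = real (w j) * of_bool (j \<in> supp u) / real b" for j
  have y01: "0 \<le> y j" "y j \<le> 1" for j
    using b w_le[of j u] by (auto simp: y_def)
  have Ey: "(\<Sum>j\<le>d. p j * y j) = 1 / real k"
  proof -
    have "(\<Sum>j\<le>d. p j * (real (w j) * (of_bool (j \<in> supp u) / real b)))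
      = (\<Sum>j\<in>supp u. of_bool (j \<in> supp u) / real b) / real k"
      by (rule sum_p_active) auto
    also have "(\<Sum>j\<in>supp u. of_bool (j \<in> supp u) / real b) = (\<Sum>j\<in>supp u. 1 / real b)"
      by (rule sum.cong) auto
    also have "\<dots> = 1"
      using b(2) by (simp add: b(1)[symmetric])
    finally show ?thesis by (simp add: y_def)
  qed
  \<comment> \<open>The tilt is \<open>1 / 4\<close>, applied to the threshold
    \<open>1 / (2 * k)\<close> per sample. As \<open>y^2 \<le> y\<close>, the second order term
    costs only \<open>y / 16\<close>; the exponent arises from
    \<open>1 / 8 - 3 / 16 = - 1 / 16\<close>.\<close>
  define h where "h j = 1 / (8 * real k) - y j / 4" for j
  have "(\<Sum>j\<le>d. p j * exp (h j)) \<le> (\<Sum>j\<le>d. p j * (exp (1 / (8 * real k)) * (1 - 3 / 16 * y j)))"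
  proof (intro sum_mono mult_left_mono p_nonneg)
    fix j
    have "exp (h j) = exp (1 / (8 * real k)) * exp (- (y j / 4))"
      by (simp add: h_def flip: exp_add)
    also have "exp (- (y j / 4)) \<le> 1 - y j / 4 + (y j / 4)\<^sup>2"
      by (rule exp_minus_bound) (use y01 in auto)
    also have "\<dots> \<le> 1 - 3 / 16 * y j"
      using mult_left_mono[OF y01(2) y01(1), of j j] by (simp add: power2_eq_square)
    finally show "exp (h j) \<le> exp (1 / (8 * real k)) * (1 - 3 / 16 * y j)" by simp
  qed
  also have "\<dots> = exp (1 / (8 * real k)) * ((\<Sum>j\<le>d. p j) - 3 / 16 * (\<Sum>j\<le>d. p j * y j))"
  proof -
    have "(\<Sum>j\<le>d. p j * (c * (1 - 3 / 16 * y j))) = c * ((\<Sum>j\<le>d. p j) - 3 / 16 * (\<Sum>j\<le>d. p j * y j))" for c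
      by (simp add: sum_distrib_left sum_subtractf right_diff_distrib mult_ac)
    then show ?thesis .
  qed
  also have "\<dots> = exp (1 / (8 * real k)) * (1 - 3 / 16 * (1 / real k))"
    by (simp only: sum_p Ey)
  also have "\<dots> \<le> exp (1 / (8 * real k)) * exp (- (3 / 16 * (1 / real k)))"
    using exp_ge_add_one_self[of "- (3 / 16 * (1 / real k))"] by (intro mult_left_mono) auto
  also have "\<dots> = exp (- 1 / (16 * real k))"
    by (simp flip: exp_add)
  finally have "pr (\<lambda>x. mass x (supp u) < real t * real b / (2 * real k))
     \<le> exp (real t * (- 1 / (16 * real k)))"
  proof (rule pr_chernoff)
    fix x assume "mass x (supp u) < real t * real b / (2 * real k)"
    then have "(\<Sum>l<t. y (x l)) < real t / (2 * real k)"
      unfolding y_def using b by (simp add: sum_divide_distrib[symmetric] field_simps)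
    then show "0 \<le> (\<Sum>l<t. h (x l))"
      by (simp add: h_def sum_subtractf sum_divide_distrib[symmetric])
  qed
  then show ?thesis by simp
qed

text \<open>\<open>phi\<close> stands for the difference of the error indicators of two candidates,
  and \<open>Delta\<close> for the true gap between their errors. The normalised samples
  \<open>y\<close> satisfy \<open>\<bar>y j\<bar> \<le> 1\<close>, so their second moment is at most
  their first absolute moment, which is at most \<open>1 / k\<close>.\<close>

lemma pr_moderate:
  assumes b: "b = card (supp u)"
    and phi: "\<And>j. \<bar>phi j\<bar> \<le> 1" "\<And>j. j \<notin> supp u \<Longrightarrow> phi j = 0"
    and Delta: "Delta = (\<Sum>j\<in>supp u. phi j)" "0 < Delta"
  shows "pr (\<lambda>x. (\<Sum>l<t. real (w (x l)) * phi (x l)) \<le> 0) \<le> exp (- real t * Delta\<^sup>2 / (4 * real k * (real b)\<^sup>2))"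
proof -
  have Db: "Delta \<le> real b"
  proof -
    have "Delta \<le> (\<Sum>j\<in>supp u. 1)" unfolding Delta by (rule sum_mono) (use phi in \<open>auto simp: abs_le_iff\<close>)
    then show ?thesis by (simp add: b)
  qed
  then have b0: "0 < real b" using Delta by simp
  \<comment> \<open>This value minimises \<open>- eta * Delta / (k * b) + eta^2 / k\<close>.\<close>
  define eta where "eta = Delta / (2 * real b)"
  have eta: "0 < eta" "eta \<le> 1 / 2" using Delta b0 Db by (auto simp: eta_def field_simps)
  define y where "y j = real (w j) * phi j / real b" for j
  have ya: "\<bar>y j\<bar> \<le> 1" for j
  proof (cases "j \<in> supp u")
    case True
    then have "real (w j) * \<bar>phi j\<bar> \<le> real b * 1"
      using w_le[of j u] phi b by (intro mult_mono) auto
    then show ?thesis using b0 by (simp add: y_def abs_mult)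
  qed (simp add: y_def phi)
  have Ey: "(\<Sum>j\<le>d. p j * y j) = Delta / (real k * real b)"
  proof -
    have "(\<Sum>j\<le>d. p j * (real (w j) * (phi j / real b))) = (\<Sum>j\<in>supp u. phi j / real b) / real k"
      by (rule sum_p_active) (use phi in auto)
    then show ?thesis by (simp add: y_def Delta sum_divide_distrib[symmetric] field_simps)
  qed
  have Ey2: "(\<Sum>j\<le>d. p j * (y j)\<^sup>2) \<le> 1 / real k"
  proof -
    have "(\<Sum>j\<le>d. p j * (y j)\<^sup>2) \<le> (\<Sum>j\<le>d. p j * (real (w j) * (\<bar>phi j\<bar> / real b)))"
    proof (intro sum_mono mult_left_mono p_nonneg)
      fix j
      have "(y j)\<^sup>2 = \<bar>y j\<bar> * \<bar>y j\<bar>" by (simp add: power2_eq_square)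
      also have "\<dots> \<le> 1 * \<bar>y j\<bar>" using ya by (intro mult_right_mono) auto
      finally show "(y j)\<^sup>2 \<le> real (w j) * (\<bar>phi j\<bar> / real b)" by (simp add: y_def abs_mult)
    qed
    also have "\<dots> = (\<Sum>j\<in>supp u. \<bar>phi j\<bar> / real b) / real k"
      by (rule sum_p_active) (use phi in auto)
    also have "(\<Sum>j\<in>supp u. \<bar>phi j\<bar> / real b) \<le> (\<Sum>j\<in>supp u. 1 / real b)"
      using phi b0 by (intro sum_mono divide_right_mono) auto
    also have "\<dots> = 1" using b0 by (simp add: b[symmetric])
    finally show ?thesis by (simp add: divide_right_mono)
  qed
  have "(\<Sum>j\<le>d. p j * exp (- (eta * y j))) \<le> (\<Sum>j\<le>d. p j * (1 - eta * y j + (eta * y j)\<^sup>2))"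
  proof (intro sum_mono mult_left_mono p_nonneg)
    fix j
    have "\<bar>eta * y j\<bar> \<le> 1 * 1"
      unfolding abs_mult using ya eta by (intro mult_mono) auto
    then show "exp (- (eta * y j)) \<le> 1 - eta * y j + (eta * y j)\<^sup>2"
      using exp_minus_bound[of "eta * y j"] exp_bound[of "- (eta * y j)"]
      by (cases "0 \<le> eta * y j") auto
  qed
  also have "\<dots> = (\<Sum>j\<le>d. p j) - eta * (\<Sum>j\<le>d. p j * y j) + eta\<^sup>2 * (\<Sum>j\<le>d. p j * (y j)\<^sup>2)"
    by (simp add: sum_distrib_left sum_subtractf sum.distrib algebra_simps power_mult_distrib)
  also have "\<dots> \<le> 1 - eta * (Delta / (real k * real b)) + eta\<^sup>2 * (1 / real k)"
    unfolding sum_p Ey using mult_left_mono[OF Ey2, of "eta\<^sup>2"] by simp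
  also have "\<dots> = 1 + - (Delta\<^sup>2 / (4 * real k * (real b)\<^sup>2))"
    unfolding eta_def using b0 k_pos by (simp add: field_simps power2_eq_square)
  also have "\<dots> \<le> exp (- (Delta\<^sup>2 / (4 * real k * (real b)\<^sup>2)))"
    by (rule exp_ge_add_one_self)
  finally have "pr (\<lambda>x. (\<Sum>l<t. real (w (x l)) * phi (x l)) \<le> 0) \<le> exp (real t * - (Delta\<^sup>2 / (4 * real k * (real b)\<^sup>2)))"
  proof (rule pr_chernoff)
    fix x assume "(\<Sum>l<t. real (w (x l)) * phi (x l)) \<le> 0"
    then have "(\<Sum>l<t. real (w (x l)) * phi (x l)) * (eta / real b) \<le> 0"
      using eta b0 by (intro mult_nonpos_nonneg) auto
    then show "0 \<le> (\<Sum>l<t. - (eta * y (x l)))"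
      by (simp add: sum_negf sum_distrib_left sum_distrib_right y_def field_simps)
  qed
  then show ?thesis by simp
qed

text \<open>The expected mass of \<open>e\<close> is at most \<open>t * r / k\<close>, and the
  threshold exceeds this more than eightfold. The tilt may grow with \<open>b / r\<close>, so the
  probability decays like a power of \<open>r / b\<close>. This absorbs the factor \<open>b\<close>,
  which bounds the loss, and leaves a multiple of \<open>r\<close>.\<close>

lemma pr_heavy:
  assumes b: "b = card (supp u)" and e: "e \<subseteq> supp u" "card e \<le> r" and br: "32 * r < b"
    and kt: "8 * k \<le> t"
  shows "real b * pr (\<lambda>x. real t * real b / (4 * real k) \<le> mass x e)
    \<le> 32 * real r * exp (- real t / (8 * real k))"
proof (cases "r = 0")
  case True
  then have "e = {}" using e finite_subset[OF e(1)] by auto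
  moreover have "0 < real t * real b / (4 * real k)" using k_pos t_pos br by simp
  ultimately have "pr (\<lambda>x. real t * real b / (4 * real k) \<le> mass x e) = 0"
    unfolding pr_def by simp
  then show ?thesis by simp
next
  case False
  \<comment> \<open>With the tilt \<open>ln y\<close> the moment of one sample is bounded by
    \<open>1 + y * r / (k * b)\<close>, and this \<open>y\<close> makes the second term
    \<open>1 / (8 * k)\<close>. The assumption \<open>32 * r < b\<close> makes \<open>y\<close>
    exceed 4, so that \<open>ln y\<close> is at least 1.\<close>
  define y where "y = real b / (8 * real r)"
  have y: "4 < y" using False br by (simp add: y_def field_simps)
  define th where "th = ln y"
  have "exp 1 \<le> y" using exp_le y by simp
  then have th: "1 \<le> th" "exp th = y" unfolding th_def using y by (auto simp: ln_ge_iff)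
  define z where "z j = real (w j) * of_bool (j \<in> e) / real b" for j
  have b0: "0 < real b" using br by simp
  have z01: "0 \<le> z j" "z j \<le> 1" for j
    using b b0 w_le[of j u] e by (auto simp: z_def)
  have Ez: "(\<Sum>j\<le>d. p j * z j) \<le> real r / (real k * real b)"
  proof -
    have "(\<Sum>j\<le>d. p j * (real (w j) * (of_bool (j \<in> e) / real b))) = (\<Sum>j\<in>e. of_bool (j \<in> e) / real b) / real k"
      by (rule sum_p_active) (use e finite_subset[OF e(1)] in auto)
    also have "\<dots> = real (card e) / (real k * real b)" by simp
    also have "\<dots> \<le> real r / (real k * real b)" using e by (intro divide_right_mono) auto
    finally show ?thesis by (simp add: z_def)
  qed
  define h where "h j = th * z j - th / (4 * real k)" for j
  have "(\<Sum>j\<le>d. p j * exp (h j)) \<le> (\<Sum>j\<le>d. p j * (exp (- (th / (4 * real k))) * (1 + y * z j)))"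
  proof (intro sum_mono mult_left_mono p_nonneg)
    fix j
    have "exp (h j) = exp (- (th / (4 * real k))) * exp (th * z j)"
      by (simp add: h_def flip: exp_add)
    also have "exp (th * z j) \<le> 1 + y * z j"
    proof (cases "j \<in> e")
      case True
      \<comment> \<open>Convexity: the exponential lies below its chord over the interval from 0 to
        \<open>th\<close>.\<close>
      have "exp ((1 - z j) *\<^sub>R 0 + z j *\<^sub>R th) \<le> (1 - z j) * exp 0 + z j * exp th"
        using convex_onD[OF exp_convex, of "z j" 0 th] z01 by auto
      then show ?thesis using th z01[of j] by (simp add: algebra_simps)
    qed (simp add: z_def)
    finally show "exp (h j) \<le> exp (- (th / (4 * real k))) * (1 + y * z j)" by simp
  qed
  also have "\<dots> = exp (- (th / (4 * real k))) * ((\<Sum>j\<le>d. p j) + y * (\<Sum>j\<le>d. p j * z j))"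
  proof -
    have "(\<Sum>j\<le>d. p j * (c * (1 + y * z j))) = c * ((\<Sum>j\<le>d. p j) + y * (\<Sum>j\<le>d. p j * z j))" for c
      by (simp add: sum_distrib_left sum.distrib distrib_left mult_ac)
    then show ?thesis .
  qed
  also have "\<dots> \<le> exp (- (th / (4 * real k))) * (1 + y * (real r / (real k * real b)))"
    unfolding sum_p using y Ez by (intro mult_left_mono add_left_mono) auto
  also have "y * (real r / (real k * real b)) = 1 / (8 * real k)"
    using False b0 k_pos by (simp add: y_def)
  also have "exp (- (th / (4 * real k))) * (1 + 1 / (8 * real k)) \<le> exp (- (th / (4 * real k))) * exp (1 / (8 * real k))"
    using exp_ge_add_one_self by (intro mult_left_mono) auto
  also have "\<dots> = exp (1 / (8 * real k) - th / (4 * real k))" by (simp flip: exp_add)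
  finally have "pr (\<lambda>x. real t * real b / (4 * real k) \<le> mass x e)
     \<le> exp (real t * (1 / (8 * real k) - th / (4 * real k)))"
  proof (rule pr_chernoff)
    fix x assume "real t * real b / (4 * real k) \<le> mass x e"
    then have "real t / (4 * real k) \<le> (\<Sum>l<t. z (x l))"
      unfolding z_def using b0 by (simp add: sum_divide_distrib[symmetric] field_simps)
    then have "th * (real t / (4 * real k)) \<le> th * (\<Sum>l<t. z (x l))"
      using th by (intro mult_left_mono) auto
    then show "0 \<le> (\<Sum>l<t. h (x l))"
      by (simp add: h_def sum_subtractf sum_distrib_left[symmetric] mult.commute)
  qed
  then have "real b * pr (\<lambda>x. real t * real b / (4 * real k) \<le> mass x e)
     \<le> real b * exp (real t * (1 / (8 * real k) - th / (4 * real k)))"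
    using b0 by (intro mult_left_mono) auto
  also have "real b * exp (real t * (1 / (8 * real k) - th / (4 * real k))) =
      8 * real r * exp th * exp (real t * (1 / (8 * real k) - th / (4 * real k)))"
    using th False by (simp add: y_def)
  also have "8 * real r * exp th * exp (real t * (1 / (8 * real k) - th / (4 * real k)))
     = 8 * real r * exp (th + real t * (1 / (8 * real k) - th / (4 * real k)))"
    by (simp only: exp_add mult.assoc)
  also have "\<dots> \<le> 8 * real r * exp (1 - real t / (8 * real k))"
  proof -
    define tau where "tau = real t / (8 * real k)"
    have tau: "1 \<le> tau" using kt k_pos by (simp add: tau_def field_simps del: of_nat_mult)
    have eq: "real t * (1 / (8 * real k) - th / (4 * real k)) = tau - 2 * tau * th"
      using k_pos by (simp add: tau_def field_simps)
    \<comment> \<open>A single \<open>th\<close> in the exponent comes from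
      \<open>b = 8 * r * exp th\<close>; as \<open>tau\<close> and \<open>th\<close> are at least 1,
      the term \<open>- 2 * tau * th\<close> pays for it and still leaves
      \<open>- tau\<close>.\<close>
    have "0 \<le> (2 * tau - 1) * (th - 1)" using tau th by simp
    then have "th + (tau - 2 * tau * th) \<le> 1 - tau" by (simp add: algebra_simps)
    then have "exp (th + real t * (1 / (8 * real k) - th / (4 * real k))) \<le> exp (1 - real t / (8 * real k))"
      unfolding eq by (simp only: exp_le_cancel_iff tau_def)
    then show ?thesis by (intro mult_left_mono) auto
  qed
  also have "\<dots> = (8 * exp 1 * real r) * exp (- real t / (8 * real k))"
  proof -
    have "exp (1 - a) = exp 1 * exp (- a)" for a :: real
      by (simp flip: exp_add)
    from this[of "real t / (8 * real k)"] show ?thesis by simp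
  qed
  also have "\<dots> \<le> (32 * real r) * exp (- real t / (8 * real k))"
  proof (rule mult_right_mono)
    show "8 * exp 1 * real r \<le> 32 * real r" using exp_le by (intro mult_right_mono) auto
  qed simp
  finally show ?thesis .
qed

section \<open>The loss caused by choosing coefficients on the sample\<close>

definition representative :: "(nat \<Rightarrow> nat) \<Rightarrow> bool" where
  "representative x \<longleftrightarrow> (\<forall>u. real t * real (card (supp u)) / (2 * real k)
      \<le> mass x (supp u))"

definition err :: "(nat \<Rightarrow> 'a) \<Rightarrow> (nat \<Rightarrow> 'a) \<Rightarrow> nat" where
  "err a u = card {j. j < d \<and> a j \<noteq> codeword u j}"

definition est :: "(nat \<Rightarrow> 'a) \<Rightarrow> (nat \<Rightarrow> nat) \<Rightarrow> (nat \<Rightarrow> 'a) \<Rightarrow> nat" where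
  "est a x u = (\<Sum>l<t. w (x l) * of_bool (x l < d \<and> a (x l) \<noteq> codeword u (x l)))"

text \<open>A gap of at most 32 times the optimal error is met by the second moment bound. A larger gap would lead to a
  failure probability that does not decay with the gap; on a representative sample, failure forces the few errors
  of the optimal row to be sampled far too often, which is unlikely enough to pay for the gap.\<close>

lemma pr_bad_candidate:
  fixes \<epsilon> :: real
  assumes eps: "0 < \<epsilon>" "\<epsilon> < 1"
    and t: "128 * real CARD('a) ^ k / \<epsilon> \<le> exp (real t * \<epsilon>\<^sup>2 / (144 * real k))"
    and far: "(1 + \<epsilon> / 2) * real (err a us) < real (err a u)"
  shows "(real (err a u) - real (err a us)) * pr (\<lambda>x. representative x \<and> est a x u \<le> est a x us)
     \<le> \<epsilon> / 4 * real (err a us) / real CARD('a) ^ k"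
proof -
  define r where "r = err a us"
  define Delta where "Delta = real (err a u) - real r"
  define c where "c = (\<lambda>m. u m - 1 * us m)"
  define b where "b = card (supp c)"
  define e where "e = {j \<in> supp c. a j \<noteq> codeword us j}"
  define phi :: "nat \<Rightarrow> real" where "phi j = of_bool (j < d \<and> a j \<noteq> codeword u j)
      - of_bool (j < d \<and> a j \<noteq> codeword us j)" for j
  define E where "E = exp (- real t * \<epsilon>\<^sup>2 / (144 * real k))"
  let ?bad = "\<lambda>x. representative x \<and> est a x u \<le> est a x us"
  have lc: "codeword c j = codeword u j - codeword us j" for j
    unfolding c_def lincomb_diff_scale by simp
  have q1: "1 \<le> real CARD('a) ^ k" by (intro one_le_power) (rule real_card_ge_1)
  have E: "E \<le> \<epsilon> / (128 * real CARD('a) ^ k)"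
  proof -
    have "E = 1 / exp (real t * \<epsilon>\<^sup>2 / (144 * real k))" 
      by (simp only: E_def mult_minus_left minus_divide_left[symmetric] exp_minus inverse_eq_divide)
    also have "\<dots> \<le> 1 / (128 * real CARD('a) ^ k / \<epsilon>)"
    proof (rule divide_left_mono[OF t])
      have "0 < 128 * real CARD('a) ^ k / \<epsilon>" by (rule divide_pos_pos) (use q1 eps in linarith)+
      then show "0 < exp (real t * \<epsilon>\<^sup>2 / (144 * real k)) * (128 * real CARD('a) ^ k / \<epsilon>)"
        by (intro mult_pos_pos exp_gt_zero)
    qed simp
    finally show ?thesis by simp
  qed
  \<comment> \<open>The left side of the hypothesis \<open>t\<close> is at least 128, which forces
    the exponent on its right side above 1. The heavy tail below needs
    \<open>8 * k \<le> t\<close>.\<close>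
  have t144: "144 * real k \<le> real t"
  proof -
    have "exp 1 < 128 * real CARD('a) ^ k / \<epsilon>"
    proof -
      have "128 \<le> 128 * real CARD('a) ^ k" using q1 by linarith
      also have "\<dots> \<le> 128 * real CARD('a) ^ k / \<epsilon>"
        using mult_left_mono[of \<epsilon> 1 "128 * real CARD('a) ^ k"] eps q1
        by (subst pos_le_divide_eq) (auto simp del: mult_le_cancel_left1)
      finally show ?thesis using exp_le by linarith
    qed
    then have "exp 1 < exp (real t * \<epsilon>\<^sup>2 / (144 * real k))" using t by linarith
    then have "144 * real k < real t * \<epsilon>\<^sup>2" using k_pos by (simp add: field_simps)
    also have "\<dots> \<le> real t * 1" using eps by (intro mult_left_mono) (auto simp: power_le_one)
    finally show ?thesis by simp
  qed
  have Dfar: "\<epsilon> / 2 * real r < Delta" using far by (simp add: Delta_def r_def algebra_simps)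
  have Dpos: "0 < Delta" 
  proof -
    have "0 \<le> \<epsilon> / 2 * real r" using eps by simp
    then show ?thesis using Dfar by linarith
  qed
  have phi: "\<bar>phi j\<bar> \<le> 1" "j \<notin> supp c \<Longrightarrow> phi j = 0" for j by (auto simp: phi_def lc)
  have sphi: "Delta = (\<Sum>j\<in>supp c. phi j)"
  proof -
    have *: "(\<Sum>j<d. of_bool (j < d \<and> P j)) = real (card {j. j < d \<and> P j})" for P
      by (subst sum_of_bool_eq) (auto intro!: arg_cong[of _ _ card])
    have "(\<Sum>j\<in>supp c. phi j) = (\<Sum>j<d. phi j)"
      by (rule sum.mono_neutral_left) (use phi in auto)
    also have "\<dots> = Delta"
      unfolding phi_def sum_subtractf * Delta_def r_def err_def ..
    finally show ?thesis by simp
  qed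
  have b_le: "real b \<le> 2 * real r + Delta"
  proof -
    have "b \<le> card ({j. j < d \<and> a j \<noteq> codeword u j} \<union> {j. j < d \<and> a j \<noteq> codeword us j})"
      unfolding b_def by (rule card_mono) (auto simp: lc)
    also have "\<dots> \<le> err a u + r" unfolding err_def r_def by (rule card_Un_le)
    finally show ?thesis by (simp add: Delta_def)
  qed
  have Db: "Delta \<le> real b"
  proof -
    have "Delta \<le> (\<Sum>j\<in>supp c. 1)" unfolding sphi by (rule sum_mono) (use phi in \<open>auto simp: abs_le_iff\<close>)
    then show ?thesis by (simp add: b_def)
  qed
  have card_e: "card e \<le> r" unfolding e_def r_def err_def by (rule card_mono) auto
  have est: "(\<Sum>l<t. real (w (x l)) * phi (x l)) = real (est a x u) - real (est a x us)" for x
    by (simp add: est_def phi_def sum_subtractf right_diff_distrib)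
  \<comment> \<open>Both cases aim at the same bound. Since \<open>E\<close> is at most
    \<open>\<epsilon> / (128 * CARD('a) ^ k)\<close>, the quotient \<open>32 / 128\<close> becomes
    the \<open>1 / 4\<close> of the claim.\<close>
  have "Delta * pr ?bad \<le> 32 * real r * E"
  proof (cases "Delta \<le> 32 * real r")
    case True
    \<comment> \<open>As \<open>u\<close> is far, \<open>r\<close> is at most
      \<open>2 * Delta / \<epsilon>\<close>, so the difference codeword has weight at most
      \<open>5 * Delta / \<epsilon>\<close>. This gives \<open>4 * 25 = 100\<close> in the
      denominator of the exponent; 144 is a weaker, convenient value.\<close>
    have "real r \<le> 2 * Delta / \<epsilon>" using Dfar eps by (simp add: field_simps)
    moreover have "Delta \<le> Delta / \<epsilon>" using Dpos eps by (simp add: field_simps)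
    ultimately have "real b \<le> 5 * Delta / \<epsilon>" using b_le by simp
    then have "(real b)\<^sup>2 \<le> (5 * Delta / \<epsilon>)\<^sup>2" by (intro power_mono) auto
    then have b2: "(real b)\<^sup>2 * \<epsilon>\<^sup>2 \<le> 25 * Delta\<^sup>2"
      using eps by (simp add: power_divide power_mult_distrib field_simps)
    have b0: "0 < real b" using Db Dpos by linarith
    have "pr ?bad \<le> pr (\<lambda>x. (\<Sum>l<t. real (w (x l)) * phi (x l)) \<le> 0)"
      by (rule pr_mono) (simp add: est)
    also have "\<dots> \<le> exp (- real t * Delta\<^sup>2 / (4 * real k * (real b)\<^sup>2))"
      by (rule pr_moderate[OF b_def phi sphi Dpos])
    also have "\<dots> \<le> E"
    proof -
      have "\<epsilon>\<^sup>2 / (144 * real k) \<le> Delta\<^sup>2 / (4 * real k * (real b)\<^sup>2)"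
      proof -
        have "\<epsilon>\<^sup>2 * (4 * real k * (real b)\<^sup>2) = 4 * real k * ((real b)\<^sup>2 * \<epsilon>\<^sup>2)" by simp
        also have "\<dots> \<le> 4 * real k * (25 * Delta\<^sup>2)" by (intro mult_left_mono b2) auto
        also have "\<dots> \<le> Delta\<^sup>2 * (144 * real k)" by simp
        finally show ?thesis using b0 k_pos by (simp add: divide_le_eq le_divide_eq pos_divide_le_eq pos_le_divide_eq mult_ac)
      qed
      then have "real t * (\<epsilon>\<^sup>2 / (144 * real k)) \<le> real t * (Delta\<^sup>2 / (4 * real k * (real b)\<^sup>2))"
        by (intro mult_left_mono) auto
      then show ?thesis by (simp add: E_def)
    qed
    finally have "Delta * pr ?bad \<le> 32 * real r * E"
      using True Dpos by (intro mult_mono) (auto simp: E_def pr_def intro!: sum_nonneg mult_nonneg_nonneg weight_nonneg)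
    then show ?thesis .
  next
    case False
    have "pr ?bad \<le> pr (\<lambda>x. real t * real b / (4 * real k) \<le> mass x e)"
    proof (rule pr_mono)
      fix x assume "?bad x"
      then have x: "representative x" "(\<Sum>l<t. real (w (x l)) * phi (x l)) \<le> 0" by (simp_all add: est)
      have "real t * real b / (2 * real k) \<le> mass x (supp c)"
        using x(1) unfolding representative_def b_def by blast
      \<comment> \<open>On the support of \<open>c\<close>, \<open>phi\<close> is 1 outside
        \<open>e\<close> and at least -1 on \<open>e\<close>. So if the \<open>phi\<close> terms sum
        to at most 0, then \<open>e\<close> carries at least half of the mass of the
        support.\<close>
      also have "\<dots> \<le> (\<Sum>l<t. real (w (x l)) * (phi (x l) + 2 * of_bool (x l \<in> e)))"
        by (intro sum_mono mult_left_mono) (auto simp: phi_def e_def lc)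
      also have "\<dots> = (\<Sum>l<t. real (w (x l)) * phi (x l)) + 2 * mass x e"
        by (simp only: distrib_left sum.distrib sum_distrib_left mult.left_commute)
      finally show "real t * real b / (4 * real k) \<le> mass x e"
        using x(2) by simp
    qed
    then have "Delta * pr ?bad \<le> real b * pr (\<lambda>x. real t * real b / (4 * real k) \<le> mass x e)"
      using Db Dpos by (intro mult_mono) (auto simp: pr_def intro!: sum_nonneg mult_nonneg_nonneg weight_nonneg)
    also have "\<dots> \<le> 32 * real r * exp (- real t / (8 * real k))"
    proof (rule pr_heavy[OF b_def _ card_e])
      show "e \<subseteq> supp c" by (auto simp: e_def)
      show "32 * r < b" using False Db by linarith
      show "8 * k \<le> t" using t144 by linarith
    qed
    also have "\<dots> \<le> 32 * real r * E"
    proof -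
      have "\<epsilon>\<^sup>2 / (144 * real k) \<le> 1 / (144 * real k)"
        using eps k_pos by (intro divide_right_mono) (auto simp: power_le_one)
      also have "\<dots> \<le> 1 / (8 * real k)" using k_pos by (simp add: field_simps)
      finally have "real t * (\<epsilon>\<^sup>2 / (144 * real k)) \<le> real t * (1 / (8 * real k))"
        by (intro mult_left_mono) auto
      then have "exp (- real t / (8 * real k)) \<le> E" by (simp add: E_def)
      then show ?thesis by (intro mult_left_mono) auto
    qed
    finally show ?thesis .
  qed
  also have "\<dots> \<le> 32 * real r * (\<epsilon> / (128 * real CARD('a) ^ k))" by (intro mult_left_mono E) auto
  also have "\<dots> = \<epsilon> / 4 * real r / real CARD('a) ^ k" by simp
  finally show ?thesis by (simp add: Delta_def r_def)
qed

section \<open>From expected loss to one good sample\<close>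

abbreviation "candidates \<equiv> PiE {..<k} (\<lambda>_. UNIV :: 'a set)"

lemma card_candidates: "card candidates = CARD('a) ^ k"
  by (subst card_PiE) auto

text \<open>Codewords depend only on the first \<open>k\<close> coefficients, so the finite set
  \<open>candidates\<close> represents all coefficient functions in the union bounds.\<close>

lemma lincomb_restrict: "codeword (restrict u {..<k}) = codeword u"
  by (auto simp: lincomb_def intro!: sum.cong)

lemma err_restrict: "err a (restrict u {..<k}) = err a u"
  by (simp add: err_def lincomb_restrict)

lemma est_restrict: "est a x (restrict u {..<k}) = est a x u"
  by (simp add: est_def lincomb_restrict)

lemma pr_Bex: "finite F \<Longrightarrow> pr (\<lambda>x. \<exists>u\<in>F. P u x) \<le> (\<Sum>u\<in>F. pr (P u))"
proof -
  assume F: "finite F"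
  have "pr (\<lambda>x. \<exists>u\<in>F. P u x) \<le> (\<Sum>x\<in>samples. (\<Prod>l<t. p (x l)) * (\<Sum>u\<in>F. of_bool (P u x)))"
    unfolding pr_def
  proof (intro sum_mono mult_left_mono weight_nonneg)
    fix x show "of_bool (\<exists>u\<in>F. P u x) \<le> (\<Sum>u\<in>F. of_bool (P u x) :: real)"
    proof (cases "\<exists>u\<in>F. P u x")
      case True
      then obtain u where "u \<in> F" "P u x" by blast
      then show ?thesis using member_le_sum[of u F "\<lambda>u. of_bool (P u x) :: real"] F by auto
    qed (simp add: sum_nonneg)
  qed
  also have "\<dots> = (\<Sum>u\<in>F. pr (P u))"
    unfolding pr_def sum_distrib_left by (rule sum.swap)
  finally show ?thesis .
qed

lemma pr_representative:
  assumes "2 * real CARD('a) ^ k \<le> exp (real t / (16 * real k))"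
  shows "1 / 2 \<le> pr representative"
proof -
  let ?P = "\<lambda>u x. mass x (supp u) < real t * real (card (supp u)) / (2 * real k)"
  have P: "pr (?P u) \<le> exp (- real t / (16 * real k))" for u
  proof (cases "card (supp u) = 0")
    case True
    have "\<not> ?P u x" for x unfolding True not_less by (simp add: sum_nonneg)
    then have "pr (?P u) = 0" unfolding pr_def by simp
    then show ?thesis by simp
  next
    case False
    then have "0 < card (supp u)" by (simp only: neq0_conv)
    then show ?thesis by (rule pr_light[OF refl])
  qed
  have fin: "finite candidates" by (intro finite_PiE) auto
  have "1 - pr representative = pr (\<lambda>x. \<not> representative x)"
    unfolding pr_def sum_weight[symmetric] sum_subtractf[symmetric] by (intro sum.cong) auto
  also have "\<dots> \<le> pr (\<lambda>x. \<exists>u\<in>candidates. ?P u x)"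
  proof (rule pr_mono)
    fix x assume "\<not> representative x"
    then obtain u where "?P u x" unfolding representative_def by (auto simp: not_le)
    then have "?P (restrict u {..<k}) x" by (simp add: lincomb_restrict)
    then show "\<exists>u\<in>candidates. ?P u x" by (intro bexI[of _ "restrict u {..<k}"]) auto
  qed
  also have "\<dots> \<le> (\<Sum>u\<in>candidates. pr (?P u))" by (rule pr_Bex[OF fin])
  also have "\<dots> \<le> (\<Sum>u\<in>candidates. exp (- real t / (16 * real k)))" by (intro sum_mono P)
  also have "\<dots> = real CARD('a) ^ k / exp (real t / (16 * real k))"
    by (simp only: sum_constant card_candidates minus_divide_left[symmetric] exp_minus of_nat_power divide_inverse[symmetric])
  also have "\<dots> \<le> 1 / 2" using assms by (simp add: field_simps)
  finally show ?thesis by simp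
qed

lemma exists_good_sample:
  fixes \<epsilon> :: real and A :: "nat \<Rightarrow> nat \<Rightarrow> 'a"
  assumes eps: "0 < \<epsilon>" "\<epsilon> < 1"
    and t: "128 * real CARD('a) ^ k / \<epsilon> \<le> exp (real t * \<epsilon>\<^sup>2 / (144 * real k))"
  shows "\<exists>x\<in>samples. \<forall>U. (\<forall>i<n. \<forall>u. est (A i) x (U i) \<le> est (A i) x u) \<longrightarrow>
      (\<Sum>i<n. real (err (A i) (U i))) \<le> (1 + \<epsilon>) * (\<Sum>i<n. real (err (A i) (Ub i)))"
proof -
  define R where "R = (\<Sum>i<n. real (err (A i) (Ub i)))"
  define far where "far i u \<longleftrightarrow> (1 + \<epsilon> / 2) * real (err (A i) (Ub i)) < real (err (A i) u)" for i u
  define gap where "gap i u = (real (err (A i) u) - real (err (A i) (Ub i))) * of_bool (far i u)" for i u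
  define X where "X x = (\<Sum>i<n. \<Sum>u\<in>candidates. gap i u * of_bool (est (A i) x u \<le> est (A i) x (Ub i)))" for x
  have q1: "1 \<le> real CARD('a) ^ k" by (intro one_le_power) (rule real_card_ge_1)
  have gap0: "0 \<le> gap i u" for i u
  proof -
    have "0 \<le> \<epsilon> / 2 * real (err (A i) (Ub i))" using eps by simp
    then show ?thesis by (auto simp: gap_def far_def algebra_simps)
  qed
  have "128 * real CARD('a) ^ k / 1 \<le> 128 * real CARD('a) ^ k / \<epsilon>"
    using eps q1 by (intro divide_left_mono) auto
  also note t
  also have "exp (real t * \<epsilon>\<^sup>2 / (144 * real k)) \<le> exp (real t / (16 * real k))"
  proof -
    have "real t * \<epsilon>\<^sup>2 / (144 * real k) \<le> real t * 1 / (16 * real k)"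
      using eps k_pos by (intro frac_le mult_left_mono) (auto simp: power_le_one)
    then show ?thesis by simp
  qed
  finally have rep2: "1 / 2 \<le> pr representative" using q1 by (intro pr_representative) linarith
  have "(\<Sum>x\<in>samples. (\<Prod>l<t. p (x l)) * (of_bool (representative x) * X x))
     = (\<Sum>i<n. \<Sum>u\<in>candidates. gap i u * pr (\<lambda>x. representative x \<and> est (A i) x u \<le> est (A i) x (Ub i)))"
    unfolding X_def pr_def sum_distrib_left
    by (subst sum.swap, rule sum.cong, simp, subst sum.swap) (intro sum.cong, auto)
  also have "\<dots> \<le> (\<Sum>i<n. \<Sum>u\<in>candidates. \<epsilon> / 4 * real (err (A i) (Ub i)) / real CARD('a) ^ k)"
  proof (intro sum_mono)
    fix i u
    show "gap i u * pr (\<lambda>x. representative x \<and> est (A i) x u \<le> est (A i) x (Ub i))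
      \<le> \<epsilon> / 4 * real (err (A i) (Ub i)) / real CARD('a) ^ k"
      using pr_bad_candidate[OF eps t, of "A i" "Ub i" u] eps by (cases "far i u") (auto simp: gap_def far_def)
  qed
  also have "\<dots> = \<epsilon> / 4 * R"
    using q1 by (simp add: card_candidates R_def sum_distrib_left)
  finally have EX: "(\<Sum>x\<in>samples. (\<Prod>l<t. p (x l)) * (of_bool (representative x) * X x)) \<le> \<epsilon> / 4 * R" .
  have "\<exists>x\<in>samples. X x \<le> \<epsilon> / 2 * R"
  proof (rule ccontr)
    assume "\<not> ?thesis"
    then have gt: "\<And>x. x \<in> samples \<Longrightarrow> \<epsilon> / 2 * R < X x" by force
    \<comment> \<open>\<open>R\<close> may be 0, so the averaging argument needs a strict
      inequality, which comes from a representative sample of positive probability.\<close>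
    have "\<exists>x\<in>samples. (\<Prod>l<t. p (x l)) * of_bool (representative x) \<noteq> 0"
    proof (rule ccontr)
      assume "\<not> ?thesis"
      then have "pr representative = 0" unfolding pr_def by (intro sum.neutral) auto
      with rep2 show False by simp
    qed
    then obtain x where x: "x \<in> samples" "(\<Prod>l<t. p (x l)) * of_bool (representative x) \<noteq> 0" by blast
    then have "0 < (\<Prod>l<t. p (x l))" "representative x" using weight_nonneg[of x] by (auto simp: less_le)
    have "(\<Sum>x\<in>samples. (\<Prod>l<t. p (x l)) * (of_bool (representative x) * (\<epsilon> / 2 * R))) < (\<Sum>x\<in>samples. (\<Prod>l<t. p (x l)) * (of_bool (representative x) * X x))"
    proof (rule sum_strict_mono_ex1[OF finite_samples])
      show "\<forall>x\<in>samples. (\<Prod>l<t. p (x l)) * (of_bool (representative x) * (\<epsilon> / 2 * R)) \<le> (\<Prod>l<t. p (x l)) * (of_bool (representative x) * X x)"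
        using gt by (intro ballI mult_left_mono weight_nonneg) (auto simp: less_imp_le)
      show "\<exists>x\<in>samples. (\<Prod>l<t. p (x l)) * (of_bool (representative x) * (\<epsilon> / 2 * R)) < (\<Prod>l<t. p (x l)) * (of_bool (representative x) * X x)"
        using \<open>0 < (\<Prod>l<t. p (x l))\<close> \<open>representative x\<close> gt[OF x(1)] x(1)
        by (intro bexI[of _ x] mult_strict_left_mono) auto
    qed
    also have "(\<Sum>x\<in>samples. (\<Prod>l<t. p (x l)) * (of_bool (representative x) * (\<epsilon> / 2 * R))) = pr representative * (\<epsilon> / 2 * R)"
      unfolding pr_def sum_distrib_right by (simp add: mult_ac)
    finally have "pr representative * (\<epsilon> / 2 * R) < \<epsilon> / 4 * R" using EX by linarith
    moreover have "1 / 2 * (\<epsilon> / 2 * R) \<le> pr representative * (\<epsilon> / 2 * R)"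
      using rep2 eps by (intro mult_right_mono) (auto simp: R_def intro!: sum_nonneg mult_nonneg_nonneg)
    ultimately show False by linarith
  qed
  then obtain x where x: "x \<in> samples" "X x \<le> \<epsilon> / 2 * R" by blast
  show ?thesis
  proof (intro bexI[OF _ x(1)] allI impI)
    fix U assume U: "\<forall>i<n. \<forall>u. est (A i) x (U i) \<le> est (A i) x u"
    have "(\<Sum>i<n. real (err (A i) (U i))) \<le> (\<Sum>i<n. (1 + \<epsilon> / 2) * real (err (A i) (Ub i))
        + (\<Sum>u\<in>candidates. gap i u * of_bool (est (A i) x u \<le> est (A i) x (Ub i))))"
    proof (rule sum_mono)
      fix i assume "i \<in> {..<n}"
      let ?u = "restrict (U i) {..<k}"
      \<comment> \<open>A minimiser of the estimate looks no worse than \<open>Ub i\<close> on the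
        sample, so its gap is one of the terms of \<open>X\<close>.\<close>
      have "gap i ?u * of_bool (est (A i) x ?u \<le> est (A i) x (Ub i))
        \<le> (\<Sum>u\<in>candidates. gap i u * of_bool (est (A i) x u \<le> est (A i) x (Ub i)))"
        by (rule member_le_sum[of ?u candidates]) (simp_all add: gap0 finite_PiE)
      moreover have "real (err (A i) ?u) \<le> (1 + \<epsilon> / 2) * real (err (A i) (Ub i)) + gap i ?u"
        using eps by (auto simp: gap_def far_def algebra_simps)
      moreover have "est (A i) x ?u \<le> est (A i) x (Ub i)"
        using U \<open>i \<in> {..<n}\<close> by (simp add: est_restrict)
      ultimately show "real (err (A i) (U i)) \<le> (1 + \<epsilon> / 2) * real (err (A i) (Ub i))
        + (\<Sum>u\<in>candidates. gap i u * of_bool (est (A i) x u \<le> est (A i) x (Ub i)))"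
        by (simp add: err_restrict)
    qed
    also have "\<dots> = (1 + \<epsilon> / 2) * R + X x"
      by (simp add: sum.distrib R_def X_def sum_distrib_left)
    also have "\<dots> \<le> (1 + \<epsilon>) * R" using x(2) by (simp add: algebra_simps)
    finally show "(\<Sum>i<n. real (err (A i) (U i))) \<le> (1 + \<epsilon>) * (\<Sum>i<n. real (err (A i) (Ub i)))"
      by (simp add: R_def)
  qed
qed

end

text \<open>Turns the sample into data that can be guessed: genuine columns, weights bounded by
  \<open>d\<close>, and coefficient vectors \<open>Y l\<close> in place of the sampled columns of
  \<open>V\<close>.\<close>

lemma exists_good_columns:
  fixes \<epsilon> :: real and A :: "nat \<Rightarrow> nat \<Rightarrow> 'a::{finite,field}" and V :: "nat \<Rightarrow> nat \<Rightarrow> 'a"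
  assumes eps: "0 < \<epsilon>" "\<epsilon> < 1" and kdt: "0 < k" "0 < d" "0 < t"
    and t: "128 * real CARD('a) ^ k / \<epsilon> \<le> exp (real t * \<epsilon>\<^sup>2 / (144 * real k))"
  shows "\<exists>J w Y. (\<forall>l<t. J l < d \<and> 1 \<le> w l \<and> w l \<le> d) \<and>
    (\<forall>U. (\<forall>i<n. \<forall>u. (\<Sum>l<t. w l * of_bool (A i (J l) \<noteq> (\<Sum>m<k. U i m * Y l m)))
        \<le> (\<Sum>l<t. w l * of_bool (A i (J l) \<noteq> (\<Sum>m<k. u m * Y l m)))) \<longrightarrow>
      (\<Sum>i<n. real (card {j. j < d \<and> A i j \<noteq> (\<Sum>m<k. U i m * V m j)}))
      \<le> (1 + \<epsilon>) * (\<Sum>i<n. real (card {j. j < d \<and> A i j \<noteq> (\<Sum>m<k. Ub i m * V m j)})))"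
proof -
  obtain w where w: "\<And>j. 1 \<le> w j \<and> w j \<le> max 1 (card {..<d})"
     "\<And>u j. j\<in>{..<d} \<Longrightarrow> lincomb {..<k} V u j \<noteq> 0 \<Longrightarrow> w j \<le> card {i\<in>{..<d}. lincomb {..<k} V u i \<noteq> 0}"
     "(\<Sum>j\<in>{j\<in>{..<d}. \<exists>u. lincomb {..<k} V u j \<noteq> 0}. 1 / real (w j)) \<le> real (card {..<k})"
    using lincomb_weights[of "{..<k}" "{..<d}" V] by (auto simp del: card_lessThan)
  interpret column_sampling V w d k t
    by unfold_locales (use w kdt in auto)
  obtain x where x: "x \<in> samples" "\<And>U. (\<forall>i<n. \<forall>u. est (A i) x (U i) \<le> est (A i) x u) \<Longrightarrow>
      (\<Sum>i<n. real (err (A i) (U i))) \<le> (1 + \<epsilon>) * (\<Sum>i<n. real (err (A i) (Ub i)))"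
    using exists_good_sample[OF eps t, of n A Ub] by blast
  define J where "J l = (if x l < d then x l else 0)" for l
  define Y where "Y l m = (if x l < d then V m (x l) else 0)" for l m
  \<comment> \<open>What the samples at \<open>d\<close> add to a row. It does not depend on
    \<open>u\<close>, so comparing candidates by the weighted sum or by \<open>est\<close> is the
    same.\<close>
  define const where "const a = (\<Sum>l<t. w (x l) * of_bool (\<not> x l < d \<and> a (J l) \<noteq> 0))" for a :: "nat \<Rightarrow> 'a"
  have eq: "(\<Sum>l<t. w (x l) * of_bool (a (J l) \<noteq> (\<Sum>m<k. u m * Y l m))) = est a x u + const a" for a u
    unfolding est_def const_def sum.distrib[symmetric]
    by (intro sum.cong) (auto simp: J_def Y_def lincomb_def)
  have "\<forall>l<t. J l < d \<and> 1 \<le> w (x l) \<and> w (x l) \<le> d"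
    using w(1) kdt by (auto simp: J_def)
  then have "\<exists>w. (\<forall>l<t. J l < d \<and> 1 \<le> w l \<and> w l \<le> d) \<and>
    (\<forall>U. (\<forall>i<n. \<forall>u. (\<Sum>l<t. w l * of_bool (A i (J l) \<noteq> (\<Sum>m<k. U i m * Y l m)))
        \<le> (\<Sum>l<t. w l * of_bool (A i (J l) \<noteq> (\<Sum>m<k. u m * Y l m)))) \<longrightarrow>
      (\<Sum>i<n. real (card {j. j < d \<and> A i j \<noteq> (\<Sum>m<k. U i m * V m j)}))
      \<le> (1 + \<epsilon>) * (\<Sum>i<n. real (card {j. j < d \<and> A i j \<noteq> (\<Sum>m<k. Ub i m * V m j)})))"
    using x(2) unfolding err_def lincomb_def
    by (intro exI[of _ "\<lambda>l. w (x l)"] conjI) (simp_all only: eq add_le_cancel_right, blast)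
  then show ?thesis by blast
qed

section \<open>Reasoning about timed executions\<close>

abbreviation var :: "vname \<Rightarrow> aexp" where "var x \<equiv> Read x (Const 0)"
abbreviation assign :: "vname \<Rightarrow> aexp \<Rightarrow> com" where "assign x a \<equiv> Write x (Const 0) a"

fun mods :: "com \<Rightarrow> vname set" where
  "mods Skip = {}"
| "mods (Write x a b) = {x}"
| "mods (Seq c1 c2) = mods c1 \<union> mods c2"
| "mods (Cond b c1 c2) = mods c1 \<union> mods c2"
| "mods (While b c) = mods c"

lemma exec_mods: "exec W c s t s' \<Longrightarrow> \<forall>x. x \<notin> mods c \<longrightarrow> s' x = s x"
  by (induction rule: exec.induct) auto

text \<open>Total correctness with a time bound. The frame condition is built in, so postconditions
  need to describe the modified arrays only.\<close>

definition runs :: "nat \<Rightarrow> com \<Rightarrow> state \<Rightarrow> nat \<Rightarrow> (state \<Rightarrow> bool) \<Rightarrow> bool" where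
  "runs W c s T Q \<longleftrightarrow> (\<exists>t s'. exec W c s t s' \<and> t \<le> T \<and> Q s' \<and> (\<forall>x. x \<notin> mods c \<longrightarrow> s' x = s x))"

lemma runs_conseq:
  assumes "runs W c s T Q" "T \<le> T'"
    "\<And>s'. Q s' \<Longrightarrow> \<forall>x. x \<notin> mods c \<longrightarrow> s' x = s x \<Longrightarrow> Q' s'"
  shows "runs W c s T' Q'"
  using assms unfolding runs_def by (meson le_trans)

lemma runs_Skip: "Q s \<Longrightarrow> 1 \<le> T \<Longrightarrow> runs W Skip s T Q"
  unfolding runs_def by (blast intro: exec.Skip)

lemma runs_Write:
  "afits W a s \<Longrightarrow> afits W b s \<Longrightarrow> Q (s(x := (s x)(aval a s := aval b s))) \<Longrightarrow>
    1 + acost a + acost b \<le> T \<Longrightarrow> runs W (Write x a b) s T Q"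
  unfolding runs_def by (intro exI conjI) (rule exec.Write, auto)

lemma runs_Seq:
  assumes 1: "runs W c1 s T1 R"
    and 2: "\<And>s1. R s1 \<Longrightarrow> \<forall>x. x \<notin> mods c1 \<longrightarrow> s1 x = s x \<Longrightarrow> runs W c2 s1 T2 Q"
    and T: "T1 + T2 \<le> T"
  shows "runs W (Seq c1 c2) s T Q"
proof -
  obtain t1 s1 where s1: "exec W c1 s t1 s1" "t1 \<le> T1" "R s1" "\<forall>x. x \<notin> mods c1 \<longrightarrow> s1 x = s x"
    using 1 unfolding runs_def by blast
  obtain t2 s2 where s2: "exec W c2 s1 t2 s2" "t2 \<le> T2" "Q s2"
    using 2[OF s1(3,4)] unfolding runs_def by blast
  have "exec W (Seq c1 c2) s (t1 + t2) s2" by (rule exec.Seq[OF s1(1) s2(1)])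
  with s1 s2 T exec_mods[OF this] show ?thesis
    unfolding runs_def by (intro exI[of _ "t1 + t2"] exI[of _ s2]) simp
qed

lemma runs_Cond:
  assumes "bfits W b s"
    and "bval b s \<Longrightarrow> runs W c1 s T Q" "\<not> bval b s \<Longrightarrow> runs W c2 s T Q"
    and T: "1 + bcost b + T \<le> T'"
  shows "runs W (Cond b c1 c2) s T' Q"
proof (cases "bval b s")
  case True
  then obtain t s' where s: "exec W c1 s t s'" "t \<le> T" "Q s'" using assms(2) unfolding runs_def by blast
  have "exec W (Cond b c1 c2) s (1 + bcost b + t) s'" by (rule exec.CondTrue[OF assms(1) True s(1)])
  with s T exec_mods[OF this] show ?thesis
    unfolding runs_def by (intro exI[of _ "1 + bcost b + t"] exI[of _ s']) simp
next
  case False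
  then obtain t s' where s: "exec W c2 s t s'" "t \<le> T" "Q s'" using assms(3) unfolding runs_def by blast
  have "exec W (Cond b c1 c2) s (1 + bcost b + t) s'" by (rule exec.CondFalse[OF assms(1) False s(1)])
  with s T exec_mods[OF this] show ?thesis
    unfolding runs_def by (intro exI[of _ "1 + bcost b + t"] exI[of _ s']) simp
qed

text \<open>The index of \<open>I\<close> is the number of iterations still permitted. The loop may
  stop before it reaches 0, as the propagation of a carry does, and then only some
  \<open>j \<le> i\<close> is known.\<close>

lemma runs_While:
  assumes I: "I i s"
    and b: "\<And>i s. I i s \<Longrightarrow> bfits W b s"
    and step: "\<And>i s. I i s \<Longrightarrow> bval b s \<Longrightarrow> 0 < i \<and> runs W c s T (I (i - 1))"
  shows "runs W (While b c) s (i * (1 + bcost b + T) + 1 + bcost b) (\<lambda>s'. \<not> bval b s' \<and> (\<exists>j\<le>i. I j s'))"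
  using I
proof (induction i arbitrary: s)
  case 0
  then have "\<not> bval b s" using step by blast
  then have "exec W (While b c) s (1 + bcost b) s" by (intro exec.WhileFalse b[OF 0])
  with 0 \<open>\<not> bval b s\<close> show ?case
    unfolding runs_def by (intro exI[of _ "1 + bcost b"] exI[of _ s]) auto
next
  case (Suc i)
  show ?case
  proof (cases "bval b s")
    case False
    then have "exec W (While b c) s (1 + bcost b) s" by (intro exec.WhileFalse b[OF Suc.prems])
    with Suc.prems False show ?thesis
      unfolding runs_def by (intro exI[of _ "1 + bcost b"] exI[of _ s]) auto
  next
    case True
    then obtain t1 s1 where s1: "exec W c s t1 s1" "t1 \<le> T" "I i s1"
      using step[OF Suc.prems True] unfolding runs_def by auto
    obtain t2 s2 where s2: "exec W (While b c) s1 t2 s2" "t2 \<le> i * (1 + bcost b + T) + 1 + bcost b"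
      "\<not> bval b s2" "\<exists>j\<le>i. I j s2"
      using Suc.IH[OF s1(3)] unfolding runs_def by blast
    have ex: "exec W (While b c) s (1 + bcost b + t1 + t2) s2"
      by (rule exec.WhileTrue[OF b[OF Suc.prems] True s1(1) s2(1)])
    have "\<exists>j\<le>Suc i. I j s2" using s2(4) le_SucI by blast
    with s1 s2 ex exec_mods[OF ex] show ?thesis
      unfolding runs_def by (intro exI[of _ "1 + bcost b + t1 + t2"] exI[of _ s2]) simp
  qed
qed

definition For :: "vname \<Rightarrow> aexp \<Rightarrow> com \<Rightarrow> com" where
  "For x e c = Seq (assign x (Const 0))
     (While (Less (var x) e) (Seq c (assign x (Add (var x) (Const 1)))))"

lemma mods_For [simp]: "mods (For x e c) = insert x (mods c)"
  by (auto simp: For_def)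

text \<open>The postcondition of the body is stated for the state in which the counter has already
  advanced, so \<open>I\<close> may mention the counter. The bound \<open>e\<close> is evaluated
  anew in each round; hence the requirement in all states that agree with \<open>s0\<close> outside
  \<open>x\<close> and \<open>mods c\<close>.\<close>

lemma runs_For:
  assumes x: "x \<notin> mods c" and W: "N < W"
    and e: "\<And>s. \<forall>y. y \<noteq> x \<longrightarrow> y \<notin> mods c \<longrightarrow> s y = s0 y \<Longrightarrow> aval e s = N \<and> afits W e s"
    and I0: "I 0 (s0(x := (s0 x)(0 := 0)))"
    and step: "\<And>i s. i < N \<Longrightarrow> I i s \<Longrightarrow> s x 0 = i \<Longrightarrow>
        \<forall>y. y \<noteq> x \<longrightarrow> y \<notin> mods c \<longrightarrow> s y = s0 y \<Longrightarrow>
        runs W c s T (\<lambda>s'. I (Suc i) (s'(x := (s' x)(0 := Suc i))))"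
    and T': "N * (T + acost e + 10) + acost e + 7 \<le> T'"
  shows "runs W (For x e c) s0 T' (\<lambda>s'. I N s' \<and> s' x 0 = N)"
proof -
  \<comment> \<open>\<open>runs_While\<close> counts the remaining rounds down, whereas
    \<open>I\<close> counts the completed ones up.\<close>
  define Inv where "Inv i s \<longleftrightarrow> i \<le> N \<and> I (N - i) s \<and> s x 0 = N - i \<and>
     (\<forall>y. y \<noteq> x \<longrightarrow> y \<notin> mods c \<longrightarrow> s y = s0 y)" for i s
  show ?thesis
    unfolding For_def
  proof (rule runs_Seq[OF runs_Write[OF _ _ _ order_refl]])
    show "afits W (Const 0) s0" "afits W (Const 0) s0" using W by auto
    show "(\<lambda>s. s = s0(x := (s0 x)(0 := 0))) (s0(x := (s0 x)(aval (Const 0) s0 := aval (Const 0) s0)))"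
      by simp
    fix s1 assume s1: "s1 = s0(x := (s0 x)(0 := 0))"
    show "runs W (While (Less (var x) e) (Seq c (assign x (Add (var x) (Const 1))))) s1
       (N * (1 + bcost (Less (var x) e) + (T + 6)) + 1 + bcost (Less (var x) e)) (\<lambda>s'. I N s' \<and> s' x 0 = N)"
    proof (rule runs_conseq[OF runs_While[where I = Inv] order_refl])
      show "Inv N s1" using I0 by (simp add: Inv_def s1)
    next
      fix i s assume "Inv i s"
      then show "bfits W (Less (var x) e) s" using e[of s] W by (auto simp: Inv_def)
    next
      fix i s assume inv: "Inv i s" and "bval (Less (var x) e) s"
      then have "N - i < N" using e[of s] by (auto simp: Inv_def)
      then have i: "0 < i" by simp
      have "runs W (Seq c (assign x (Add (var x) (Const 1)))) s (T + 6) (Inv (i - 1))"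
      proof (rule runs_Seq[OF step[of "N - i"]])
        show "N - i < N" "I (N - i) s" "s x 0 = N - i" "\<forall>y. y \<noteq> x \<longrightarrow> y \<notin> mods c \<longrightarrow> s y = s0 y"
          using inv \<open>N - i < N\<close> by (auto simp: Inv_def)
        fix s2 assume s2: "I (Suc (N - i)) (s2(x := (s2 x)(0 := Suc (N - i))))"
          "\<forall>y. y \<notin> mods c \<longrightarrow> s2 y = s y"
        have s2x: "s2 x 0 = N - i" using s2(2) x inv by (simp add: Inv_def)
        show "runs W (assign x (Add (var x) (Const 1))) s2 6 (Inv (i - 1))"
        proof (rule runs_Write)
          show "afits W (Const 0) s2" "afits W (Add (var x) (Const 1)) s2"
            using W \<open>N - i < N\<close> by (auto simp: s2x)
          have "N - (i - 1) = Suc (N - i)" using inv i by (auto simp: Inv_def)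
          then show "Inv (i - 1) (s2(x := (s2 x)(aval (Const 0) s2 := aval (Add (var x) (Const 1)) s2)))"
            using s2 inv by (auto simp: Inv_def s2x)
        qed simp
      qed simp
      with i show "0 < i \<and> runs W (Seq c (assign x (Add (var x) (Const 1)))) s (T + 6) (Inv (i - 1))" by simp
    next
      fix s' assume s': "\<not> bval (Less (var x) e) s' \<and> (\<exists>j\<le>N. Inv j s')"
      then obtain j where j: "Inv j s'" by blast
      then have "\<not> N - j < N" using s' e[of s'] by (auto simp: Inv_def)
      with j show "I N s' \<and> s' x 0 = N" by (cases "j = 0") (auto simp: Inv_def)
    qed
  qed (use T' in \<open>simp add: algebra_simps\<close>)
qed

text \<open>The array \<open>g\<close> holds an \<open>e\<close>-digit counter in base \<open>B\<close>, least significant digit first; the number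
  of steps would not fit into a word. The loop stops when the carry reaches \<open>g[e]\<close>.\<close>

definition increment :: "vname \<Rightarrow> aexp \<Rightarrow> vname \<Rightarrow> com" where
  "increment g B p = Seq (assign p (Const 0)) (Seq
     (While (Neg (Less (Read g (var p)) (Sub B (Const 1))))
       (Seq (Write g (var p) (Const 0)) (assign p (Add (var p) (Const 1)))))
     (Write g (var p) (Add (Read g (var p)) (Const 1))))"

definition Enumerate :: "vname \<Rightarrow> aexp \<Rightarrow> aexp \<Rightarrow> vname \<Rightarrow> com \<Rightarrow> com" where
  "Enumerate g e B p c = While (Less (Read g e) (Const 1)) (Seq c (increment g B p))"

lemma mods_increment [simp]: "mods (increment g B p) = {g, p}"
  by (auto simp: increment_def)

lemma mods_Enumerate [simp]: "mods (Enumerate g e B p c) = {g, p} \<union> mods c"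
  by (auto simp: Enumerate_def)

text \<open>\<open>f N\<close> is the overflow digit: the value \<open>b ^ N\<close>, reached after
  the last vector, is still represented, and termination shows in a single digit.\<close>

definition digits :: "nat \<Rightarrow> nat \<Rightarrow> (nat \<Rightarrow> nat) \<Rightarrow> nat \<Rightarrow> bool" where
  "digits b N f c \<longleftrightarrow> (\<forall>m\<le>N. f m < b) \<and> (\<Sum>m\<le>N. f m * b ^ m) = c"

text \<open>The invariant carries a pending amount \<open>b ^ (N - i)\<close> at position
  \<open>N - i\<close>: the digits and this carry always add up to \<open>Suc c\<close>. The carry
  stops at position \<open>N\<close> at the latest, whose digit 0 is smaller than
  \<open>b - 1\<close>.\<close>

lemma runs_increment:
  assumes g: "g \<noteq> p" and b: "2 \<le> b" "b < W" "N + 1 < W"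
    and B: "\<And>s. \<forall>y. y \<noteq> g \<longrightarrow> y \<noteq> p \<longrightarrow> s y = s0 y \<Longrightarrow> aval B s = b \<and> afits W B s"
    and d: "digits b N (s0 g) c" "s0 g N = 0"
    and T: "N * (18 + acost B) + acost B + 22 \<le> T"
  shows "runs W (increment g B p) s0 T (\<lambda>s. digits b N (s g) (Suc c))"
proof -
  define Inv where "Inv i s \<longleftrightarrow> i \<le> N \<and> s p 0 = N - i \<and> (\<forall>m\<le>N. s g m < b) \<and> s g N = 0 \<and>
     (\<Sum>m\<le>N. s g m * b ^ m) + b ^ (N - i) = Suc c \<and>
     (\<forall>y. y \<noteq> g \<longrightarrow> y \<noteq> p \<longrightarrow> s y = s0 y)" for i s
  let ?b = "Neg (Less (Read g (var p)) (Sub B (Const 1)))"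
  \<comment> \<open>The old contribution of digit \<open>j\<close> is added on one side and the new
    one on the other, which avoids truncated subtraction.\<close>
  have upd: "(\<Sum>m\<le>N. (f(j := v)) m * b ^ m) + f j * b ^ j = (\<Sum>m\<le>N. f m * b ^ m) + v * b ^ j"
    if "j \<le> N" for f j v
    using that by (subst (1 2) sum.remove[of _ j]) auto
  show ?thesis
    unfolding increment_def
  proof (rule runs_Seq[OF runs_Write[OF _ _ _ order_refl]])
    show "afits W (Const 0) s0" "afits W (Const 0) s0" using b by auto
    show "(\<lambda>s. s = s0(p := (s0 p)(0 := 0))) (s0(p := (s0 p)(aval (Const 0) s0 := aval (Const 0) s0)))"
      by simp
    fix s1 assume s1: "s1 = s0(p := (s0 p)(0 := 0))"
    show "runs W (Seq (While ?b (Seq (Write g (var p) (Const 0)) (assign p (Add (var p) (Const 1)))))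
     (Write g (var p) (Add (Read g (var p)) (Const 1)))) s1
       (N * (1 + bcost ?b + 10) + 1 + bcost ?b + 10) (\<lambda>s. digits b N (s g) (Suc c))"
    proof (rule runs_Seq[OF runs_While[where I = Inv] _ order_refl])
      show "Inv N s1" using d g by (simp add: Inv_def s1 digits_def)
    next
      fix i s assume inv: "Inv i s"
      then have "s g (N - i) < b" "N - i < W" using b by (auto simp: Inv_def)
      then have "s g (N - i) < W" "N - i < W" using b by linarith+
      then show "bfits W ?b s" using B[of s] b inv by (auto simp: Inv_def)
    next
      fix i s assume inv: "Inv i s" and bv: "bval ?b s"
      have sB: "aval B s = b" using B[of s] inv by (auto simp: Inv_def)
      have sgi: "s g (N - i) < b" using inv by (auto simp: Inv_def)
      moreover have "\<not> s g (N - i) < b - 1" using bv inv by (simp add: Inv_def sB)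
      ultimately have e: "s g (N - i) = b - 1" by linarith
      have i: "0 < i" using e b inv by (cases "i = 0") (auto simp: Inv_def)
      have N: "N - (i - 1) = Suc (N - i)" using inv i by (auto simp: Inv_def)
      have p: "s p 0 = N - i" using inv by (auto simp: Inv_def)
      have "runs W (Seq (Write g (var p) (Const 0)) (assign p (Add (var p) (Const 1)))) s 10 (Inv (i - 1))"
      proof (rule runs_Seq[OF runs_Write[OF _ _ _ order_refl]])
        show "afits W (var p) s" "afits W (Const 0) s" using b by (auto simp: p)
        show "(\<lambda>s1. s1 = s(g := (s g)(N - i := 0))) (s(g := (s g)(aval (var p) s := aval (Const 0) s)))"
          by (simp add: p)
        fix s2 assume s2: "s2 = s(g := (s g)(N - i := 0))"
        show "runs W (assign p (Add (var p) (Const 1))) s2 6 (Inv (i - 1))"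
        proof (rule runs_Write)
          show "afits W (Const 0) s2" "afits W (Add (var p) (Const 1)) s2"
            using b g by (auto simp: p s2)
          have "(\<Sum>m\<le>N. ((s g)(N - i := 0)) m * b ^ m) + b ^ Suc (N - i) = (\<Sum>m\<le>N. s g m * b ^ m) + b ^ (N - i)"
          proof -
            have "(b - 1) * x + x = b * x" for x using b by (cases b) auto
            from this[of "b ^ (N - i)"] show ?thesis
              using upd[of "N - i" "s g" 0] unfolding e power_Suc by simp
          qed
          then show "Inv (i - 1) (s2(p := (s2 p)(aval (Const 0) s2 := aval (Add (var p) (Const 1)) s2)))"
            using inv g b i by (auto simp: Inv_def p s2 N Suc_diff_le)
        qed simp
      qed simp
      with i show "0 < i \<and> runs W (Seq (Write g (var p) (Const 0)) (assign p (Add (var p) (Const 1)))) s 10 (Inv (i - 1))"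
        by simp
    next
      fix s assume "\<not> bval ?b s \<and> (\<exists>j\<le>N. Inv j s)"
      then obtain j where inv: "Inv j s" and nb: "\<not> bval ?b s" by blast
      have sB: "aval B s = b" using B[of s] inv by (auto simp: Inv_def)
      have p: "s p 0 = N - j" using inv by (auto simp: Inv_def)
      have lt: "s g (N - j) < b - 1" using nb by (simp add: sB p)
      show "runs W (Write g (var p) (Add (Read g (var p)) (Const 1))) s 10 (\<lambda>s. digits b N (s g) (Suc c))"
      proof (rule runs_Write)
        show "afits W (var p) s" "afits W (Add (Read g (var p)) (Const 1)) s"
          using b lt by (auto simp: p)
        have "(\<Sum>m\<le>N. ((s g)(N - j := Suc (s g (N - j)))) m * b ^ m) = (\<Sum>m\<le>N. s g m * b ^ m) + b ^ (N - j)"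
          using upd[of "N - j" "s g" "Suc (s g (N - j))"] by simp
        then show "digits b N ((s(g := (s g)(aval (var p) s := aval (Add (Read g (var p)) (Const 1)) s))) g) (Suc c)"
          using inv lt by (auto simp: digits_def p Inv_def)
      qed simp
    qed
  qed (use T in \<open>simp add: algebra_simps\<close>)
qed

lemma sum_digits_less:
  fixes b :: nat
  shows "\<forall>m<N. f m < b \<Longrightarrow> (\<Sum>m<N. f m * b ^ m) < b ^ N"
proof (induction N)
  case (Suc N)
  then have "(\<Sum>m<N. f m * b ^ m) < b ^ N" by simp
  moreover have "f N * b ^ N \<le> (b - 1) * b ^ N" using Suc.prems by (intro mult_right_mono) auto
  moreover have "(b - 1) * b ^ N + b ^ N = b ^ Suc N"
    using Suc.prems by (cases b) auto
  ultimately show ?case unfolding sum.lessThan_Suc by linarith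
qed simp

lemma digit_eq:
  fixes b :: nat
  shows "\<forall>m<N. f m < b \<Longrightarrow> m < N \<Longrightarrow> (\<Sum>m<N. f m * b ^ m) div b ^ m mod b = f m"
proof (induction N arbitrary: f m)
  case (Suc N)
  have b: "0 < b" using Suc.prems by (metis gr_zeroI not_less_zero)
  have split: "(\<Sum>m<Suc N. f m * b ^ m) = f 0 + b * (\<Sum>m<N. f (Suc m) * b ^ m)"
    by (simp add: sum.lessThan_Suc_shift sum_distrib_left mult_ac del: sum.lessThan_Suc)
  show ?case
  proof (cases m)
    case 0
    then show ?thesis using Suc.prems unfolding split by simp
  next
    case (Suc m')
    have "(\<Sum>m<Suc N. f m * b ^ m) div b ^ m = (\<Sum>m<N. f (Suc m) * b ^ m) div b ^ m'"
      unfolding split Suc power_Suc div_mult2_eq using Suc.prems b by simp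
    then show ?thesis using Suc.IH[of "\<lambda>m. f (Suc m)" m'] Suc.prems Suc by auto
  qed
qed simp

lemma digits_exist:
  fixes b :: nat
  assumes "\<forall>m<N. f m < b"
  shows "\<exists>c < b ^ N. \<forall>m<N. c div b ^ m mod b = f m"
  using sum_digits_less[OF assms] digit_eq[OF assms] by blast

lemma digitsD:
  assumes "digits b N f c" "f N = 0"
  shows "\<forall>m<N. f m = c div b ^ m mod b" "c < b ^ N"
proof -
  have *: "(\<Sum>m<N. f m * b ^ m) = c" "\<forall>m<N. f m < b"
    using assms by (auto simp: digits_def lessThan_Suc_atMost[symmetric])
  show "\<forall>m<N. f m = c div b ^ m mod b" "c < b ^ N"
    using digit_eq[OF *(2)] sum_digits_less[OF *(2)] unfolding *(1) by auto
qed

text \<open>The number \<open>i\<close> exists in the logic only; the program sees its digits.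
  \<open>I\<close> must survive any change of \<open>g\<close> and \<open>p\<close>, because the
  increment follows the body. Every round is charged a full carry. In the end the lower digits are 0
  again, so the array is ready for another enumeration once its overflow digit is cleared.\<close>

lemma runs_Enumerate:
  assumes g: "g \<noteq> p" "g \<notin> mods c" "p \<notin> mods c" and b: "2 \<le> b" "b < W" "N + 1 < W"
    and B: "\<And>s. \<forall>y. y \<noteq> g \<longrightarrow> y \<noteq> p \<longrightarrow> y \<notin> mods c \<longrightarrow> s y = s0 y \<Longrightarrow> aval B s = b \<and> afits W B s"
    and e: "\<And>s. \<forall>y. y \<noteq> g \<longrightarrow> y \<noteq> p \<longrightarrow> y \<notin> mods c \<longrightarrow> s y = s0 y \<Longrightarrow> aval e s = N \<and> afits W e s"
    and z: "\<forall>m\<le>N. s0 g m = 0" and I0: "I 0 s0"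
    and step: "\<And>i s. i < b ^ N \<Longrightarrow> I i s \<Longrightarrow> \<forall>m<N. s g m = i div b ^ m mod b \<Longrightarrow>
        \<forall>y. y \<noteq> g \<longrightarrow> y \<noteq> p \<longrightarrow> y \<notin> mods c \<longrightarrow> s y = s0 y \<Longrightarrow> s g N = 0 \<Longrightarrow>
        runs W c s T (\<lambda>s'. \<forall>s''. (\<forall>y. y \<noteq> g \<longrightarrow> y \<noteq> p \<longrightarrow> s'' y = s' y) \<longrightarrow> I (Suc i) s'')"
    and T': "b ^ N * (T + (N + 2) * (22 + acost B) + acost e) + acost e + 4 \<le> T'"
  shows "runs W (Enumerate g e B p c) s0 T' (\<lambda>s. I (b ^ N) s \<and> (\<forall>m<N. s g m = 0))"
proof -
  define Inv where "Inv i s \<longleftrightarrow> i \<le> b ^ N \<and> I (b ^ N - i) s \<and> digits b N (s g) (b ^ N - i) \<and>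
     (\<forall>y. y \<noteq> g \<longrightarrow> y \<noteq> p \<longrightarrow> y \<notin> mods c \<longrightarrow> s y = s0 y)" for i s
  let ?b = "Less (Read g e) (Const 1)"
  let ?Ti = "N * (18 + acost B) + acost B + 22"
  show ?thesis
    unfolding Enumerate_def
  proof (rule runs_conseq[OF runs_While[where I = Inv and T = "T + ?Ti"]])
    show "Inv (b ^ N) s0" using I0 z b by (simp add: Inv_def digits_def)
  next
    fix i s assume inv: "Inv i s"
    then have "s g N < b" by (simp add: Inv_def digits_def)
    then show "bfits W ?b s" using inv e[of s] b by (auto simp: Inv_def)
  next
    fix i s assume inv: "Inv i s" and "bval ?b s"
    then have gN: "s g N = 0" using e[of s] by (auto simp: Inv_def)
    have dg: "digits b N (s g) (b ^ N - i)" using inv by (simp add: Inv_def)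
    have lt: "b ^ N - i < b ^ N" by (rule digitsD(2)[OF dg gN])
    then have i: "0 < i" by simp
    have Si: "b ^ N - (i - 1) = Suc (b ^ N - i)" using i inv by (auto simp: Inv_def)
    have "runs W (Seq c (increment g B p)) s (T + ?Ti) (Inv (i - 1))"
    proof (rule runs_Seq[OF step[of "b ^ N - i"] _ order_refl])
      show "b ^ N - i < b ^ N" by (rule lt)
      show "\<forall>m<N. s g m = (b ^ N - i) div b ^ m mod b" by (rule digitsD(1)[OF dg gN])
      show "I (b ^ N - i) s" "\<forall>y. y \<noteq> g \<longrightarrow> y \<noteq> p \<longrightarrow> y \<notin> mods c \<longrightarrow> s y = s0 y"
        using inv by (auto simp: Inv_def)
      show "s g N = 0" by (rule gN)
      fix s1 assume s1: "\<forall>s''. (\<forall>y. y \<noteq> g \<longrightarrow> y \<noteq> p \<longrightarrow> s'' y = s1 y) \<longrightarrow> I (Suc (b ^ N - i)) s''"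
        "\<forall>x. x \<notin> mods c \<longrightarrow> s1 x = s x"
      have s1g: "s1 g = s g" using s1(2) g by simp
      show "runs W (increment g B p) s1 ?Ti (Inv (i - 1))"
      proof (rule runs_conseq[OF runs_increment[OF g(1) b, where c = "b ^ N - i"] order_refl])
        show "digits b N (s1 g) (b ^ N - i)" "s1 g N = 0" using dg gN by (simp_all add: s1g)
        fix s2 assume "\<forall>y. y \<noteq> g \<longrightarrow> y \<noteq> p \<longrightarrow> s2 y = s1 y"
        then show "aval B s2 = b \<and> afits W B s2" using s1 inv by (intro B) (auto simp: Inv_def)
      next
        fix s2 assume s2: "digits b N (s2 g) (Suc (b ^ N - i))" "\<forall>x. x \<notin> mods (increment g B p) \<longrightarrow> s2 x = s1 x"
        have "I (Suc (b ^ N - i)) s2" using s1(1) s2(2) by auto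
        with s2 s1 inv show "Inv (i - 1) s2" unfolding Inv_def Si by auto
      qed simp
    qed
    with i show "0 < i \<and> runs W (Seq c (increment g B p)) s (T + ?Ti) (Inv (i - 1))" by simp
  next
    fix s assume s: "\<not> bval ?b s \<and> (\<exists>j\<le>b ^ N. Inv j s)"
    then obtain j where inv: "Inv j s" by blast
    have gN: "s g N \<noteq> 0" using s inv e[of s] by (auto simp: Inv_def)
    \<comment> \<open>The total value is at most \<open>b ^ N\<close>, so a nonzero overflow digit
      leaves nothing for the others.\<close>
    have sum: "(\<Sum>m<N. s g m * b ^ m) + s g N * b ^ N = b ^ N - j"
      using inv by (simp add: Inv_def digits_def lessThan_Suc_atMost[symmetric])
    moreover have "b ^ N \<le> s g N * b ^ N" using gN by simp
    moreover have "0 < b ^ N" using b by simp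
    ultimately have "j = 0" "(\<Sum>m<N. s g m * b ^ m) = 0" by linarith+
    with inv b show "I (b ^ N) s \<and> (\<forall>m<N. s g m = 0)" by (auto simp: Inv_def)
  next
    have "N * (18 + acost B) \<le> N * (22 + acost B)" by (intro mult_left_mono) auto
    then have "1 + bcost ?b + (T + ?Ti) \<le> T + (N + 2) * (22 + acost B) + acost e"
    proof -
      have "1 + (1 + (1 + e') + 1) + (T' + (x + B' + 22)) \<le> T' + (y + 2 * (22 + B')) + e'"
        if "x \<le> y" for x y e' B' T' :: nat using that by simp
      from this[OF \<open>N * (18 + acost B) \<le> N * (22 + acost B)\<close>] show ?thesis
        unfolding bcost.simps acost.simps add_mult_distrib .
    qed
    then have "b ^ N * (1 + bcost ?b + (T + ?Ti)) \<le> b ^ N * (T + (N + 2) * (22 + acost B) + acost e)"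
      by (rule mult_le_mono2)
    then show "b ^ N * (1 + bcost ?b + (T + ?Ti)) + 1 + bcost ?b \<le> T'" using T' unfolding bcost.simps acost.simps by linarith
  qed
qed

section \<open>The search program\<close>

lemma runs_assign_Seq:
  assumes "afits W b s" "0 < W" "runs W c (s(x := (s x)(0 := aval b s))) T Q" "2 + acost b + T \<le> T'"
  shows "runs W (Seq (assign x b) c) s T' Q"
proof (rule runs_Seq[OF runs_Write[OF _ _ _ order_refl]])
  show "(\<lambda>s1. s1 = s(x := (s x)(0 := aval b s))) (s(x := (s x)(aval (Const 0) s := aval b s)))" by simp
  show "runs W c s1 T Q" if "s1 = s(x := (s x)(0 := aval b s))" for s1
    unfolding that by (rule assms(3))
qed (use assms in auto)

lemma runs_Seq_assign:
  assumes "runs W c s T (\<lambda>s'. afits W b s' \<and> Q (s'(x := (s' x)(0 := aval b s'))))" "0 < W"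
    "2 + acost b + T \<le> T'"
  shows "runs W (Seq c (assign x b)) s T' Q"
  by (rule runs_Seq[OF assms(1) runs_Write[OF _ _ _ order_refl]]) (use assms in auto)

lemma index_less: "i * b + j < a * b" if "i < a" "j < b" for i j a b :: nat
proof -
  have "i * b + j < Suc i * b" using that by simp
  also have "\<dots> \<le> a * b" using that by (intro mult_le_mono1) simp
  finally show ?thesis .
qed

text \<open>One write per entry: the table becomes part of the program text, so its length may
  depend only on constants such as \<open>q\<close>.\<close>

definition store_table :: "vname \<Rightarrow> nat list \<Rightarrow> (nat \<Rightarrow> nat) \<Rightarrow> com" where
  "store_table x is f = foldr (\<lambda>i c. Seq (Write x (Const i) (Const (f i))) c) is Skip"

lemma mods_store_table: "mods (store_table x is f) \<subseteq> {x}"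
  by (induction "is") (auto simp: store_table_def)

lemma runs_store_table:
  "\<forall>i\<in>set is. i < W \<and> f i < W \<Longrightarrow>
    runs W (store_table x is f) s (3 * length is + 1) (\<lambda>s'. \<forall>i\<in>set is. s' x i = f i)"
proof -
  assume "\<forall>i\<in>set is. i < W \<and> f i < W"
  then have "runs W (store_table x is f) s (3 * length is + 1)
     (\<lambda>s'. \<forall>i. s' x i = (if i \<in> set is then f i else s x i))"
  proof (induction "is" arbitrary: s)
    case Nil
    then show ?case by (simp add: store_table_def runs_Skip)
  next
    case (Cons i "is")
    have "runs W (Seq (Write x (Const i) (Const (f i))) (store_table x is f)) s (3 * length (i # is) + 1)
       (\<lambda>s'. \<forall>j. s' x j = (if j \<in> set (i # is) then f j else s x j))"
    proof (rule runs_Seq[OF runs_Write[OF _ _ _ order_refl]])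
      show "(\<lambda>s1. s1 = s(x := (s x)(i := f i))) (s(x := (s x)(aval (Const i) s := aval (Const (f i)) s)))" by simp
      fix s1 assume s1: "s1 = s(x := (s x)(i := f i))"
      show "runs W (store_table x is f) s1 (3 * length is + 1)
         (\<lambda>s'. \<forall>j. s' x j = (if j \<in> set (i # is) then f j else s x j))"
        by (rule runs_conseq[OF Cons.IH order_refl]) (use Cons.prems in \<open>auto simp: s1\<close>)
    qed (use Cons.prems in auto)
    then show ?case by (simp add: store_table_def)
  qed
  then show ?thesis by (rule runs_conseq) auto
qed

definition copy_com :: "vname \<Rightarrow> vname \<Rightarrow> com" where
  "copy_com y z = For ''x'' (Mul (var ''n'') (var ''k'')) (Write y (var ''x'') (Read z (var ''x'')))"

lemma mods_copy_com [simp]: "mods (copy_com y z) = {''x'', y}"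
  by (auto simp: copy_com_def)

lemma runs_copy_com:
  assumes "y \<noteq> z" "y \<notin> {''x'', ''n'', ''k''}" "z \<noteq> ''x''"
    and s: "s ''n'' 0 = n" "s ''k'' 0 = k" and W: "n < W" "k < W" "n * k < W" "1 < W" "\<forall>i<n * k. s z i < W"
  shows "runs W (copy_com y z) s (21 * (n * k) + 12) (\<lambda>s'. \<forall>i<n * k. s' y i = s z i)"
proof -
  let ?c = "Write y (var ''x'') (Read z (var ''x''))"
  have "runs W (copy_com y z) s (21 * (n * k) + 12) (\<lambda>s'. (\<forall>i<n * k. s' y i = s z i) \<and> s' ''x'' 0 = n * k)"
    unfolding copy_com_def
  proof (rule runs_For[where T = 6 and I = "\<lambda>j s'. \<forall>i<j. s' y i = s z i"])
    fix j s1 assume j: "j < n * k" "\<forall>i<j. s1 y i = s z i" "s1 ''x'' 0 = j"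
      "\<forall>v. v \<noteq> ''x'' \<longrightarrow> v \<notin> mods ?c \<longrightarrow> s1 v = s v"
    then have "s1 z = s z" using assms by auto
    then show "runs W ?c s1 6 (\<lambda>s'. \<forall>i<Suc j. (s'(''x'' := (s' ''x'')(0 := Suc j))) y i = s z i)"
      using assms j by (intro runs_Write) (auto simp: less_Suc_eq)
  qed (use assms in \<open>auto simp: algebra_simps\<close>)
  then show ?thesis by (rule runs_conseq) auto
qed

lemma index_inject: "i * d + j = i' * d + j' \<Longrightarrow> j < d \<Longrightarrow> j' < d \<Longrightarrow> i = i' \<and> j = j'" for i j i' j' d :: nat
  by (metis add.commute div_mult_self1_is_m div_mult_self3 div_less add.right_neutral add_left_cancel not_less_zero less_nat_zero_code add_cancel_left_right div_mult_self1 gr_implies_not0)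

text \<open>The search for \<open>V\<close> leaves its columns one after the other in
  \<open>O\<close>, while the output format is row by row.\<close>

definition transpose_com :: com where
  "transpose_com = For ''j'' (var ''d'') (For ''m'' (var ''k'')
     (Write ''V'' (Add (Mul (var ''m'') (var ''d'')) (var ''j''))
        (Read ''O'' (Add (Mul (var ''j'') (var ''k'')) (var ''m'')))))"

lemma mods_transpose_com [simp]: "mods transpose_com = {''j'', ''m'', ''V''}"
  by (auto simp: transpose_com_def)

lemma runs_transpose_com:
  assumes s: "s ''d'' 0 = d" "s ''k'' 0 = k" and W: "d < W" "k < W" "d * k < W" "1 < W" "\<forall>i<d * k. s ''O'' i < W"
  shows "runs W transpose_com s (d * (40 * k + 30) + 20)
     (\<lambda>s'. \<forall>j<d. \<forall>m<k. s' ''V'' (m * d + j) = s ''O'' (j * k + m))"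
proof -
  let ?c = "Write ''V'' (Add (Mul (var ''m'') (var ''d'')) (var ''j''))
        (Read ''O'' (Add (Mul (var ''j'') (var ''k'')) (var ''m'')))"
  let ?f = "For ''m'' (var ''k'') ?c"
  have "runs W transpose_com s (d * (40 * k + 30) + 20)
     (\<lambda>s'. (\<forall>j<d. \<forall>m<k. s' ''V'' (m * d + j) = s ''O'' (j * k + m)) \<and> s' ''j'' 0 = d)"
    unfolding transpose_com_def
  proof (rule runs_For[where T = "40 * k + 9" and
        I = "\<lambda>i s'. \<forall>j<i. \<forall>m<k. s' ''V'' (m * d + j) = s ''O'' (j * k + m)"])
    fix i s1 assume i: "i < d" and I1: "\<forall>j<i. \<forall>m<k. s1 ''V'' (m * d + j) = s ''O'' (j * k + m)"
      and j1: "s1 ''j'' 0 = i" and fr: "\<forall>y. y \<noteq> ''j'' \<longrightarrow> y \<notin> mods ?f \<longrightarrow> s1 y = s y"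
    have "runs W ?f s1 (40 * k + 9)
      (\<lambda>s'. ((\<forall>j<i. \<forall>m<k. s' ''V'' (m * d + j) = s ''O'' (j * k + m)) \<and>
         (\<forall>m<k. s' ''V'' (m * d + i) = s ''O'' (i * k + m))) \<and> s' ''m'' 0 = k)"
    proof (rule runs_For[where T = 18 and I = "\<lambda>l s'. (\<forall>j<i. \<forall>m<k. s' ''V'' (m * d + j) = s ''O'' (j * k + m)) \<and>
         (\<forall>m<l. s' ''V'' (m * d + i) = s ''O'' (i * k + m))"])
      fix l s2 assume l: "l < k" and I2: "(\<forall>j<i. \<forall>m<k. s2 ''V'' (m * d + j) = s ''O'' (j * k + m)) \<and>
         (\<forall>m<l. s2 ''V'' (m * d + i) = s ''O'' (i * k + m))" and m2: "s2 ''m'' 0 = l"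
        and fr2: "\<forall>y. y \<noteq> ''m'' \<longrightarrow> y \<notin> mods ?c \<longrightarrow> s2 y = s1 y"
      have v: "s2 ''d'' 0 = d" "s2 ''k'' 0 = k" "s2 ''j'' 0 = i" "s2 ''O'' = s ''O''"
        using fr2 fr s j1 by simp_all
      have a1: "i * k + l < d * k" by (rule index_less[OF i l])
      have a2: "l * d + i < d * k" using index_less[OF l i] by (simp add: mult.commute)
      have fits: "i < W" "l < W" "i * k + l < W" "l * d + i < W" "i * k < W" "l * d < W" "s ''O'' (i * k + l) < W"
        using a1 a2 W i l by (auto intro: less_trans)
      have ne: "m * d + j = l * d + i \<longleftrightarrow> m = l \<and> j = i" if "j < d" for m j
        using index_inject[of m d j l i] that i by auto
      show "runs W ?c s2 18 (\<lambda>s'. (\<forall>j<i. \<forall>m<k. (s'(''m'' := (s' ''m'')(0 := Suc l))) ''V'' (m * d + j) = s ''O'' (j * k + m)) \<and>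
         (\<forall>m<Suc l. (s'(''m'' := (s' ''m'')(0 := Suc l))) ''V'' (m * d + i) = s ''O'' (i * k + m)))"
        by (rule runs_Write) (use fits W I2 i l ne in \<open>auto simp: v m2 less_Suc_eq\<close>)
    next
      show "(\<forall>j<i. \<forall>m<k. (s1(''m'' := (s1 ''m'')(0 := 0))) ''V'' (m * d + j) = s ''O'' (j * k + m)) \<and>
         (\<forall>m<0. (s1(''m'' := (s1 ''m'')(0 := 0))) ''V'' (m * d + i) = s ''O'' (i * k + m))"
        using I1 by simp
    qed (use fr s W in simp_all)
    then show "runs W ?f s1 (40 * k + 9)
      (\<lambda>s'. \<forall>j<Suc i. \<forall>m<k. (s'(''j'' := (s' ''j'')(0 := Suc i))) ''V'' (m * d + j) = s ''O'' (j * k + m))"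
      by (rule runs_conseq) (auto simp: less_Suc_eq)
  qed (use s W in \<open>simp_all add: algebra_simps\<close>)
  then show ?thesis by (rule runs_conseq) auto
qed

lemma all_flat_index:
  fixes n k :: nat
  assumes "\<forall>r<n. \<forall>m<k. P (r * k + m)"
  shows "\<forall>x<n * k. P x"
proof (intro allI impI)
  fix x assume x: "x < n * k"
  then have "0 < k" by (cases k) auto
  then have "x div k < n" "x mod k < k" using x by (auto simp: less_mult_imp_div_less)
  then have "P (x div k * k + x mod k)" using assms by blast
  then show "P x" by simp
qed

section \<open>Field arithmetic by table lookup\<close>

locale field_machine =
  fixes enc :: "'a::{finite,field} \<Rightarrow> nat" and q W :: nat
  assumes enc: "field_encoding enc" and q_def: "q = CARD('a)" and W: "q * q < W"
begin

definition dec :: "nat \<Rightarrow> 'a" where "dec = inv_into UNIV enc"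

lemma inj_enc: "inj enc" and enc_less: "enc x < q" and enc_0: "enc 0 = 0"
  using enc unfolding field_encoding_def bij_betw_def q_def by auto

lemma enc_eq_iff [simp]: "enc x = enc y \<longleftrightarrow> x = y"
  using inj_enc by (auto dest: injD)

lemma enc_dec: "i < q \<Longrightarrow> enc (dec i) = i"
  unfolding dec_def using enc by (intro f_inv_into_f) (auto simp: field_encoding_def bij_betw_def q_def)

lemma dec_enc [simp]: "dec (enc x) = x"
  unfolding dec_def using inj_enc by simp

lemma q_ge_2: "2 \<le> q"
proof -
  have "card {0, 1 :: 'a} \<le> q" unfolding q_def by (rule card_mono) auto
  then show ?thesis by simp
qed

lemma enc_less_W: "enc x < W"
proof -
  have "q \<le> q * q" by simp
  then show ?thesis using enc_less[of x] W by linarith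
qed

lemma W_gt: "q < W" "3 < W" "0 < W" "1 < W"
proof -
  have "2 * 2 \<le> q * q" "q * 1 \<le> q * q" using q_ge_2 by (intro mult_le_mono; simp)+
  then show "q < W" "3 < W" "0 < W" "1 < W" using W by linarith+
qed

text \<open>The precondition for enumerating candidates in \<open>H\<close>; the range includes the
  overflow digit \<open>H[k]\<close>.\<close>

abbreviation cleared :: "state \<Rightarrow> nat \<Rightarrow> bool" where
  "cleared s k \<equiv> \<forall>m\<le>k. s ''H'' m = 0"

abbreviation stores :: "state \<Rightarrow> vname \<Rightarrow> nat \<Rightarrow> nat \<Rightarrow> (nat \<Rightarrow> nat \<Rightarrow> 'a) \<Rightarrow> bool" where
  "stores s x a b f \<equiv> \<forall>i<a. \<forall>j<b. s x (i * b + j) = enc (f i j)"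

definition tables :: "state \<Rightarrow> bool" where
  "tables s \<longleftrightarrow> (\<forall>x y. s ''P'' (enc x * q + enc y) = enc (x + y)) \<and>
     (\<forall>x y. s ''M'' (enc x * q + enc y) = enc (x * y))"

lemma table_index: "enc x * q + enc y < W"
  using index_less[OF enc_less[of x] enc_less[of y]] W by linarith

lemma table_index': "enc x * q < W"
  using table_index[of x 0] by (simp add: enc_0)

text \<open>The programs depend on \<open>enc\<close> and \<open>q\<close> only, not on the word bound \<open>W\<close>, which varies with the input.\<close>

definition dot_com :: com where
  "dot_com = Seq (assign ''z'' (Const 0)) (For ''m'' (var ''k'')
     (assign ''z'' (Read ''P'' (Add (Mul (var ''z'') (Const q))
        (Read ''M'' (Add (Mul (Read ''Y'' (Add (Mul (var ''l'') (var ''k'')) (var ''m''))) (Const q))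
           (Read ''H'' (var ''m''))))))))"

lemma mods_dot_com [simp]: "mods dot_com = {''z'', ''m''}"
  by (auto simp: dot_com_def)

lemma runs_dot_com:
  assumes T: "tables s" and k: "s ''k'' 0 = k" "k < W" and l: "s ''l'' 0 = l" "l < W" "l * k + k \<le> W"
    and Y: "\<forall>m<k. s ''Y'' (l * k + m) = enc (y m)" and H: "\<forall>m<k. s ''H'' m = enc (u m)"
  shows "runs W dot_com s (50 * k + 15) (\<lambda>s'. s' ''z'' 0 = enc (\<Sum>m<k. u m * y m))"
  unfolding dot_com_def
proof (rule runs_assign_Seq)
  let ?s = "s(''z'' := (s ''z'')(0 := aval (Const 0) s))"
  let ?c = "assign ''z'' (Read ''P'' (Add (Mul (var ''z'') (Const q))
        (Read ''M'' (Add (Mul (Read ''Y'' (Add (Mul (var ''l'') (var ''k'')) (var ''m''))) (Const q))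
           (Read ''H'' (var ''m''))))))"
  have "runs W (For ''m'' (var ''k'') ?c) ?s (50 * k + 9)
     (\<lambda>s'. s' ''z'' 0 = enc (\<Sum>m<k. u m * y m) \<and> s' ''m'' 0 = k)"
  proof (rule runs_For[where I = "\<lambda>i s'. s' ''z'' 0 = enc (\<Sum>m<i. u m * y m)" and T = 38])
    fix i s' assume i: "i < k" and z: "s' ''z'' 0 = enc (\<Sum>m<i. u m * y m)" and m: "s' ''m'' 0 = i"
      and fr: "\<forall>y. y \<noteq> ''m'' \<longrightarrow> y \<notin> mods ?c \<longrightarrow> s' y = ?s y"
    have s': "s' ''k'' 0 = k" "s' ''l'' 0 = l" "s' ''Y'' (l * k + i) = enc (y i)" "s' ''H'' i = enc (u i)"
      "s' ''P'' (enc a * q + enc b) = enc (a + b)" "s' ''M'' (enc a * q + enc b) = enc (b * a)" for a b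
      using fr i T k l Y H by (auto simp: tables_def mult.commute[of a b])
    have lk: "l * k < W" "l * k + i < W" using i l by linarith+
    show "runs W ?c s' 38 (\<lambda>s'. (s'(''m'' := (s' ''m'')(0 := Suc i))) ''z'' 0 = enc (\<Sum>m<Suc i. u m * y m))"
      by (rule runs_Write)
        (use i lk k l W_gt in \<open>simp_all add: s' z m enc_less_W table_index table_index'\<close>)
  qed (use k W_gt in \<open>simp_all add: enc_0\<close>)
  then show "runs W (For ''m'' (var ''k'') ?c) ?s (50 * k + 9) (\<lambda>s'. s' ''z'' 0 = enc (\<Sum>m<k. u m * y m))"
    by (rule runs_conseq) auto
qed (use W_gt in auto)

section \<open>Exhaustive search for the nearest codeword\<close>

definition wdist :: "nat \<Rightarrow> nat \<Rightarrow> (nat \<Rightarrow> nat) \<Rightarrow> (nat \<Rightarrow> 'a) \<Rightarrow> (nat \<Rightarrow> nat \<Rightarrow> 'a) \<Rightarrow> (nat \<Rightarrow> 'a) \<Rightarrow> nat" where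
  "wdist k L wt x y u = (\<Sum>l<L. wt l * of_bool (x l \<noteq> (\<Sum>m<k. u m * y l m)))"

lemma wdist_cong: "(\<And>m. m < k \<Longrightarrow> u m = u' m) \<Longrightarrow> wdist k L wt x y u = wdist k L wt x y u'"
  by (simp add: wdist_def)

lemma wdist_le: "\<forall>l<L. wt l \<le> D \<Longrightarrow> wdist k L wt x y u \<le> L * D"
  unfolding wdist_def using sum_bounded_above[of "{..<L}" "\<lambda>l. wt l * of_bool (x l \<noteq> (\<Sum>m<k. u m * y l m))" D]
  by auto

definition input_vars :: "vname set" where
  "input_vars = {''P'', ''M'', ''k'', ''R'', ''L'', ''d'', ''A'', ''a'', ''b'', ''J'', ''w'', ''Y''}"

text \<open>The generic task: \<open>R\<close> words with \<open>L\<close> weighted coordinates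
  each, to be fitted by the code with coefficient vectors \<open>y l\<close>. The entries
  \<open>X r l\<close> are read in place from the input matrix by address arithmetic. The number of
  columns doubles as the bound \<open>D\<close> on the weights.\<close>

definition inputs :: "state \<Rightarrow> nat \<Rightarrow> nat \<Rightarrow> nat \<Rightarrow> nat \<Rightarrow> (nat \<Rightarrow> nat) \<Rightarrow> (nat \<Rightarrow> nat \<Rightarrow> 'a) \<Rightarrow> (nat \<Rightarrow> nat \<Rightarrow> 'a) \<Rightarrow> bool" where
  "inputs s k R L D wt X y \<longleftrightarrow> tables s \<and> s ''k'' 0 = k \<and> s ''R'' 0 = R \<and> s ''L'' 0 = L \<and> s ''d'' 0 = D \<and>
     s ''a'' 0 < W \<and> s ''b'' 0 < W \<and>
     (\<forall>r<R. \<forall>l<L. r * s ''a'' 0 + s ''J'' l * s ''b'' 0 < W \<and> s ''A'' (r * s ''a'' 0 + s ''J'' l * s ''b'' 0) = enc (X r l)) \<and>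
     (\<forall>l<L. s ''J'' l < W \<and> s ''w'' l = wt l \<and> wt l \<le> D) \<and>
     (stores s ''Y'' L k y)"

lemma inputs_cong:
  "inputs s k R L D wt X y \<Longrightarrow> \<forall>v\<in>input_vars. s' v = s v \<Longrightarrow> inputs s' k R L D wt X y"
  unfolding inputs_def tables_def input_vars_def by simp

text \<open>\<open>L * D + 1\<close> exceeds every score and serves as the initial minimum;
  \<open>R\<close> times this number bounds the total of all minima.\<close>

definition sizes :: "nat \<Rightarrow> nat \<Rightarrow> nat \<Rightarrow> nat \<Rightarrow> bool" where
  "sizes k R L D \<longleftrightarrow> k + 1 < W \<and> R < W \<and> L < W \<and> D < W \<and> L * k < W \<and> R * k < W \<and> L * D + 1 < W \<and> R * (L * D + 1) < W"

abbreviation "entry \<equiv> Read ''A'' (Add (Mul (var ''r'') (var ''a'')) (Mul (Read ''J'' (var ''l'')) (var ''b'')))"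

text \<open>With strides \<open>(a, b) = (d, 1)\<close> the entries are those of the sampled columns \<open>J\<close> in row \<open>r\<close> of the input, with
  \<open>(a, b) = (1, d)\<close> and \<open>J = id\<close> those of column \<open>r\<close>; one search program serves both steps.\<close>

definition score_com :: com where
  "score_com = Seq (assign ''c'' (Const 0)) (For ''l'' (var ''L'')
     (Seq dot_com (Cond (Conj (Neg (Less (var ''z'') entry)) (Neg (Less entry (var ''z'')))) Skip
        (assign ''c'' (Add (var ''c'') (Read ''w'' (var ''l'')))))))"

lemma mods_score_com [simp]: "mods score_com = {''c'', ''l'', ''z'', ''m''}"
  by (auto simp: score_com_def)

lemma runs_score_com:
  assumes inp: "inputs s k R L D wt X y" and sz: "sizes k R L D"
    and r: "s ''r'' 0 = r" "r < R" and H: "\<forall>m<k. s ''H'' m = enc (u m)"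
  shows "runs W score_com s (L * (50 * k + 72) + 20) (\<lambda>s'. s' ''c'' 0 = wdist k L wt (X r) y u)"
  unfolding score_com_def
proof (rule runs_assign_Seq)
  let ?s = "s(''c'' := (s ''c'')(0 := aval (Const 0) s))"
  let ?i = "Cond (Conj (Neg (Less (var ''z'') entry)) (Neg (Less entry (var ''z'')))) Skip
        (assign ''c'' (Add (var ''c'') (Read ''w'' (var ''l''))))"
  let ?c = "Seq dot_com ?i"
  have "runs W (For ''l'' (var ''L'') ?c) ?s (L * (50 * k + 72) + 9)
     (\<lambda>s'. s' ''c'' 0 = wdist k L wt (X r) y u \<and> s' ''l'' 0 = L)"
  proof (rule runs_For[where I = "\<lambda>i s'. s' ''c'' 0 = wdist k i wt (X r) y u" and T = "50 * k + 60"])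
    fix i s' assume i: "i < L" and c: "s' ''c'' 0 = wdist k i wt (X r) y u" and l: "s' ''l'' 0 = i"
      and fr: "\<forall>y. y \<noteq> ''l'' \<longrightarrow> y \<notin> mods ?c \<longrightarrow> s' y = ?s y"
    have inp': "inputs s' k R L D wt X y" by (rule inputs_cong[OF inp]) (use fr in \<open>auto simp: input_vars_def\<close>)
    have "Suc i * k \<le> L * k" using i by (intro mult_le_mono1) simp
    then have lk: "i * k + k \<le> W" using sz by (simp add: sizes_def)
    have H': "\<forall>m<k. s' ''H'' m = enc (u m)" using fr H by simp
    show "runs W ?c s' (50 * k + 60) (\<lambda>s'. (s'(''l'' := (s' ''l'')(0 := Suc i))) ''c'' 0 = wdist k (Suc i) wt (X r) y u)"
    proof (rule runs_Seq[OF runs_dot_com[where k = k and l = i and y = "y i" and u = u]])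
      fix s2 assume z: "s2 ''z'' 0 = enc (\<Sum>m<k. u m * y i m)" and "\<forall>x. x \<notin> mods dot_com \<longrightarrow> s2 x = s' x"
      then have fr2: "\<forall>x. x \<noteq> ''z'' \<longrightarrow> x \<noteq> ''m'' \<longrightarrow> s2 x = s' x" by simp
      have inp2: "inputs s2 k R L D wt X y" by (rule inputs_cong[OF inp']) (use fr2 in \<open>auto simp: input_vars_def\<close>)
      have v: "s2 ''l'' 0 = i" "s2 ''r'' 0 = r" "s2 ''c'' 0 = wdist k i wt (X r) y u"
        using fr2 fr l r c by simp_all
      have rL: "r * s2 ''a'' 0 + s2 ''J'' i * s2 ''b'' 0 < W" "s2 ''A'' (r * s2 ''a'' 0 + s2 ''J'' i * s2 ''b'' 0) = enc (X r i)"
        "s2 ''J'' i < W" "s2 ''w'' i = wt i" "wt i \<le> D" "s2 ''a'' 0 < W" "s2 ''b'' 0 < W"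
        using inp2 i r unfolding inputs_def by auto
      have rL': "r * s2 ''a'' 0 < W" "s2 ''J'' i * s2 ''b'' 0 < W" using rL(1) by linarith+
      have wd: "wdist k i wt (X r) y u \<le> i * D"
        by (rule wdist_le) (use inp2 i in \<open>auto simp: inputs_def\<close>)
      have "Suc i * D \<le> L * D" using i by (intro mult_le_mono1) simp
      then have cW: "wdist k i wt (X r) y u + wt i < W" "wdist k i wt (X r) y u < W" "wt i < W"
        using wd sz rL(5) by (auto simp: sizes_def)
      have rW: "r < W" "i < W" using r i sz by (auto simp: sizes_def)
      have fE: "afits W entry s2" "aval entry s2 = enc (X r i)"
        using rL rL' rW W_gt by (auto simp: v enc_less_W)
      show "runs W ?i s2 45 (\<lambda>s'. (s'(''l'' := (s' ''l'')(0 := Suc i))) ''c'' 0 = wdist k (Suc i) wt (X r) y u)"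
      proof (rule runs_Cond[where T = 8])
        show "bfits W (Conj (Neg (Less (var ''z'') entry)) (Neg (Less entry (var ''z'')))) s2"
          using fE W_gt by (simp add: z enc_less_W del: aval.simps(2) afits.simps(2)) (simp add: z enc_less_W)
      next
        assume "bval (Conj (Neg (Less (var ''z'') entry)) (Neg (Less entry (var ''z'')))) s2"
        then have "enc (X r i) = enc (\<Sum>m<k. u m * y i m)"
          unfolding bval.simps fE(2) by (simp add: z del: enc_eq_iff)
        then show "runs W Skip s2 8 (\<lambda>s'. (s'(''l'' := (s' ''l'')(0 := Suc i))) ''c'' 0 = wdist k (Suc i) wt (X r) y u)"
          by (intro runs_Skip) (simp_all add: v wdist_def)
      next
        assume "\<not> bval (Conj (Neg (Less (var ''z'') entry)) (Neg (Less entry (var ''z'')))) s2"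
        then have "enc (X r i) \<noteq> enc (\<Sum>m<k. u m * y i m)"
          unfolding bval.simps fE(2) by (auto simp: z)
        then show "runs W (assign ''c'' (Add (var ''c'') (Read ''w'' (var ''l'')))) s2 8
           (\<lambda>s'. (s'(''l'' := (s' ''l'')(0 := Suc i))) ''c'' 0 = wdist k (Suc i) wt (X r) y u)"
          using cW W_gt rL rW by (intro runs_Write) (simp_all add: v, simp add: wdist_def)
      qed simp
    qed (use inp' sz l lk i H' in \<open>auto simp: inputs_def sizes_def\<close>)
  qed (use inp sz W_gt in \<open>auto simp: inputs_def sizes_def wdist_def algebra_simps\<close>)
  then show "runs W (For ''l'' (var ''L'') ?c) ?s (L * (50 * k + 72) + 9) (\<lambda>s'. s' ''c'' 0 = wdist k L wt (X r) y u)"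
    by (rule runs_conseq) auto
qed (use W_gt in auto)

text \<open>The digits of the base \<open>q\<close> counter \<open>H\<close> are themselves the
  encoded candidate. The initial value of \<open>e\<close> exceeds every score, so the first
  candidate is always stored; the last write clears the overflow digit for the next row.\<close>

definition row_com :: com where
  "row_com = Seq (assign ''e'' (Add (Mul (var ''L'') (var ''d'')) (Const 1)))
     (Seq (Enumerate ''H'' (var ''k'') (Const q) ''p'' (Seq score_com
       (Cond (Less (var ''c'') (var ''e''))
         (Seq (assign ''e'' (var ''c''))
           (For ''m'' (var ''k'') (Write ''O'' (Add (Mul (var ''r'') (var ''k'')) (var ''m'')) (Read ''H'' (var ''m'')))))
         Skip)))
     (Write ''H'' (var ''k'') (Const 0)))"

lemma mods_row_com [simp]: "mods row_com = {''e'', ''H'', ''p'', ''c'', ''l'', ''z'', ''m'', ''O''}"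
  by (auto simp: row_com_def)

definition row_time :: "nat \<Rightarrow> nat \<Rightarrow> nat" where
  "row_time k L = q ^ k * (L * (50 * k + 72) + 47 * k + 100) + 20"

lemma every_vector_enumerated:
  "\<exists>c < q ^ k. \<forall>m<k. dec (c div q ^ m mod q) = u m"
  using digits_exist[of k "\<lambda>m. enc (u m)" q] enc_less by (metis dec_enc)

text \<open>The last conjunct protects the results of the other rows, which share the array
  \<open>O\<close>.\<close>

lemma runs_row_com:
  assumes inp: "inputs s k R L D wt X y" and sz: "sizes k R L D"
    and r: "s ''r'' 0 = r" "r < R" and H: "cleared s k"
  shows "runs W row_com s (row_time k L) (\<lambda>s'. cleared s' k \<and>
     (\<exists>u. (\<forall>m<k. s' ''O'' (r * k + m) = enc (u m)) \<and> s' ''e'' 0 = wdist k L wt (X r) y u \<and>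
        (\<forall>u'. wdist k L wt (X r) y u \<le> wdist k L wt (X r) y u')) \<and>
     (\<forall>x. x < r * k \<or> r * k + k \<le> x \<longrightarrow> s' ''O'' x = s ''O'' x))"
    (is "runs W _ s _ ?Q")
proof -
  let ?frame = "\<lambda>s'. \<forall>x. x < r * k \<or> r * k + k \<le> x \<longrightarrow> s' ''O'' x = s ''O'' x"
  let ?wd = "wdist k L wt (X r) y"
  define U :: "nat \<Rightarrow> nat \<Rightarrow> 'a" where "U c m = dec (c div q ^ m mod q)" for c m
  define I where "I c s' \<longleftrightarrow> (c = 0 \<and> s' ''e'' 0 = L * D + 1 \<or>
       (\<exists>u. (\<forall>m<k. s' ''O'' (r * k + m) = enc (u m)) \<and> s' ''e'' 0 = ?wd u)) \<and>
     (\<forall>c'<c. s' ''e'' 0 \<le> ?wd (U c')) \<and>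
     (?frame s')" for c s'
  have wd: "?wd u \<le> L * D" for u
    by (rule wdist_le) (use inp in \<open>auto simp: inputs_def\<close>)
  have sW: "k + 1 < W" "R < W" "L < W" "D < W" "L * k < W" "R * k < W" "L * D + 1 < W" using sz by (auto simp: sizes_def)
  have rk: "r * k + k \<le> R * k" using mult_le_mono1[of "Suc r" R k] r by simp
  let ?copy = "Write ''O'' (Add (Mul (var ''r'') (var ''k'')) (var ''m'')) (Read ''H'' (var ''m''))"
  let ?upd = "Seq (assign ''e'' (var ''c'')) (For ''m'' (var ''k'') ?copy)"
  let ?body = "Seq score_com (Cond (Less (var ''c'') (var ''e'')) ?upd Skip)"
  let ?s = "s(''e'' := (s ''e'')(0 := aval (Add (Mul (var ''L'') (var ''d'')) (Const 1)) s))"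
  let ?Tb = "L * (50 * k + 72) + 24 * k + 50"
  have vars: "s ''k'' 0 = k" "s ''L'' 0 = L" "s ''d'' 0 = D" using inp by (auto simp: inputs_def)
  have enum: "runs W (Enumerate ''H'' (var ''k'') (Const q) ''p'' ?body) ?s (q ^ k * (?Tb + (k + 2) * 23 + 2) + 6)
     (\<lambda>s'. I (q ^ k) s' \<and> (\<forall>m<k. s' ''H'' m = 0))"
  proof (rule runs_Enumerate[where T = ?Tb])
    show "I 0 ?s" by (simp add: I_def vars)
    show "\<forall>m\<le>k. ?s ''H'' m = 0" using H by simp
  next
    fix i s1 assume i: "i < q ^ k" and inv: "I i s1" and dg: "\<forall>m<k. s1 ''H'' m = i div q ^ m mod q"
      and fr: "\<forall>y. y \<noteq> ''H'' \<longrightarrow> y \<noteq> ''p'' \<longrightarrow> y \<notin> mods ?body \<longrightarrow> s1 y = ?s y"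
    have inp1: "inputs s1 k R L D wt X y" by (rule inputs_cong[OF inp]) (use fr in \<open>auto simp: input_vars_def\<close>)
    have r1: "s1 ''r'' 0 = r" using fr r by simp
    have H1: "\<forall>m<k. s1 ''H'' m = enc (U i m)"
      using dg q_ge_2 by (simp add: U_def enc_dec)
    show "runs W ?body s1 ?Tb (\<lambda>s'. \<forall>s''. (\<forall>y. y \<noteq> ''H'' \<longrightarrow> y \<noteq> ''p'' \<longrightarrow> s'' y = s' y) \<longrightarrow> I (Suc i) s'')"
      (is "runs _ _ _ _ ?J")
    proof (rule runs_Seq[OF runs_score_com[OF inp1 sz r1 r(2) H1]])
      fix s2 assume c: "s2 ''c'' 0 = ?wd (U i)" and "\<forall>x. x \<notin> mods score_com \<longrightarrow> s2 x = s1 x"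
      then have fr2: "\<forall>x. x \<notin> {''c'', ''l'', ''z'', ''m''} \<longrightarrow> s2 x = s1 x" by simp
      have inp2: "inputs s2 k R L D wt X y" by (rule inputs_cong[OF inp1]) (use fr2 in \<open>auto simp: input_vars_def\<close>)
      have inv2: "I i s2" using inv fr2 by (simp add: I_def)
      have r2: "s2 ''r'' 0 = r" using fr2 r1 by simp
      have k2: "s2 ''k'' 0 = k" using inp2 by (simp add: inputs_def)
      have H2: "\<forall>m<k. s2 ''H'' m = enc (U i m)" using fr2 H1 by simp
      have cW: "s2 ''c'' 0 < W" using wd[of "U i"] sW c by linarith
      have eW: "s2 ''e'' 0 < W"
        using inv2 sW wd unfolding I_def by (metis le_less_trans add_lessD1)
      show "runs W (Cond (Less (var ''c'') (var ''e'')) ?upd Skip) s2 (24 * k + 30)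
         ?J"
      proof (rule runs_Cond[where T = "24 * k + 20"])
        show "bfits W (Less (var ''c'') (var ''e'')) s2" using cW eW W_gt by simp
      next
        assume "bval (Less (var ''c'') (var ''e'')) s2"
        then have lt: "?wd (U i) < s2 ''e'' 0" by (simp add: c)
        let ?s2 = "s2(''e'' := (s2 ''e'')(0 := aval (var ''c'') s2))"
        show "runs W ?upd s2 (24 * k + 20) ?J"
        proof (rule runs_assign_Seq)
          have "runs W (For ''m'' (var ''k'') ?copy) ?s2 (24 * k + 10)
            (\<lambda>s'. ((\<forall>m<k. s' ''O'' (r * k + m) = enc (U i m)) \<and>
              (?frame s')) \<and> s' ''m'' 0 = k)"
          proof (rule runs_For[where T = 12 and I = "\<lambda>j s'. (\<forall>m<j. s' ''O'' (r * k + m) = enc (U i m)) \<and>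
              (?frame s')"])
            fix j s3 assume j: "j < k" and I3: "(\<forall>m<j. s3 ''O'' (r * k + m) = enc (U i m)) \<and>
              (?frame s3)" and m: "s3 ''m'' 0 = j"
              and fr3: "\<forall>y. y \<noteq> ''m'' \<longrightarrow> y \<notin> mods ?copy \<longrightarrow> s3 y = ?s2 y"
            have v3: "s3 ''r'' 0 = r" "s3 ''k'' 0 = k" "s3 ''H'' j = enc (U i j)"
              using fr3 r2 k2 H2 j by simp_all
            have lt3: "r < W" "k < W" "j < W" "r * k + j < W" "r * k < W" using rk sW j r by linarith+
            show "runs W ?copy s3 12 (\<lambda>s'. (\<forall>m<Suc j. (s'(''m'' := (s' ''m'')(0 := Suc j))) ''O'' (r * k + m) = enc (U i m)) \<and>
              (\<forall>x. x < r * k \<or> r * k + k \<le> x \<longrightarrow> (s'(''m'' := (s' ''m'')(0 := Suc j))) ''O'' x = s ''O'' x))"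
              by (rule runs_Write) (use lt3 W_gt I3 j in \<open>simp_all add: v3 m enc_less_W less_Suc_eq\<close>)
          next
            show "(\<forall>m<0. (?s2(''m'' := (?s2 ''m'')(0 := 0))) ''O'' (r * k + m) = enc (U i m)) \<and>
              (\<forall>x. x < r * k \<or> r * k + k \<le> x \<longrightarrow> (?s2(''m'' := (?s2 ''m'')(0 := 0))) ''O'' x = s ''O'' x)"
              using inv2 by (simp add: I_def)
          qed (use sW W_gt k2 in simp_all)
          then show "runs W (For ''m'' (var ''k'') ?copy) ?s2 (24 * k + 10)
            ?J"
          proof (rule runs_conseq[OF _ order_refl], intro allI impI)
            fix s' s'' assume s': "((\<forall>m<k. s' ''O'' (r * k + m) = enc (U i m)) \<and>
              (?frame s')) \<and> s' ''m'' 0 = k"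
              "\<forall>x. x \<notin> mods (For ''m'' (var ''k'') ?copy) \<longrightarrow> s' x = ?s2 x"
              "\<forall>y. y \<noteq> ''H'' \<longrightarrow> y \<noteq> ''p'' \<longrightarrow> s'' y = s' y"
            then have e: "s'' ''e'' 0 = ?wd (U i)" "s'' ''O'' = s' ''O''" by (simp_all add: c)
            have "?wd (U i) \<le> ?wd (U c')" if "c' < Suc i" for c'
            proof (cases "c' = i")
              case False
              then have "s2 ''e'' 0 \<le> ?wd (U c')" using inv2 that unfolding I_def by simp
              then show ?thesis using lt by linarith
            qed simp
            moreover have "\<forall>m<k. s'' ''O'' (r * k + m) = enc (U i m)"
              "?frame s''"
              using s'(1) unfolding e by simp_all
            ultimately show "I (Suc i) s''" unfolding I_def e(1) by blast
          qed
        qed (use W_gt cW in simp_all)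
      next
        assume "\<not> bval (Less (var ''c'') (var ''e'')) s2"
        then have ge: "s2 ''e'' 0 \<le> ?wd (U i)" by (simp add: c)
        have "I (Suc i) s''" if "\<forall>y. y \<noteq> ''H'' \<longrightarrow> y \<noteq> ''p'' \<longrightarrow> s'' y = s2 y" for s''
        proof -
          have "s'' ''e'' = s2 ''e''" "s'' ''O'' = s2 ''O''" using that by simp_all
          \<comment> \<open>Every score is at most \<open>L * D\<close>, so a candidate that does
            not improve on \<open>e\<close> shows that \<open>e\<close> is no longer the initial
            value and some vector has been stored.\<close>
          moreover have "i \<noteq> 0 \<or> s2 ''e'' 0 \<noteq> L * D + 1" using ge wd[of "U i"] by linarith
          ultimately have "\<exists>u. (\<forall>m<k. s'' ''O'' (r * k + m) = enc (u m)) \<and> s'' ''e'' 0 = ?wd u"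
            using inv2 unfolding I_def by metis
          moreover have "\<forall>c'<Suc i. s'' ''e'' 0 \<le> ?wd (U c')"
            using inv2 ge \<open>s'' ''e'' = s2 ''e''\<close> unfolding I_def by (metis less_Suc_eq)
          moreover have "?frame s''"
            using inv2 \<open>s'' ''O'' = s2 ''O''\<close> unfolding I_def by simp
          ultimately show ?thesis unfolding I_def by blast
        qed
        then show "runs W Skip s2 (24 * k + 20) ?J"
          by (intro runs_Skip) simp_all
      qed simp
    qed simp
  qed (use sW W_gt q_ge_2 vars in \<open>simp_all add: add_mult_distrib2\<close>)
  have "runs W (Seq (Enumerate ''H'' (var ''k'') (Const q) ''p'' ?body) (Write ''H'' (var ''k'') (Const 0))) ?s
     (q ^ k * (?Tb + (k + 2) * 23 + 2) + 6 + 4) ?Q"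
  proof (rule runs_Seq[OF enum _ order_refl])
    fix s1 assume s1: "I (q ^ k) s1 \<and> (\<forall>m<k. s1 ''H'' m = 0)"
      "\<forall>x. x \<notin> mods (Enumerate ''H'' (var ''k'') (Const q) ''p'' ?body) \<longrightarrow> s1 x = ?s x"
    have "q ^ k \<noteq> 0" using q_ge_2 by simp
    then obtain u where u: "\<forall>m<k. s1 ''O'' (r * k + m) = enc (u m)" "s1 ''e'' 0 = ?wd u"
      using s1(1) unfolding I_def by auto
    have min: "?wd u \<le> ?wd u'" for u'
    proof -
      obtain c where c: "c < q ^ k" "\<forall>m<k. U c m = u' m"
        using every_vector_enumerated unfolding U_def by blast
      have "?wd u' = ?wd (U c)" using c by (intro wdist_cong) simp
      then show ?thesis using s1(1) c(1) u(2) unfolding I_def by metis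
    qed
    have k1: "s1 ''k'' 0 = k" using s1(2) vars by simp
    show "runs W (Write ''H'' (var ''k'') (Const 0)) s1 4 ?Q"
    proof (rule runs_Write)
      have "(\<forall>m<k. s1 ''O'' (r * k + m) = enc (u m)) \<and> s1 ''e'' 0 = ?wd u \<and>
        (\<forall>u'. ?wd u \<le> ?wd u')" using u min by blast
      moreover have "?frame s1"
        using s1(1) unfolding I_def by blast
      moreover have "\<forall>m<k. s1 ''H'' m = 0" using s1(1) by blast
      ultimately show "?Q (s1(''H'' := (s1 ''H'')(aval (var ''k'') s1 := aval (Const 0) s1)))"
        by (simp add: k1) blast
    qed (use W_gt sW k1 in simp_all)
  qed
  then show ?thesis
    unfolding row_com_def
    by (rule runs_assign_Seq[rotated 2]) (use W_gt sW vars in \<open>simp_all add: row_time_def algebra_simps\<close>)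
qed

definition search_com :: com where
  "search_com = Seq (assign ''f'' (Const 0)) (For ''r'' (var ''R'')
     (Seq row_com (assign ''f'' (Add (var ''f'') (var ''e'')))))"

lemma mods_search_com [simp]:
  "mods search_com = {''f'', ''r'', ''e'', ''H'', ''p'', ''c'', ''l'', ''z'', ''m'', ''O''}"
  by (auto simp: search_com_def)

lemma runs_search_com:
  assumes inp: "inputs s k R L D wt X y" and sz: "sizes k R L D" and H: "cleared s k"
  shows "runs W search_com s (R * (row_time k L + 19) + 12) (\<lambda>s'. cleared s' k \<and>
     (\<exists>u. stores s' ''O'' R k u \<and>
        s' ''f'' 0 = (\<Sum>r<R. wdist k L wt (X r) y (u r)) \<and>
        (\<forall>r<R. \<forall>u'. wdist k L wt (X r) y (u r) \<le> wdist k L wt (X r) y u')))"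
    (is "runs W _ s _ ?Q")
  unfolding search_com_def
proof (rule runs_assign_Seq)
  let ?s = "s(''f'' := (s ''f'')(0 := aval (Const 0) s))"
  let ?c = "Seq row_com (assign ''f'' (Add (var ''f'') (var ''e'')))"
  define I where "I i s' \<longleftrightarrow> cleared s' k \<and>
     (\<exists>u. stores s' ''O'' i k u \<and>
        s' ''f'' 0 = (\<Sum>r<i. wdist k L wt (X r) y (u r)) \<and>
        (\<forall>r<i. \<forall>u'. wdist k L wt (X r) y (u r) \<le> wdist k L wt (X r) y u'))" for i s'
  have vars: "s ''k'' 0 = k" "s ''R'' 0 = R" using inp by (auto simp: inputs_def)
  have sW: "R < W" "R * (L * D + 1) < W" using sz by (auto simp: sizes_def)
  have "runs W (For ''r'' (var ''R'') ?c) ?s (R * (row_time k L + 19) + 9) (\<lambda>s'. I R s' \<and> s' ''r'' 0 = R)"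
  proof (rule runs_For[where T = "row_time k L + 7"])
    show "I 0 (?s(''r'' := (?s ''r'')(0 := 0)))" using H by (simp add: I_def)
  next
    fix i s1 assume i: "i < R" and I1: "I i s1" and r: "s1 ''r'' 0 = i"
      and fr: "\<forall>y. y \<noteq> ''r'' \<longrightarrow> y \<notin> mods ?c \<longrightarrow> s1 y = ?s y"
    have inp1: "inputs s1 k R L D wt X y" by (rule inputs_cong[OF inp]) (use fr in \<open>auto simp: input_vars_def\<close>)
    have H1: "cleared s1 k" using I1 by (simp add: I_def)
    obtain u where u: "stores s1 ''O'' i k u"
        "s1 ''f'' 0 = (\<Sum>r<i. wdist k L wt (X r) y (u r))"
        "\<forall>r<i. \<forall>u'. wdist k L wt (X r) y (u r) \<le> wdist k L wt (X r) y u'"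
      using I1 unfolding I_def by blast
    show "runs W ?c s1 (row_time k L + 7) (\<lambda>s'. I (Suc i) (s'(''r'' := (s' ''r'')(0 := Suc i))))"
    proof (rule runs_Seq_assign[OF runs_conseq[OF runs_row_com[OF inp1 sz r i H1] order_refl]])
      fix s2 assume s2: "cleared s2 k \<and>
         (\<exists>u. (\<forall>m<k. s2 ''O'' (i * k + m) = enc (u m)) \<and> s2 ''e'' 0 = wdist k L wt (X i) y u \<and>
            (\<forall>u'. wdist k L wt (X i) y u \<le> wdist k L wt (X i) y u')) \<and>
         (\<forall>x. x < i * k \<or> i * k + k \<le> x \<longrightarrow> s2 ''O'' x = s1 ''O'' x)"
        "\<forall>x. x \<notin> mods row_com \<longrightarrow> s2 x = s1 x"
      then obtain v where v: "\<forall>m<k. s2 ''O'' (i * k + m) = enc (v m)" "s2 ''e'' 0 = wdist k L wt (X i) y v"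
            "\<forall>u'. wdist k L wt (X i) y v \<le> wdist k L wt (X i) y u'" by blast
      have f2: "s2 ''f'' 0 = (\<Sum>r<i. wdist k L wt (X r) y (u r))" using s2(2) u(2) by simp
      have wd: "wdist k L wt (X r) y u \<le> L * D" for r u
        by (rule wdist_le) (use inp in \<open>auto simp: inputs_def\<close>)
      have "(\<Sum>r<i. wdist k L wt (X r) y (u r)) \<le> i * (L * D)"
        using sum_bounded_above[of "{..<i}" "\<lambda>r. wdist k L wt (X r) y (u r)" "L * D"] wd by simp
      moreover have "Suc i * (L * D + 1) \<le> R * (L * D + 1)" using i by (intro mult_le_mono1) simp
      moreover have "Suc i * (L * D + 1) = i * (L * D) + L * D + i + 1" by simp
      ultimately have fW: "s2 ''f'' 0 + s2 ''e'' 0 < W" using wd[of i v] sW unfolding f2 v by linarith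
      have O2: "s2 ''O'' (r * k + m) = s1 ''O'' (r * k + m)" if "r < i" "m < k" for r m
        using s2(1) index_less[OF that] by blast
      have "I (Suc i) (s2(''f'' := (s2 ''f'')(0 := s2 ''f'' 0 + s2 ''e'' 0), ''r'' := (s2 ''r'')(0 := Suc i)))"
        unfolding I_def
      proof (intro conjI exI[of _ "u(i := v)"])
        show "\<forall>m\<le>k. (s2(''f'' := (s2 ''f'')(0 := s2 ''f'' 0 + s2 ''e'' 0), ''r'' := (s2 ''r'')(0 := Suc i))) ''H'' m = 0"
          using s2(1) by simp
        show "\<forall>r<Suc i. \<forall>m<k. (s2(''f'' := (s2 ''f'')(0 := s2 ''f'' 0 + s2 ''e'' 0), ''r'' := (s2 ''r'')(0 := Suc i))) ''O'' (r * k + m)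
            = enc ((u(i := v)) r m)"
          using u(1) v(1) O2 by (simp add: less_Suc_eq)
        show "\<forall>r<Suc i. \<forall>u'. wdist k L wt (X r) y ((u(i := v)) r) \<le> wdist k L wt (X r) y u'"
          using u(3) v(3) by (simp add: less_Suc_eq)
      qed (simp add: f2 v)
      then show "afits W (Add (var ''f'') (var ''e'')) s2 \<and>
         I (Suc i) (s2(''f'' := (s2 ''f'')(0 := aval (Add (var ''f'') (var ''e'')) s2),
           ''r'' := ((s2(''f'' := (s2 ''f'')(0 := aval (Add (var ''f'') (var ''e'')) s2))) ''r'')(0 := Suc i)))"
        using fW W_gt by simp
    qed (use W_gt in simp_all)
  qed (use vars sW W_gt in \<open>simp_all add: algebra_simps\<close>)
  then show "runs W (For ''r'' (var ''R'') ?c) ?s (R * (row_time k L + 19) + 9) ?Q"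
    by (rule runs_conseq) (auto simp: I_def)
qed (use W_gt in auto)

section \<open>Loading the weighted sample described by a guess\<close>

definition load_com :: com where
  "load_com = Seq
     (For ''l'' (var ''t'') (Seq
        (Write ''J'' (var ''l'') (Mod (Read ''G'' (var ''l'')) (var ''d'')))
        (Write ''w'' (var ''l'') (Add (Mod (Read ''G'' (Add (var ''t'') (var ''l''))) (var ''d'')) (Const 1)))))
     (For ''x'' (Mul (var ''t'') (var ''k''))
        (Write ''Y'' (var ''x'') (Mod (Read ''G'' (Add (Add (var ''t'') (var ''t'')) (var ''x''))) (Const q))))"

lemma mods_load_com [simp]: "mods load_com = {''l'', ''J'', ''w'', ''x'', ''Y''}"
  by (auto simp: load_com_def)

lemma runs_load_com:
  assumes s: "s ''t'' 0 = t" "s ''d'' 0 = d" "s ''k'' 0 = k"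
    and W': "0 < d" "d < W" "k < W" "t * (k + 2) < W" "\<forall>i<t * (k + 2). s ''G'' i < W"
  shows "runs W load_com s (40 * t + 40 * (t * k) + 40)
    (\<lambda>s'. (\<forall>l<t. s' ''J'' l = s ''G'' l mod d \<and> s' ''w'' l = s ''G'' (t + l) mod d + 1) \<and>
       (\<forall>x<t * k. s' ''Y'' x = s ''G'' (2 * t + x) mod q))"
proof -
  let ?c1 = "Write ''J'' (var ''l'') (Mod (Read ''G'' (var ''l'')) (var ''d''))"
  let ?c2 = "Write ''w'' (var ''l'') (Add (Mod (Read ''G'' (Add (var ''t'') (var ''l''))) (var ''d'')) (Const 1))"
  let ?c3 = "Write ''Y'' (var ''x'') (Mod (Read ''G'' (Add (Add (var ''t'') (var ''t'')) (var ''x''))) (Const q))"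
  let ?I = "\<lambda>i s'. \<forall>l<i. s' ''J'' l = s ''G'' l mod d \<and> s' ''w'' l = s ''G'' (t + l) mod d + 1"
  have N: "t * (k + 2) = 2 * t + t * k" by simp
  have loop1: "runs W (For ''l'' (var ''t'') (Seq ?c1 ?c2)) s (36 * t + 9) (\<lambda>s'. ?I t s' \<and> s' ''l'' 0 = t)"
  proof (rule runs_For[where T = 24 and I = ?I])
    fix i s1 assume i: "i < t" and I1: "?I i s1" and l: "s1 ''l'' 0 = i"
      and fr: "\<forall>y. y \<noteq> ''l'' \<longrightarrow> y \<notin> mods (Seq ?c1 ?c2) \<longrightarrow> s1 y = s y"
    have v: "s1 ''t'' 0 = t" "s1 ''d'' 0 = d" "s1 ''G'' = s ''G''" using fr s by simp_all
    have md: "s ''G'' j mod d + 1 < W" "s ''G'' j mod d < W" for j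
    proof -
      have "s ''G'' j mod d < d" using W' by simp
      then show "s ''G'' j mod d + 1 < W" "s ''G'' j mod d < W" using W' by linarith+
    qed
    have fits: "i < W" "t < W" "t + i < W" "s ''G'' i < W" "s ''G'' (t + i) < W"
      using i W' by (auto simp: N)
    show "runs W (Seq ?c1 ?c2) s1 24 (\<lambda>s'. ?I (Suc i) (s'(''l'' := (s' ''l'')(0 := Suc i))))"
    proof (rule runs_Seq[OF runs_Write[OF _ _ _ order_refl]])
      show "(\<lambda>s2. s2 = s1(''J'' := (s1 ''J'')(i := s ''G'' i mod d)))
         (s1(''J'' := (s1 ''J'')(aval (var ''l'') s1 := aval (Mod (Read ''G'' (var ''l'')) (var ''d'')) s1)))"
        by (simp add: l v)
      fix s2 assume s2: "s2 = s1(''J'' := (s1 ''J'')(i := s ''G'' i mod d))"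
      show "runs W ?c2 s2 14 (\<lambda>s'. ?I (Suc i) (s'(''l'' := (s' ''l'')(0 := Suc i))))"
        by (rule runs_Write) (use I1 fits md W_gt W' in \<open>simp_all add: s2 l v less_Suc_eq\<close>)
    qed (use fits W_gt W' in \<open>simp_all add: l v\<close>)
  qed (use s W' W_gt in \<open>simp_all add: N\<close>)
  have loop2: "runs W (For ''x'' (Mul (var ''t'') (var ''k'')) ?c3) s1 (40 * (t * k) + 20)
    (\<lambda>s'. (?I t s' \<and> (\<forall>x<t * k. s' ''Y'' x = s ''G'' (2 * t + x) mod q)) \<and> s' ''x'' 0 = t * k)"
    if s1: "?I t s1" "s1 ''t'' 0 = t" "s1 ''k'' 0 = k" "s1 ''G'' = s ''G''" for s1
  proof (rule runs_For[where T = 20 and I = "\<lambda>i s'. ?I t s' \<and> (\<forall>x<i. s' ''Y'' x = s ''G'' (2 * t + x) mod q)"])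
    show "?I t (s1(''x'' := (s1 ''x'')(0 := 0))) \<and> (\<forall>x<0. (s1(''x'' := (s1 ''x'')(0 := 0))) ''Y'' x = s ''G'' (2 * t + x) mod q)"
      using s1 by simp
    fix i s2 assume i: "i < t * k" and I2: "?I t s2 \<and> (\<forall>x<i. s2 ''Y'' x = s ''G'' (2 * t + x) mod q)"
      and x: "s2 ''x'' 0 = i" and fr: "\<forall>y. y \<noteq> ''x'' \<longrightarrow> y \<notin> mods ?c3 \<longrightarrow> s2 y = s1 y"
    have v: "s2 ''t'' 0 = t" "s2 ''G'' = s ''G''" using fr s1 by simp_all
    have fits: "i < W" "t < W" "t + t < W" "t + t + i < W" "s ''G'' (t + t + i) < W"
      using i W' by (auto simp: N mult_2)
    show "runs W ?c3 s2 20 (\<lambda>s'. ?I t (s'(''x'' := (s' ''x'')(0 := Suc i))) \<and>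
       (\<forall>x<Suc i. (s'(''x'' := (s' ''x'')(0 := Suc i))) ''Y'' x = s ''G'' (2 * t + x) mod q))"
      by (rule runs_Write) (use I2 fits W_gt in \<open>simp_all add: x v less_Suc_eq mult_2\<close>)
  qed (use s1 W' W_gt in \<open>simp_all add: N\<close>)
  show ?thesis
    unfolding load_com_def
  proof (rule runs_Seq[OF loop1])
    fix s1 assume "?I t s1 \<and> s1 ''l'' 0 = t" "\<forall>x. x \<notin> mods (For ''l'' (var ''t'') (Seq ?c1 ?c2)) \<longrightarrow> s1 x = s x"
    then show "runs W (For ''x'' (Mul (var ''t'') (var ''k'')) ?c3) s1 (40 * (t * k) + 20)
      (\<lambda>s'. ?I t s' \<and> (\<forall>x<t * k. s' ''Y'' x = s ''G'' (2 * t + x) mod q))"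
      using s by (intro runs_conseq[OF loop2 order_refl]) auto
  qed simp
qed

definition unit_com :: com where
  "unit_com = For ''l'' (var ''n'') (Seq (Write ''J'' (var ''l'') (var ''l'')) (Write ''w'' (var ''l'') (Const 1)))"

lemma mods_unit_com [simp]: "mods unit_com = {''l'', ''J'', ''w''}"
  by (auto simp: unit_com_def)

lemma runs_unit_com:
  assumes s: "s ''n'' 0 = n" "n < W"
  shows "runs W unit_com s (30 * n + 10) (\<lambda>s'. \<forall>l<n. s' ''J'' l = l \<and> s' ''w'' l = 1)"
proof -
  let ?c1 = "Write ''J'' (var ''l'') (var ''l'')"
  let ?c2 = "Write ''w'' (var ''l'') (Const 1)"
  let ?I = "\<lambda>i s'. \<forall>l<i. s' ''J'' l = l \<and> s' ''w'' l = 1"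
  have "runs W unit_com s (30 * n + 10) (\<lambda>s'. ?I n s' \<and> s' ''l'' 0 = n)"
    unfolding unit_com_def
  proof (rule runs_For[where T = 10 and I = ?I])
    fix i s1 assume i: "i < n" and I1: "?I i s1" and l: "s1 ''l'' 0 = i"
    show "runs W (Seq ?c1 ?c2) s1 10 (\<lambda>s'. ?I (Suc i) (s'(''l'' := (s' ''l'')(0 := Suc i))))"
    proof (rule runs_Seq[OF runs_Write[OF _ _ _ order_refl]])
      show "(\<lambda>s2. s2 = s1(''J'' := (s1 ''J'')(i := i))) (s1(''J'' := (s1 ''J'')(aval (var ''l'') s1 := aval (var ''l'') s1)))"
        by (simp add: l)
      fix s2 assume s2: "s2 = s1(''J'' := (s1 ''J'')(i := i))"
      show "runs W ?c2 s2 4 (\<lambda>s'. ?I (Suc i) (s'(''l'' := (s' ''l'')(0 := Suc i))))"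
        by (rule runs_Write) (use I1 i s W_gt in \<open>simp_all add: s2 l less_Suc_eq\<close>)
    qed (use i s W_gt in \<open>simp_all add: l\<close>)
  qed (use s W_gt in simp_all)
  then show ?thesis by (rule runs_conseq) auto
qed

section \<open>Enumerating the guesses\<close>

definition base :: "nat \<Rightarrow> nat \<Rightarrow> nat \<Rightarrow> (nat \<Rightarrow> nat \<Rightarrow> 'a) \<Rightarrow> state \<Rightarrow> bool" where
  "base n d k A s \<longleftrightarrow> tables s \<and> s ''n'' 0 = n \<and> s ''d'' 0 = d \<and> s ''k'' 0 = k \<and>
     (stores s ''A'' n d A)"

lemma base_cong:
  "base n d k A s \<Longrightarrow> \<forall>v\<in>{''P'', ''M'', ''n'', ''d'', ''k'', ''A''}. s' v = s v \<Longrightarrow> base n d k A s'"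
  unfolding base_def tables_def by simp

text \<open>The cost is arranged by columns because this is how the search for \<open>V\<close>
  accumulates it.\<close>

definition vcost :: "nat \<Rightarrow> nat \<Rightarrow> nat \<Rightarrow> (nat \<Rightarrow> nat \<Rightarrow> 'a) \<Rightarrow> (nat \<Rightarrow> nat \<Rightarrow> 'a) \<Rightarrow> (nat \<Rightarrow> nat \<Rightarrow> 'a) \<Rightarrow> nat" where
  "vcost n d k A u v = (\<Sum>j<d. wdist k n (\<lambda>_. 1) (\<lambda>i. A i j) u (\<lambda>m. v m j))"

text \<open>The digits of a guess \<open>g\<close> are \<open>t\<close> column indices, \<open>t\<close> weights and a \<open>t \<times> k\<close> matrix; all of them
  are digits in base \<open>d * q\<close> and are reduced modulo \<open>d\<close> or \<open>q\<close>.\<close>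

definition sample_opt :: "nat \<Rightarrow> nat \<Rightarrow> nat \<Rightarrow> nat \<Rightarrow> (nat \<Rightarrow> nat \<Rightarrow> 'a) \<Rightarrow> (nat \<Rightarrow> nat) \<Rightarrow> (nat \<Rightarrow> nat \<Rightarrow> 'a) \<Rightarrow> bool" where
  "sample_opt n d k t A g u \<longleftrightarrow> (\<forall>r<n. \<forall>u'.
     wdist k t (\<lambda>l. g (t + l) mod d + 1) (\<lambda>l. A r (g l mod d)) (\<lambda>l m. dec (g (2 * t + (l * k + m)) mod q)) (u r)
     \<le> wdist k t (\<lambda>l. g (t + l) mod d + 1) (\<lambda>l. A r (g l mod d)) (\<lambda>l m. dec (g (2 * t + (l * k + m)) mod q)) u')"

definition ustep_com :: com where
  "ustep_com = Seq load_com (Seq (assign ''R'' (var ''n'')) (Seq (assign ''L'' (var ''t''))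
     (Seq (assign ''a'' (var ''d'')) (Seq (assign ''b'' (Const 1)) search_com))))"

lemma mods_ustep_com [simp]: "mods ustep_com = {''l'', ''J'', ''w'', ''x'', ''Y'', ''R'', ''L'', ''a'', ''b'',
   ''f'', ''r'', ''e'', ''H'', ''p'', ''c'', ''z'', ''m'', ''O''}"
  by (auto simp: ustep_com_def)

lemma runs_ustep_com:
  assumes s: "base n d k A s" "s ''t'' 0 = t" "cleared s k"
    and g: "\<forall>i<t * (k + 2). s ''G'' i = g i \<and> g i < W"
    and sz: "sizes k n t d" "t * (k + 2) < W" "n * d < W" "0 < d"
  shows "runs W ustep_com s (40 * t + 40 * (t * k) + n * (row_time k t + 19) + 80)
    (\<lambda>s'. cleared s' k \<and> (\<exists>u. stores s' ''O'' n k u \<and>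
       sample_opt n d k t A g u))"
    (is "runs W _ s _ ?Q")
proof -
  define T0 where "T0 = n * (row_time k t + 19)"
  show ?thesis
    unfolding ustep_com_def
  proof (rule runs_Seq[OF runs_load_com[where t = t and d = d and k = k]])
  let ?y = "\<lambda>l m. dec (g (2 * t + (l * k + m)) mod q)"
  let ?wt = "\<lambda>l. g (t + l) mod d + 1"
  fix s1 assume s1: "(\<forall>l<t. s1 ''J'' l = s ''G'' l mod d \<and> s1 ''w'' l = s ''G'' (t + l) mod d + 1) \<and>
       (\<forall>x<t * k. s1 ''Y'' x = s ''G'' (2 * t + x) mod q)"
    and "\<forall>x. x \<notin> mods load_com \<longrightarrow> s1 x = s x"
  then have fr: "\<forall>x. x \<notin> {''l'', ''J'', ''w'', ''x'', ''Y''} \<longrightarrow> s1 x = s x" by simp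
  have N: "t * (k + 2) = 2 * t + t * k" by simp
  have sW: "k < W" "n < W" "t < W" "d < W" using sz by (auto simp: sizes_def)
  define s2 where "s2 = s1(''R'' := (s1 ''R'')(0 := n), ''L'' := (s1 ''L'')(0 := t), ''a'' := (s1 ''a'')(0 := d), ''b'' := (s1 ''b'')(0 := 1))"
  have b1: "base n d k A s1" by (rule base_cong[OF s(1)]) (use fr in simp)
  have b2: "base n d k A s2" by (rule base_cong[OF b1]) (simp add: s2_def)
  have t1: "s1 ''t'' 0 = t" using fr s by simp
  have in2: "inputs s2 k n t d ?wt (\<lambda>r l. A r (g l mod d)) ?y"
    unfolding inputs_def
  proof (intro conjI allI impI)
    show "tables s2" "s2 ''k'' 0 = k" "s2 ''d'' 0 = d" using b2 by (auto simp: base_def)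
    show "s2 ''R'' 0 = n" "s2 ''L'' 0 = t" "s2 ''a'' 0 < W" "s2 ''b'' 0 < W" using sW W_gt by (simp_all add: s2_def)
    fix l assume l: "l < t"
    then have gl: "s ''G'' l = g l" "s ''G'' (t + l) = g (t + l)" using g by (auto simp: N)
    have J: "s2 ''J'' l = g l mod d" "s2 ''w'' l = g (t + l) mod d + 1"
      using s1 l by (simp_all add: s2_def gl)
    have lt: "g l mod d < d" "g (t + l) mod d < d" using sz by simp_all
    show "s2 ''J'' l < W" "s2 ''w'' l = ?wt l" "?wt l \<le> d"
      using less_trans[OF lt(1) sW(4)] lt by (simp_all add: J)
    { fix r assume r: "r < n"
      have a: "r * s2 ''a'' 0 + s2 ''J'' l * s2 ''b'' 0 = r * d + g l mod d" by (simp add: J) (simp add: s2_def)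
      show "r * s2 ''a'' 0 + s2 ''J'' l * s2 ''b'' 0 < W"
        unfolding a using index_less[OF r lt(1)] sz by linarith
      show "s2 ''A'' (r * s2 ''a'' 0 + s2 ''J'' l * s2 ''b'' 0) = enc (A r (g l mod d))"
        unfolding a using b2 r lt by (simp add: base_def) }
    { fix m assume m: "m < k"
      have i: "l * k + m < t * k" by (rule index_less[OF l m])
      then have "s2 ''Y'' (l * k + m) = g (2 * t + (l * k + m)) mod q"
        using s1 g by (simp add: s2_def N)
      moreover have "g (2 * t + (l * k + m)) mod q < q" using q_ge_2 by simp
      ultimately show "s2 ''Y'' (l * k + m) = enc (?y l m)" by (simp add: enc_dec) }
  qed
  have H2: "cleared s2 k" using fr s by (simp add: s2_def)
  have srch: "runs W search_com s2 (T0 + 12)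
    ?Q"
    by (rule runs_conseq[OF runs_search_com[OF in2 sz(1) H2]]) (auto simp: sample_opt_def T0_def)
  have v1: "s1 ''n'' 0 = n" "s1 ''d'' 0 = d" using b1 by (auto simp: base_def)
  show "runs W (Seq (assign ''R'' (var ''n'')) (Seq (assign ''L'' (var ''t''))
     (Seq (assign ''a'' (var ''d'')) (Seq (assign ''b'' (Const 1)) search_com)))) s1 (T0 + 40)
    ?Q"
    by (rule runs_assign_Seq[OF _ _ runs_assign_Seq[OF _ _ runs_assign_Seq[OF _ _ runs_assign_Seq[where T = "T0 + 12", OF _ _ _ order_refl] order_refl] order_refl]])
      (use sW W_gt srch in \<open>simp_all add: v1 t1 s2_def\<close>)
  qed (use s g sz in \<open>auto simp: base_def sizes_def T0_def\<close>)
qed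

text \<open>Now the rows of \<open>U\<close> are the coefficient vectors and the columns of
  \<open>A\<close> the words to be fitted. The copy in \<open>Y\<close> also preserves
  \<open>U\<close>, since the search overwrites \<open>O\<close>.\<close>

definition vstep_com :: com where
  "vstep_com = Seq (copy_com ''Y'' ''O'') (Seq unit_com (Seq (assign ''R'' (var ''d'')) (Seq (assign ''L'' (var ''n''))
     (Seq (assign ''a'' (Const 1)) (Seq (assign ''b'' (var ''d'')) search_com)))))"

lemma mods_vstep_com [simp]: "mods vstep_com = {''l'', ''J'', ''w'', ''x'', ''Y'', ''R'', ''L'', ''a'', ''b'',
   ''f'', ''r'', ''e'', ''H'', ''p'', ''c'', ''z'', ''m'', ''O''}"
  by (auto simp: vstep_com_def)

lemma runs_vstep_com:
  assumes s: "base n d k A s" "cleared s k" "stores s ''O'' n k u"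
    and sz: "sizes k d n d" "n * d < W" "0 < d"
  shows "runs W vstep_com s (21 * (n * k) + 30 * n + d * (row_time k n + 19) + 60)
    (\<lambda>s'. cleared s' k \<and> stores s' ''Y'' n k u \<and>
       (\<exists>v. (\<forall>j<d. \<forall>m<k. s' ''O'' (j * k + m) = enc (v m j)) \<and> s' ''f'' 0 = vcost n d k A u v \<and>
          (\<forall>v'. vcost n d k A u v \<le> vcost n d k A u v')))"
    (is "runs W _ s _ ?Q")
proof -
  define T0 where "T0 = d * (row_time k n + 19)"
  have sW: "k < W" "n < W" "d < W" "n * k < W" using sz by (auto simp: sizes_def)
  have O: "\<forall>x<n * k. s ''O'' x < W"
    by (rule all_flat_index) (use s enc_less_W in auto)
  show ?thesis
    unfolding vstep_com_def
  proof (rule runs_Seq[OF runs_copy_com[where n = n and k = k]])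
    fix s1 assume s1: "\<forall>i<n * k. s1 ''Y'' i = s ''O'' i" and "\<forall>x. x \<notin> mods (copy_com ''Y'' ''O'') \<longrightarrow> s1 x = s x"
    then have fr1: "\<forall>x. x \<notin> {''x'', ''Y''} \<longrightarrow> s1 x = s x" by simp
    have b1: "base n d k A s1" by (rule base_cong[OF s(1)]) (use fr1 in simp)
    have Y1: "s1 ''Y'' (r * k + m) = enc (u r m)" if "r < n" "m < k" for r m
      using s1 s(3) index_less[OF that] that by simp
    show "runs W (Seq unit_com (Seq (assign ''R'' (var ''d'')) (Seq (assign ''L'' (var ''n''))
     (Seq (assign ''a'' (Const 1)) (Seq (assign ''b'' (var ''d'')) search_com))))) s1
     (30 * n + T0 + 45) ?Q"
    proof (rule runs_Seq[OF runs_unit_com[where n = n]])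
      show "s1 ''n'' 0 = n" "n < W" using b1 sW by (auto simp: base_def)
      fix s2 assume s2: "\<forall>l<n. s2 ''J'' l = l \<and> s2 ''w'' l = 1" and "\<forall>x. x \<notin> mods unit_com \<longrightarrow> s2 x = s1 x"
      then have fr2: "\<forall>x. x \<notin> {''l'', ''J'', ''w''} \<longrightarrow> s2 x = s1 x" by simp
      have b2: "base n d k A s2" by (rule base_cong[OF b1]) (use fr2 in simp)
      define s3 where "s3 = s2(''R'' := (s2 ''R'')(0 := d), ''L'' := (s2 ''L'')(0 := n), ''a'' := (s2 ''a'')(0 := 1), ''b'' := (s2 ''b'')(0 := d))"
      have b3: "base n d k A s3" by (rule base_cong[OF b2]) (simp add: s3_def)
      have Y3: "s3 ''Y'' (r * k + m) = enc (u r m)" if "r < n" "m < k" for r m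
        using fr2 Y1[OF that] by (simp add: s3_def)
      have in3: "inputs s3 k d n d (\<lambda>_. 1) (\<lambda>j i. A i j) u"
        unfolding inputs_def
      proof (intro conjI allI impI)
        show "tables s3" "s3 ''k'' 0 = k" "s3 ''d'' 0 = d" using b3 by (auto simp: base_def)
        show "s3 ''R'' 0 = d" "s3 ''L'' 0 = n" "s3 ''a'' 0 < W" "s3 ''b'' 0 < W" using sW W_gt by (simp_all add: s3_def)
        fix l assume l: "l < n"
        have J: "s3 ''J'' l = l" "s3 ''w'' l = 1" using s2 l by (simp_all add: s3_def)
        show "s3 ''J'' l < W" "s3 ''w'' l = 1" "1 \<le> d" using l sW sz by (auto simp: J)
        { fix r assume r: "r < d"
          have a: "r * s3 ''a'' 0 + s3 ''J'' l * s3 ''b'' 0 = l * d + r" by (simp add: J) (simp add: s3_def)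
          show "r * s3 ''a'' 0 + s3 ''J'' l * s3 ''b'' 0 < W"
            unfolding a using index_less[OF l r] sz by linarith
          show "s3 ''A'' (r * s3 ''a'' 0 + s3 ''J'' l * s3 ''b'' 0) = enc (A l r)"
            unfolding a using b3 r l by (simp add: base_def) }
        fix m assume "m < k"
        then show "s3 ''Y'' (l * k + m) = enc (u l m)" using Y3 l by simp
      qed
      have H3: "cleared s3 k" using fr2 fr1 s by (simp add: s3_def)
      have srch: "runs W search_com s3 (T0 + 12) ?Q"
      proof (rule runs_conseq[OF runs_search_com[OF in3 sz(1) H3]])
        fix s' assume s': "cleared s' k \<and>
          (\<exists>v. stores s' ''O'' d k v \<and>
            s' ''f'' 0 = (\<Sum>r<d. wdist k n (\<lambda>_. 1) (\<lambda>i. A i r) u (v r)) \<and>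
            (\<forall>r<d. \<forall>u'. wdist k n (\<lambda>_. 1) (\<lambda>i. A i r) u (v r) \<le> wdist k n (\<lambda>_. 1) (\<lambda>i. A i r) u u'))"
          "\<forall>x. x \<notin> mods search_com \<longrightarrow> s' x = s3 x"
        then obtain v where v: "stores s' ''O'' d k v"
            "s' ''f'' 0 = (\<Sum>r<d. wdist k n (\<lambda>_. 1) (\<lambda>i. A i r) u (v r))"
            "\<forall>r<d. \<forall>u'. wdist k n (\<lambda>_. 1) (\<lambda>i. A i r) u (v r) \<le> wdist k n (\<lambda>_. 1) (\<lambda>i. A i r) u u'"
          by blast
        have "s' ''Y'' = s3 ''Y''" using s'(2) by simp
        \<comment> \<open>The columns of \<open>V\<close> do not interact, so minimising each of
          them minimises over all matrices.\<close>
        moreover have "\<forall>v'. vcost n d k A u (\<lambda>m j. v j m) \<le> vcost n d k A u v'"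
          unfolding vcost_def using v(3) by (intro allI sum_mono) auto
        ultimately show "?Q s'" using s'(1) v Y3 by (intro conjI exI[of _ "\<lambda>m j. v j m"]) (auto simp: vcost_def)
      qed (simp add: T0_def)
      have v2: "s2 ''n'' 0 = n" "s2 ''d'' 0 = d" using b2 by (auto simp: base_def)
      show "runs W (Seq (assign ''R'' (var ''d'')) (Seq (assign ''L'' (var ''n''))
       (Seq (assign ''a'' (Const 1)) (Seq (assign ''b'' (var ''d'')) search_com)))) s2 (T0 + 32) ?Q"
        by (rule runs_assign_Seq[OF _ _ runs_assign_Seq[OF _ _ runs_assign_Seq[OF _ _ runs_assign_Seq[where T = "T0 + 12", OF _ _ _ order_refl] order_refl] order_refl]])
          (use sW W_gt srch in \<open>simp_all add: v2 s3_def\<close>)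
    qed simp
  qed (use s sW O W_gt in \<open>auto simp: base_def T0_def\<close>)
qed

section \<open>Keeping the best of all guesses\<close>

definition keep_com :: com where
  "keep_com = Cond (Less (var ''f'') (var ''g''))
     (Seq (assign ''g'' (var ''f'')) (Seq (copy_com ''U'' ''Y'') transpose_com)) Skip"

lemma mods_keep_com [simp]: "mods keep_com = {''g'', ''x'', ''U'', ''j'', ''m'', ''V''}"
  by (auto simp: keep_com_def)

lemma runs_keep_com:
  assumes s: "s ''n'' 0 = n" "s ''d'' 0 = d" "s ''k'' 0 = k"
    and sz: "sizes k d n d"
    and Y: "stores s ''Y'' n k u" and O: "\<forall>j<d. \<forall>m<k. s ''O'' (j * k + m) = enc (v m j)"
    and fg: "s ''f'' 0 < W" "s ''g'' 0 < W"
  shows "runs W keep_com s (21 * (n * k) + d * (40 * k + 30) + 50)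
    (\<lambda>s'. if s ''f'' 0 < s ''g'' 0 then s' ''g'' 0 = s ''f'' 0 \<and>
        stores s' ''U'' n k u \<and> stores s' ''V'' k d v
      else s' ''g'' = s ''g'' \<and> s' ''U'' = s ''U'' \<and> s' ''V'' = s ''V'')"
    (is "runs W _ s _ ?Q")
  unfolding keep_com_def
proof (rule runs_Cond)
  have sW: "k < W" "n < W" "d < W" "n * k < W" "d * k < W" using sz by (auto simp: sizes_def)
  have YW: "\<forall>x<n * k. s ''Y'' x < W"
    by (rule all_flat_index) (use Y enc_less_W in auto)
  have OW: "\<forall>x<d * k. s ''O'' x < W"
    by (rule all_flat_index) (use O enc_less_W in auto)
  show "bfits W (Less (var ''f'') (var ''g'')) s" using fg W_gt by simp
  assume lt: "bval (Less (var ''f'') (var ''g'')) s"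
  show "runs W (Seq (assign ''g'' (var ''f'')) (Seq (copy_com ''U'' ''Y'') transpose_com)) s (21 * (n * k) + d * (40 * k + 30) + 40) ?Q"
  proof (rule runs_assign_Seq)
    let ?s = "s(''g'' := (s ''g'')(0 := aval (var ''f'') s))"
    show "runs W (Seq (copy_com ''U'' ''Y'') transpose_com) ?s (21 * (n * k) + d * (40 * k + 30) + 32) ?Q"
    proof (rule runs_Seq[OF runs_copy_com[where n = n and k = k]])
      fix s1 assume s1: "\<forall>i<n * k. s1 ''U'' i = ?s ''Y'' i" and "\<forall>x. x \<notin> mods (copy_com ''U'' ''Y'') \<longrightarrow> s1 x = ?s x"
      then have fr: "\<forall>x. x \<notin> {''x'', ''U''} \<longrightarrow> s1 x = ?s x" by simp
      show "runs W transpose_com s1 (d * (40 * k + 30) + 20) ?Q"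
      proof (rule runs_conseq[OF runs_transpose_com[where d = d and k = k] order_refl])
        show "\<forall>i<d * k. s1 ''O'' i < W" using fr OW by simp
        fix s' assume s': "\<forall>j<d. \<forall>m<k. s' ''V'' (m * d + j) = s1 ''O'' (j * k + m)"
          "\<forall>x. x \<notin> mods transpose_com \<longrightarrow> s' x = s1 x"
        then have "s' ''U'' = s1 ''U''" "s' ''g'' 0 = s ''f'' 0" "s1 ''O'' = s ''O''" using fr by simp_all
        moreover have "stores s1 ''U'' n k u"
          using s1 Y index_less by simp
        ultimately show "?Q s'" using s'(1) O lt by simp
      qed (use fr s sW W_gt in simp_all)
    qed (use s sW W_gt YW in simp_all)
  qed (use fg W_gt in simp_all)
next
  assume "\<not> bval (Less (var ''f'') (var ''g'')) s"
  then show "runs W Skip s (21 * (n * k) + d * (40 * k + 30) + 40) ?Q"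
    by (intro runs_Skip) simp_all
qed simp

definition guess_com :: com where
  "guess_com = Seq ustep_com (Seq vstep_com keep_com)"

lemma mods_guess_com [simp]: "mods guess_com = {''l'', ''J'', ''w'', ''x'', ''Y'', ''R'', ''L'', ''a'', ''b'',
   ''f'', ''r'', ''e'', ''H'', ''p'', ''c'', ''z'', ''m'', ''O'', ''g'', ''U'', ''j'', ''V''}"
  by (auto simp: guess_com_def)

definition guess_time :: "nat \<Rightarrow> nat \<Rightarrow> nat \<Rightarrow> nat \<Rightarrow> nat" where
  "guess_time n d k t = 40 * t + 40 * (t * k) + n * (row_time k t + 19) + 42 * (n * k) + 30 * n
     + d * (row_time k n + 19) + d * (40 * k + 30) + 190"

lemma vcost_le: "vcost n d k A u v \<le> n * d"
proof -
  have "vcost n d k A u v \<le> (\<Sum>j<d. n * 1)"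
    unfolding vcost_def by (intro sum_mono wdist_le) simp
  then show ?thesis by (simp add: mult.commute)
qed

lemma runs_guess_com:
  assumes s: "base n d k A s" "s ''t'' 0 = t" "cleared s k" "s ''g'' 0 < W"
    and g: "\<forall>i<t * (k + 2). s ''G'' i = g i \<and> g i < W"
    and sz: "sizes k n t d" "sizes k d n d" "t * (k + 2) < W" "n * d < W" "0 < d"
  shows "runs W guess_com s (guess_time n d k t) (\<lambda>s'. cleared s' k \<and>
    (\<exists>u v. sample_opt n d k t A g u \<and> (\<forall>v'. vcost n d k A u v \<le> vcost n d k A u v') \<and>
      (if vcost n d k A u v < s ''g'' 0 then s' ''g'' 0 = vcost n d k A u v \<and>
        stores s' ''U'' n k u \<and> stores s' ''V'' k d v
      else s' ''g'' = s ''g'' \<and> s' ''U'' = s ''U'' \<and> s' ''V'' = s ''V'')))"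
    (is "runs W guess_com s _ ?Q")
  unfolding guess_com_def
proof (rule runs_Seq[OF runs_ustep_com[OF s(1-3) g sz(1,3-5)]])
  fix s1 assume "cleared s1 k \<and> (\<exists>u. stores s1 ''O'' n k u \<and>
       sample_opt n d k t A g u)"
    and fr1: "\<forall>x. x \<notin> mods ustep_com \<longrightarrow> s1 x = s x"
  then obtain u where u: "cleared s1 k" "stores s1 ''O'' n k u"
       "sample_opt n d k t A g u" by blast
  have b1: "base n d k A s1" by (rule base_cong[OF s(1)]) (use fr1 in simp)
  show "runs W (Seq vstep_com keep_com) s1
      (21 * (n * k) + 30 * n + d * (row_time k n + 19) + 60 + (21 * (n * k) + d * (40 * k + 30) + 50)) ?Q"
  proof (rule runs_Seq[OF runs_vstep_com[OF b1 u(1,2) sz(2,4,5)] _ order_refl])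
    fix s2 assume s2: "cleared s2 k \<and> stores s2 ''Y'' n k u \<and>
       (\<exists>v. (\<forall>j<d. \<forall>m<k. s2 ''O'' (j * k + m) = enc (v m j)) \<and> s2 ''f'' 0 = vcost n d k A u v \<and>
          (\<forall>v'. vcost n d k A u v \<le> vcost n d k A u v'))"
      and fr2: "\<forall>x. x \<notin> mods vstep_com \<longrightarrow> s2 x = s1 x"
    then obtain v where v: "\<forall>j<d. \<forall>m<k. s2 ''O'' (j * k + m) = enc (v m j)" "s2 ''f'' 0 = vcost n d k A u v"
          "\<forall>v'. vcost n d k A u v \<le> vcost n d k A u v'" by blast
    have b2: "base n d k A s2" by (rule base_cong[OF b1]) (use fr2 in simp)
    have eq: "s2 ''g'' = s ''g''" "s2 ''U'' = s ''U''" "s2 ''V'' = s ''V''" using fr1 fr2 by simp_all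
    show "runs W keep_com s2 (21 * (n * k) + d * (40 * k + 30) + 50) ?Q"
    proof (rule runs_conseq[OF runs_keep_com[where n = n and d = d and k = k and u = u and v = v] order_refl])
      show "s2 ''f'' 0 < W" using vcost_le[of n d k A u v] sz(4) v(2) by simp
      show "s2 ''g'' 0 < W" using eq s(4) by simp
      fix s' assume s': "if s2 ''f'' 0 < s2 ''g'' 0 then s' ''g'' 0 = s2 ''f'' 0 \<and>
        stores s' ''U'' n k u \<and> stores s' ''V'' k d v
      else s' ''g'' = s2 ''g'' \<and> s' ''U'' = s2 ''U'' \<and> s' ''V'' = s2 ''V''"
        "\<forall>x. x \<notin> mods keep_com \<longrightarrow> s' x = s2 x"
      have "cleared s' k" using s'(2) s2 by simp
      with s'(1) u(3) v(3) show "?Q s'" unfolding eq v(2) by blast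
    qed (use b2 s2 v sz in \<open>auto simp: base_def\<close>)
  qed
qed (simp add: guess_time_def)

text \<open>\<open>M\<close> is a constant of the program, while \<open>t\<close> is computed from
  \<open>k\<close> at run time. A single base \<open>d * q\<close> serves all three kinds of digits;
  this repeats guesses but affects the time only through the exponent of \<open>d\<close>. The
  initial \<open>g\<close> exceeds every cost.\<close>

definition main_com :: "nat \<Rightarrow> com" where
  "main_com M = Seq (assign ''t'' (Mul (Mul (Const M) (var ''k'')) (var ''k'')))
     (Seq (assign ''N'' (Mul (var ''t'') (Add (var ''k'') (Const 2))))
     (Seq (assign ''B'' (Mul (var ''d'') (Const q)))
     (Seq (assign ''g'' (Add (Mul (var ''n'') (var ''d'')) (Const 1)))
       (Enumerate ''G'' (var ''N'') (var ''B'') ''i'' guess_com))))"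

text \<open>Which minimisers the row searches find for a guess is left open, hence the existential
  \<open>u'\<close>; the guarantee for a good sample holds for all of them.\<close>

lemma runs_main_com:
  assumes s: "base n d k A s" "\<forall>m. s ''G'' m = 0" "\<forall>m. s ''H'' m = 0"
    and t: "t = M * k * k" and N: "N = t * (k + 2)"
    and sz: "sizes k n t d" "sizes k d n d" "N + 1 < W" "d * q < W" "n * d + 1 < W" "0 < d"
      "M < W" "M * k < W" "k + 2 < W"
  shows "runs W (main_com M) s ((d * q) ^ N * (guess_time n d k t + (N + 2) * 24 + 2) + 50)
    (\<lambda>s'. \<exists>u v. stores s' ''U'' n k u \<and>
      stores s' ''V'' k d v \<and>
      (\<forall>c<(d * q) ^ N. \<exists>u'. sample_opt n d k t A (\<lambda>i. c div (d * q) ^ i mod (d * q)) u' \<and>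
         (\<forall>v'. vcost n d k A u v \<le> vcost n d k A u' v')))"
    (is "runs W _ s _ ?Q")
proof -
  let ?vc = "vcost n d k A" and ?opt = "sample_opt n d k t A"
  define stored where "stored s' u v \<longleftrightarrow> stores s' ''U'' n k u \<and>
      (stores s' ''V'' k d v)" for s' :: state and u v
  define b where "b = d * q"
  define I where "I c s' \<longleftrightarrow> cleared s' k \<and>
     (c = 0 \<and> s' ''g'' 0 = n * d + 1 \<or> (\<exists>u v. stored s' u v \<and> s' ''g'' 0 = ?vc u v)) \<and>
     (\<forall>c'<c. \<exists>u'. ?opt (\<lambda>i. c' div b ^ i mod b) u' \<and>
         (\<forall>v'. s' ''g'' 0 \<le> ?vc u' v'))" for c s'
  have b: "2 \<le> b" "b < W" unfolding b_def using q_ge_2 sz mult_le_mono[of 1 d 2 q] by auto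
  have sW: "k < W" "n < W" "t < W" "d < W" using sz by (auto simp: sizes_def)
  define s1 where "s1 = s(''t'' := (s ''t'')(0 := t), ''N'' := (s ''N'')(0 := N), ''B'' := (s ''B'')(0 := b), ''g'' := (s ''g'')(0 := n * d + 1))"
  define Tg where "Tg = guess_time n d k t"
  define T where "T = b ^ N * (Tg + (N + 2) * 24 + 2) + 6"
  have b1: "base n d k A s1" by (rule base_cong[OF s(1)]) (simp add: s1_def)
  have "runs W (Enumerate ''G'' (var ''N'') (var ''B'') ''i'' guess_com) s1 T (\<lambda>s'. I (b ^ N) s' \<and> (\<forall>m<N. s' ''G'' m = 0))"
  proof (rule runs_Enumerate[where T = Tg, OF _ _ _ b sz(3)])
    show "I 0 s1" using s by (simp add: I_def s1_def)
  next
    fix c s2 assume c: "c < b ^ N" and I2: "I c s2" and dg: "\<forall>m<N. s2 ''G'' m = c div b ^ m mod b"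
      and fr: "\<forall>y. y \<noteq> ''G'' \<longrightarrow> y \<noteq> ''i'' \<longrightarrow> y \<notin> mods guess_com \<longrightarrow> s2 y = s1 y"
    have b2: "base n d k A s2" by (rule base_cong[OF b1]) (use fr in simp)
    have t2: "s2 ''t'' 0 = t" using fr by (simp add: s1_def)
    have H2: "cleared s2 k" using I2 by (simp add: I_def)
    have "s2 ''g'' 0 = n * d + 1 \<or> (\<exists>u v. s2 ''g'' 0 = ?vc u v)" using I2 unfolding I_def by blast
    then have "s2 ''g'' 0 \<le> n * d + 1"
    proof (elim disjE exE)
      fix u v assume "s2 ''g'' 0 = ?vc u v"
      then show ?thesis using vcost_le[of n d k A u v] by linarith
    qed simp
    then have g2: "s2 ''g'' 0 < W" using sz by linarith
    have G2: "\<forall>i<t * (k + 2). s2 ''G'' i = c div b ^ i mod b \<and> c div b ^ i mod b < W"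
    proof (intro allI impI conjI)
      fix i assume "i < t * (k + 2)"
      then show "s2 ''G'' i = c div b ^ i mod b" using dg N by simp
      have "c div b ^ i mod b < b" using b by simp
      then show "c div b ^ i mod b < W" using b by linarith
    qed
    show "runs W guess_com s2 Tg (\<lambda>s'. \<forall>s''. (\<forall>y. y \<noteq> ''G'' \<longrightarrow> y \<noteq> ''i'' \<longrightarrow> s'' y = s' y) \<longrightarrow> I (Suc c) s'')"
    proof (rule runs_conseq[OF runs_guess_com[OF b2 t2 H2 g2 G2 sz(1,2)]])
      fix s3 assume "cleared s3 k \<and>
        (\<exists>u v. ?opt (\<lambda>i. c div b ^ i mod b) u \<and> (\<forall>v'. ?vc u v \<le> ?vc u v') \<and>
        (if ?vc u v < s2 ''g'' 0 then s3 ''g'' 0 = ?vc u v \<and>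
          stores s3 ''U'' n k u \<and> stores s3 ''V'' k d v
        else s3 ''g'' = s2 ''g'' \<and> s3 ''U'' = s2 ''U'' \<and> s3 ''V'' = s2 ''V''))"
      then obtain u v where H3: "cleared s3 k"
        and uv: "?opt (\<lambda>i. c div b ^ i mod b) u" "\<forall>v'. ?vc u v \<le> ?vc u v'"
        "if ?vc u v < s2 ''g'' 0 then s3 ''g'' 0 = ?vc u v \<and> stored s3 u v
        else s3 ''g'' = s2 ''g'' \<and> s3 ''U'' = s2 ''U'' \<and> s3 ''V'' = s2 ''V''" unfolding stored_def by blast
      have best: "s3 ''g'' 0 \<le> ?vc u v" "s3 ''g'' 0 \<le> s2 ''g'' 0"
        using uv(3) by (auto split: if_splits)
      have ex: "\<exists>u v. stored s3 u v \<and> s3 ''g'' 0 = ?vc u v"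
      proof (cases "?vc u v < s2 ''g'' 0")
        case True
        then show ?thesis using uv(3) by auto
      next
        case False
        then have "s2 ''g'' 0 \<noteq> n * d + 1" using vcost_le[of n d k A u v] by linarith
        then obtain u2 v2 where "stored s2 u2 v2" "s2 ''g'' 0 = ?vc u2 v2" using I2 unfolding I_def by blast
        then show ?thesis using uv(3) False by (auto simp: stored_def)
      qed
      have all: "\<exists>u'. ?opt (\<lambda>i. c' div b ^ i mod b) u' \<and> (\<forall>v'. s3 ''g'' 0 \<le> ?vc u' v')"
        if "c' < Suc c" for c'
      proof (cases "c' = c")
        case True
        then show ?thesis using uv(1,2) best(1) order_trans by blast
      next
        case False
        then have "c' < c" using that by simp
        then obtain u' where "?opt (\<lambda>i. c' div b ^ i mod b) u'" "\<forall>v'. s2 ''g'' 0 \<le> ?vc u' v'"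
          using I2 unfolding I_def by blast
        then show ?thesis using best(2) order_trans by blast
      qed
      show "\<forall>s''. (\<forall>y. y \<noteq> ''G'' \<longrightarrow> y \<noteq> ''i'' \<longrightarrow> s'' y = s3 y) \<longrightarrow> I (Suc c) s''"
      proof (intro allI impI)
        fix s'' :: state assume "\<forall>y. y \<noteq> ''G'' \<longrightarrow> y \<noteq> ''i'' \<longrightarrow> s'' y = s3 y"
        then have "s'' ''H'' = s3 ''H''" "s'' ''g'' = s3 ''g''" "s'' ''U'' = s3 ''U''" "s'' ''V'' = s3 ''V''" by simp_all
        then show "I (Suc c) s''" using H3 ex all unfolding I_def stored_def by simp
      qed
    qed (use sz N in \<open>simp_all add: Tg_def\<close>)
  qed (use sz s b in \<open>simp_all add: s1_def T_def Tg_def\<close>)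
  then have main: "runs W (Enumerate ''G'' (var ''N'') (var ''B'') ''i'' guess_com) s1 T ?Q"
  proof (rule runs_conseq[OF _ order_refl])
    fix s' assume I: "I (b ^ N) s' \<and> (\<forall>m<N. s' ''G'' m = 0)"
    have nz: "b ^ N \<noteq> 0" using b by simp
    have "b ^ N = 0 \<and> s' ''g'' 0 = n * d + 1 \<or> (\<exists>u v. stored s' u v \<and> s' ''g'' 0 = ?vc u v)"
      using I unfolding I_def by (elim conjE)
    then have "\<exists>u v. stored s' u v \<and> s' ''g'' 0 = ?vc u v"
      by (simp only: nz simp_thms)
    then obtain u v where uv: "stored s' u v" "s' ''g'' 0 = ?vc u v" by (elim exE conjE)
    have "\<forall>c<b ^ N. \<exists>u'. ?opt (\<lambda>i. c div b ^ i mod b) u' \<and> (\<forall>v'. ?vc u v \<le> ?vc u' v')"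
      unfolding uv(2)[symmetric] using I unfolding I_def by (elim conjE)
    with uv(1) have "stored s' u v \<and> (\<forall>c<b ^ N. \<exists>u'. ?opt (\<lambda>i. c div b ^ i mod b) u' \<and>
        (\<forall>v'. ?vc u v \<le> ?vc u' v'))" by (rule conjI)
    then show "?Q s'" unfolding stored_def b_def conj_assoc
      by - (rule exI, rule exI, assumption)
  qed
  have v: "s ''n'' 0 = n" "s ''d'' 0 = d" "s ''k'' 0 = k" using s by (auto simp: base_def)
  have NN: "t + (t + t * k) = N" by (simp add: N)
  have tk: "M * k * k < W" "N < W" "t * (k + 2) < W" "t * (2 + k) < W"
    "d * q < W" "n * d < W" "Suc (n * d) < W" using sz sW t N by (auto simp: add.commute)
  show ?thesis
    unfolding main_com_def
    by (rule runs_assign_Seq[OF _ _ runs_assign_Seq[OF _ _ runs_assign_Seq[OF _ _ runs_assign_Seq[where T = T, OF _ _ _ order_refl] order_refl] order_refl]])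
      (use sW W_gt sz tk main in \<open>simp_all add: v s1_def b_def[symmetric] t[symmetric] NN T_def Tg_def\<close>)
qed

section \<open>Exact factorization when there are at most \<open>k\<close> columns\<close>

definition trivial_com :: com where
  "trivial_com = Seq
     (For ''i'' (var ''n'') (For ''j'' (var ''d'')
       (Write ''U'' (Add (Mul (var ''i'') (var ''k'')) (var ''j'')) (Read ''A'' (Add (Mul (var ''i'') (var ''d'')) (var ''j''))))))
     (For ''j'' (var ''d'') (Write ''V'' (Add (Mul (var ''j'') (var ''d'')) (var ''j'')) (Const (enc 1))))"

text \<open>\<open>U\<close> is \<open>A\<close> padded with zero columns and \<open>V\<close> an
  identity matrix padded with zero rows. Only \<open>n * d + d\<close> entries are written; for
  \<open>d = 1\<close> even clearing the \<open>n * k\<close> entries of \<open>U\<close> would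
  exceed the time bound, so the padding relies on memory that is initially 0 and on
  \<open>enc 0 = 0\<close>.\<close>

lemma runs_trivial_com:
  assumes s: "s ''n'' 0 = n" "s ''d'' 0 = d" "s ''k'' 0 = k" "\<forall>x. s ''U'' x = 0" "\<forall>x. s ''V'' x = 0"
      "stores s ''A'' n d A"
    and dk: "d \<le> k" and W': "k < W" "n * k < W" "n * d < W" "n < W" "d * d < W"
  shows "runs W trivial_com s (n * (60 * d + 60) + 60 * d + 60)
    (\<lambda>s'. (\<forall>i<n. \<forall>m<k. s' ''U'' (i * k + m) = enc (if m < d then A i m else 0)) \<and>
       (\<forall>m<k. \<forall>j<d. s' ''V'' (m * d + j) = enc (if m = j then 1 else 0)))"
proof -
  let ?c = "Write ''U'' (Add (Mul (var ''i'') (var ''k'')) (var ''j'')) (Read ''A'' (Add (Mul (var ''i'') (var ''d'')) (var ''j'')))"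
  let ?f = "For ''j'' (var ''d'') ?c"
  let ?e = "Write ''V'' (Add (Mul (var ''j'') (var ''d'')) (var ''j'')) (Const (enc 1))"
  let ?I = "\<lambda>a s'. \<forall>i<n. \<forall>m<k. s' ''U'' (i * k + m) = enc (if i < a \<and> m < d then A i m else 0)"
  have dW: "d < W" using dk W' by simp
  have loop1: "runs W (For ''i'' (var ''n'') ?f) s (n * (40 * d + 30) + 20) (\<lambda>s'. ?I n s' \<and> s' ''i'' 0 = n)"
  proof (rule runs_For[where T = "40 * d + 12" and I = ?I])
    fix a s1 assume a: "a < n" and I1: "?I a s1" and i1: "s1 ''i'' 0 = a"
      and fr: "\<forall>y. y \<noteq> ''i'' \<longrightarrow> y \<notin> mods ?f \<longrightarrow> s1 y = s y"
    let ?K = "\<lambda>b s'. \<forall>i<n. \<forall>m<k. s' ''U'' (i * k + m) = enc (if i < a \<and> m < d \<or> i = a \<and> m < b then A i m else 0)"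
    have "runs W ?f s1 (40 * d + 12) (\<lambda>s'. ?K d s' \<and> s' ''j'' 0 = d)"
    proof (rule runs_For[where T = 20 and I = ?K])
      fix c s2 assume c: "c < d" and I2: "?K c s2" and j2: "s2 ''j'' 0 = c"
        and fr2: "\<forall>y. y \<noteq> ''j'' \<longrightarrow> y \<notin> mods ?c \<longrightarrow> s2 y = s1 y"
      have v: "s2 ''i'' 0 = a" "s2 ''k'' 0 = k" "s2 ''d'' 0 = d" "s2 ''A'' (a * d + c) = enc (A a c)"
        using fr2 fr s i1 a c by simp_all
      have i: "a * k + c < n * k" "a * d + c < n * d" using index_less[OF a] c dk by simp_all
      have fits: "a < W" "c < W" "a * k + c < W" "a * d + c < W" "a * k < W" "a * d < W"
        using i W' a c dW by linarith+
      have ne: "i * k + m = a * k + c \<longleftrightarrow> i = a \<and> m = c" if "m < k" for i m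
        using index_inject[of i k m a c] that c dk by auto
      have upd: "?K (Suc c) (s2(''U'' := (s2 ''U'')(a * k + c := enc (A a c)), ''j'' := (s2 ''j'')(0 := Suc c)))"
      proof (intro allI impI)
        fix i m assume "i < n" "m < k"
        then show "(s2(''U'' := (s2 ''U'')(a * k + c := enc (A a c)), ''j'' := (s2 ''j'')(0 := Suc c))) ''U'' (i * k + m)
          = enc (if i < a \<and> m < d \<or> i = a \<and> m < Suc c then A i m else 0)"
          using I2 ne[of m i] by (cases "i = a \<and> m = c") (auto simp: less_Suc_eq)
      qed
      show "runs W ?c s2 20 (\<lambda>s'. ?K (Suc c) (s'(''j'' := (s' ''j'')(0 := Suc c))))"
        by (rule runs_Write) (use upd fits W_gt W' dW enc_less_W in \<open>simp_all add: v j2\<close>)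
    next
      show "?K 0 (s1(''j'' := (s1 ''j'')(0 := 0)))" using I1 by simp
    qed (use fr s dW W_gt in simp_all)
    then show "runs W ?f s1 (40 * d + 12) (\<lambda>s'. ?I (Suc a) (s'(''i'' := (s' ''i'')(0 := Suc a))))"
      by (rule runs_conseq) (auto simp: less_Suc_eq)
  qed (use s W' W_gt in \<open>simp_all add: enc_0 algebra_simps\<close>)
  show ?thesis
    unfolding trivial_com_def
  proof (rule runs_Seq[OF loop1])
    fix s1 assume s1: "?I n s1 \<and> s1 ''i'' 0 = n" and fr: "\<forall>x. x \<notin> mods (For ''i'' (var ''n'') ?f) \<longrightarrow> s1 x = s x"
    let ?J = "\<lambda>b s'. \<forall>m<k. \<forall>j<d. s' ''V'' (m * d + j) = enc (if m = j \<and> j < b then 1 else 0)"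
    have "runs W (For ''j'' (var ''d'') ?e) s1 (40 * d + 20) (\<lambda>s'. ?J d s' \<and> s' ''j'' 0 = d)"
    proof (rule runs_For[where T = 20 and I = ?J])
      fix c s2 assume c: "c < d" and I2: "?J c s2" and j2: "s2 ''j'' 0 = c"
        and fr2: "\<forall>y. y \<noteq> ''j'' \<longrightarrow> y \<notin> mods ?e \<longrightarrow> s2 y = s1 y"
      have v: "s2 ''d'' 0 = d" using fr2 fr s by simp
      have fits: "c < W" "c * d + c < W" "c * d < W" using index_less[OF c c] W' c dW by linarith+
      have ne: "m * d + j = c * d + c \<longleftrightarrow> m = c \<and> j = c" if "j < d" for m j
        using index_inject[of m d j c c] that c by auto
      have upd: "?J (Suc c) (s2(''V'' := (s2 ''V'')(c * d + c := enc 1), ''j'' := (s2 ''j'')(0 := Suc c)))"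
      proof (intro allI impI)
        fix m j assume "m < k" "j < d"
        then show "(s2(''V'' := (s2 ''V'')(c * d + c := enc 1), ''j'' := (s2 ''j'')(0 := Suc c))) ''V'' (m * d + j)
          = enc (if m = j \<and> j < Suc c then 1 else 0)"
          using I2 ne[of j m] by (cases "m = c \<and> j = c") (auto simp: less_Suc_eq)
      qed
      show "runs W ?e s2 20 (\<lambda>s'. ?J (Suc c) (s'(''j'' := (s' ''j'')(0 := Suc c))))"
        by (rule runs_Write) (use upd fits W_gt W' dW enc_less_W in \<open>simp_all add: v j2\<close>)
    next
      show "?J 0 (s1(''j'' := (s1 ''j'')(0 := 0)))" using fr s by (simp add: enc_0)
    qed (use fr s dW W_gt in simp_all)
    then show "runs W (For ''j'' (var ''d'') ?e) s1 (40 * d + 20)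
      (\<lambda>s'. (\<forall>i<n. \<forall>m<k. s' ''U'' (i * k + m) = enc (if m < d then A i m else 0)) \<and>
       (\<forall>m<k. \<forall>j<d. s' ''V'' (m * d + j) = enc (if m = j then 1 else 0)))"
      by (rule runs_conseq) (use s1 in auto)
  qed (simp add: algebra_simps)
qed

definition plus_code :: "nat \<Rightarrow> nat" where "plus_code i = enc (dec (i div q) + dec (i mod q))"
definition times_code :: "nat \<Rightarrow> nat" where "times_code i = enc (dec (i div q) * dec (i mod q))"

definition prog :: "nat \<Rightarrow> com" where
  "prog M = Cond (Less (var ''k'') (var ''d''))
     (Seq (store_table ''P'' [0..<q * q] plus_code) (Seq (store_table ''M'' [0..<q * q] times_code) (main_com M)))
     trivial_com"

lemma runs_prog_main:
  assumes s: "s ''n'' 0 = n" "s ''d'' 0 = d" "s ''k'' 0 = k" "stores s ''A'' n d A"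
      "\<forall>m. s ''G'' m = 0" "\<forall>m. s ''H'' m = 0"
    and kd: "k < d" and t: "t = M * k * k" and N: "N = t * (k + 2)"
    and sz: "sizes k n t d" "sizes k d n d" "N + 1 < W" "d * q < W" "n * d + 1 < W" "0 < d"
      "M < W" "M * k < W" "k + 2 < W"
  shows "runs W (prog M) s ((d * q) ^ N * (guess_time n d k t + (N + 2) * 24 + 2) + 6 * (q * q) + 60)
    (\<lambda>s'. \<exists>u v. stores s' ''U'' n k u \<and>
      stores s' ''V'' k d v \<and>
      (\<forall>c<(d * q) ^ N. \<exists>u'. sample_opt n d k t A (\<lambda>i. c div (d * q) ^ i mod (d * q)) u' \<and>
         (\<forall>v'. vcost n d k A u v \<le> vcost n d k A u' v')))"
    (is "runs W _ s _ ?Q")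
  unfolding prog_def
proof (rule runs_Cond)
  define T where "T = (d * q) ^ N * (guess_time n d k t + (N + 2) * 24 + 2) + 50"
  let ?is = "[0..<q * q]"
  have dW: "d < W" "k < W" using sz by (auto simp: sizes_def)
  show "bfits W (Less (var ''k'') (var ''d'')) s" using s dW W_gt by simp
  show "runs W (Seq (store_table ''P'' ?is plus_code) (Seq (store_table ''M'' ?is times_code) (main_com M))) s
    (6 * (q * q) + 2 + T) ?Q"
  proof (rule runs_Seq[OF runs_store_table])
    show "\<forall>i\<in>set ?is. i < W \<and> plus_code i < W" using W enc_less_W by (auto simp: plus_code_def)
    fix s1 assume s1: "\<forall>i\<in>set ?is. s1 ''P'' i = plus_code i"
      and "\<forall>x. x \<notin> mods (store_table ''P'' ?is plus_code) \<longrightarrow> s1 x = s x"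
    then have fr1: "\<forall>x. x \<noteq> ''P'' \<longrightarrow> s1 x = s x" using mods_store_table by blast
    show "runs W (Seq (store_table ''M'' ?is times_code) (main_com M)) s1 (3 * (q * q) + 1 + T) ?Q"
    proof (rule runs_Seq[OF runs_store_table])
      show "\<forall>i\<in>set ?is. i < W \<and> times_code i < W" using W enc_less_W by (auto simp: times_code_def)
      fix s2 assume s2: "\<forall>i\<in>set ?is. s2 ''M'' i = times_code i"
        and "\<forall>x. x \<notin> mods (store_table ''M'' ?is times_code) \<longrightarrow> s2 x = s1 x"
      then have fr2: "\<forall>x. x \<noteq> ''M'' \<longrightarrow> s2 x = s1 x" using mods_store_table by blast
      have i: "enc x * q + enc y \<in> set ?is" for x y
        using index_less[OF enc_less[of x] enc_less[of y]] by simp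
      have dv: "(enc x * q + enc y) div q = enc x" "enc y mod q = enc y" "q \<noteq> 0" for x y
        using enc_less[of y] q_ge_2 by simp_all
      have "tables s2"
        unfolding tables_def using s1 s2 fr2 i by (simp add: plus_code_def times_code_def dv)
      then have "base n d k A s2" using s fr1 fr2 by (simp add: base_def)
      then show "runs W (main_com M) s2 T ?Q"
        unfolding T_def using s fr1 fr2 by (intro runs_main_com t N sz) simp_all
    qed simp
  qed simp
  show "1 + bcost (Less (var ''k'') (var ''d'')) + (6 * (q * q) + 2 + T)
     \<le> (d * q) ^ N * (guess_time n d k t + (N + 2) * 24 + 2) + 6 * (q * q) + 60"
    by (simp add: T_def)
  show "runs W trivial_com s (6 * (q * q) + 2 + T) ?Q" if "\<not> bval (Less (var ''k'') (var ''d'')) s"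
    using that s kd by simp
qed

lemma runs_prog_trivial:
  assumes s: "s ''n'' 0 = n" "s ''d'' 0 = d" "s ''k'' 0 = k" "\<forall>x. s ''U'' x = 0" "\<forall>x. s ''V'' x = 0"
      "stores s ''A'' n d A"
    and dk: "d \<le> k" and W': "k < W" "n * k < W" "n * d < W" "n < W" "d * d < W"
  shows "runs W (prog M) s (n * (60 * d + 60) + 60 * d + 70)
    (\<lambda>s'. (\<forall>i<n. \<forall>m<k. s' ''U'' (i * k + m) = enc (if m < d then A i m else 0)) \<and>
       (\<forall>m<k. \<forall>j<d. s' ''V'' (m * d + j) = enc (if m = j then 1 else 0)))"
  unfolding prog_def
proof (rule runs_Cond[where T = "n * (60 * d + 60) + 60 * d + 60"])
  show "bfits W (Less (var ''k'') (var ''d'')) s" using s W' dk W_gt by simp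
qed (use s dk runs_trivial_com[OF s dk W'] in simp_all)

end

section \<open>Quality of the best guess\<close>

lemma l0_norm_residual:
  fixes A :: "'a::field mat"
  assumes "A \<in> carrier_mat n d" "U \<in> carrier_mat n k" "V \<in> carrier_mat k d"
  shows "l0_norm (A - U * V) = (\<Sum>i<n. card {j. j < d \<and> A $$ (i, j) \<noteq> (\<Sum>m<k. U $$ (i, m) * V $$ (m, j))})"
proof -
  have "{(i, j). i < dim_row (A - U * V) \<and> j < dim_col (A - U * V) \<and> (A - U * V) $$ (i, j) \<noteq> 0}
    = (SIGMA i:{..<n}. {j. j < d \<and> A $$ (i, j) \<noteq> (\<Sum>m<k. U $$ (i, m) * V $$ (m, j))})"
    using assms by (auto simp: scalar_prod_def atLeast0LessThan)
  then show ?thesis unfolding l0_norm_def by simp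
qed

lemma l0_rank_opt_attained:
  fixes A :: "'a::field mat"
  assumes "A \<in> carrier_mat n d"
  obtains U V where "U \<in> carrier_mat n k" "V \<in> carrier_mat k d" "l0_norm (A - U * V) = l0_rank_opt k A"
proof -
  let ?S = "(\<lambda>(U, V). l0_norm (A - U * V)) ` (carrier_mat n k \<times> carrier_mat k d)"
  have "(0\<^sub>m n k, 0\<^sub>m k d) \<in> carrier_mat n k \<times> carrier_mat k d" by simp
  then have "?S \<noteq> {}" by blast
  then have "Inf ?S \<in> ?S" by (rule Inf_nat_def1)
  moreover have "l0_rank_opt k A = Inf ?S" using assms by (simp add: l0_rank_opt_def)
  ultimately show ?thesis using that by auto
qed

lemma (in field_machine) vcost_eq:
  "vcost n d k A u v = (\<Sum>i<n. card {j. j < d \<and> A i j \<noteq> (\<Sum>m<k. u i m * v m j)})"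
proof -
  have "vcost n d k A u v = (\<Sum>i<n. \<Sum>j<d. of_bool (A i j \<noteq> (\<Sum>m<k. u i m * v m j)))"
    unfolding vcost_def wdist_def by (subst sum.swap) (simp add: mult.commute del: sum_of_bool_eq)
  moreover have "(\<Sum>j<d. of_bool (P j)) = card {j. j < d \<and> P j}" for P
    by (subst sum_of_bool_eq) (auto intro!: arg_cong[of _ _ card])
  ultimately show ?thesis by simp
qed

lemma (in field_machine) guess_exists:
  assumes J: "\<forall>l<t. J l < d \<and> 1 \<le> w l \<and> w l \<le> d" and d: "0 < d"
  shows "\<exists>c < (d * q) ^ (t * (k + 2)). \<forall>l<t.
     (c div (d * q) ^ l mod (d * q)) mod d = J l \<and>
     (c div (d * q) ^ (t + l) mod (d * q)) mod d + 1 = w l \<and>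
     (\<forall>m<k. dec ((c div (d * q) ^ (2 * t + (l * k + m)) mod (d * q)) mod q) = (Y l m :: 'a))"
proof -
  \<comment> \<open>The inverse of the decoding. Each value is below \<open>d\<close> or below
    \<open>q\<close>, so it is a legal digit and survives the reduction; weights are stored less
    one.\<close>
  define f where "f i = (if i < t then J i else if i < 2 * t then w (i - t) - 1
     else enc (Y ((i - 2 * t) div k) ((i - 2 * t) mod k)))" for i
  have N: "t * (k + 2) = 2 * t + t * k" by simp
  have dq: "d \<le> d * q" "q \<le> d * q" using d q_ge_2 by simp_all
  have "\<forall>i<t * (k + 2). f i < d * q"
  proof (intro allI impI)
    fix i
    consider "i < t" | "t \<le> i" "i < 2 * t" | "2 * t \<le> i" by linarith
    then show "f i < d * q"
    proof cases
      case 1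
      then show ?thesis using J dq(1) by (auto simp: f_def intro: less_le_trans)
    next
      case 2
      then have "i - t < t" by linarith
      then have "w (i - t) - 1 < d" using J d by fastforce
      then have "w (i - t) - 1 < d * q" using dq(1) by linarith
      then show ?thesis using 2 by (simp add: f_def)
    next
      case 3
      then show ?thesis using less_le_trans[OF enc_less dq(2)] by (simp add: f_def)
    qed
  qed
  then obtain c where c: "c < (d * q) ^ (t * (k + 2))" "\<forall>i<t * (k + 2). c div (d * q) ^ i mod (d * q) = f i"
    using digits_exist by blast
  show ?thesis
  proof (intro exI[of _ c] conjI c allI impI)
    fix l assume l: "l < t"
    have "c div (d * q) ^ l mod (d * q) = J l" using c(2) l by (simp add: N f_def)
    then show "(c div (d * q) ^ l mod (d * q)) mod d = J l" using J l by simp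
    have "c div (d * q) ^ (t + l) mod (d * q) = w l - 1" using c(2) l by (simp add: N f_def)
    moreover have "w l - 1 < d" "1 \<le> w l" using J l d by fastforce+
    ultimately show "(c div (d * q) ^ (t + l) mod (d * q)) mod d + 1 = w l" by simp
    fix m assume m: "m < k"
    have "l * k + m < t * k" by (rule index_less[OF l m])
    then have "c div (d * q) ^ (2 * t + (l * k + m)) mod (d * q) = f (2 * t + (l * k + m))"
      using c(2) by (simp add: N)
    also have "\<dots> = enc (Y l m)" using m by (simp add: f_def)
    finally show "dec ((c div (d * q) ^ (2 * t + (l * k + m)) mod (d * q)) mod q) = Y l m"
      using enc_less[of "Y l m"] by simp
  qed
qed

text \<open>The optimal \<open>V\<close> occurs in the analysis only. For the guess that encodes a
  good sample, the rows found together with this unknown \<open>V\<close> already cost at most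
  \<open>1 + \<epsilon>\<close> times the optimum, and \<open>cost\<close> is compared with every
  \<open>v'\<close>, in particular with it.\<close>

lemma (in field_machine) best_guess_good:
  fixes \<epsilon> :: real
  assumes A: "A \<in> carrier_mat n d" and eps: "0 < \<epsilon>" "\<epsilon> < 1" and kdt: "0 < k" "0 < d" "0 < t"
    and t: "128 * real q ^ k / \<epsilon> \<le> exp (real t * \<epsilon>\<^sup>2 / (144 * real k))"
    and best: "\<forall>c<(d * q) ^ (t * (k + 2)). \<exists>u'. sample_opt n d k t (\<lambda>i j. A $$ (i, j)) (\<lambda>i. c div (d * q) ^ i mod (d * q)) u' \<and>
         (\<forall>v'. cost \<le> vcost n d k (\<lambda>i j. A $$ (i, j)) u' v')"
  shows "real cost \<le> (1 + \<epsilon>) * real (l0_rank_opt k A)"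
proof -
  let ?A = "\<lambda>i j. A $$ (i, j)"
  obtain U V where UV: "U \<in> carrier_mat n k" "V \<in> carrier_mat k d" "l0_norm (A - U * V) = l0_rank_opt k A"
    using l0_rank_opt_attained[OF A] .
  define Vf where "Vf m j = V $$ (m, j)" for m j
  define Uf where "Uf i m = U $$ (i, m)" for i m
  obtain J w Y where JwY: "\<forall>l<t. J l < d \<and> 1 \<le> w l \<and> w l \<le> d"
    "\<forall>U. (\<forall>i<n. \<forall>u. (\<Sum>l<t. w l * of_bool (?A i (J l) \<noteq> (\<Sum>m<k. U i m * Y l m)))
        \<le> (\<Sum>l<t. w l * of_bool (?A i (J l) \<noteq> (\<Sum>m<k. u m * Y l m)))) \<longrightarrow>
      (\<Sum>i<n. real (card {j. j < d \<and> ?A i j \<noteq> (\<Sum>m<k. U i m * Vf m j)}))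
      \<le> (1 + \<epsilon>) * (\<Sum>i<n. real (card {j. j < d \<and> ?A i j \<noteq> (\<Sum>m<k. Uf i m * Vf m j)}))"
    using exists_good_columns[OF eps kdt t[unfolded q_def], of n ?A Vf Uf] by (elim exE conjE)
  obtain c where c: "c < (d * q) ^ (t * (k + 2))" "\<forall>l<t.
     (c div (d * q) ^ l mod (d * q)) mod d = J l \<and>
     (c div (d * q) ^ (t + l) mod (d * q)) mod d + 1 = w l \<and>
     (\<forall>m<k. dec ((c div (d * q) ^ (2 * t + (l * k + m)) mod (d * q)) mod q) = Y l m)"
    using guess_exists[OF JwY(1) kdt(2)] by blast
  obtain u where u: "sample_opt n d k t ?A (\<lambda>i. c div (d * q) ^ i mod (d * q)) u" "\<forall>v'. cost \<le> vcost n d k ?A u v'"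
    using best c(1) by blast
  have "wdist k t (\<lambda>l. c div (d * q) ^ (t + l) mod (d * q) mod d + 1) (\<lambda>l. ?A r (c div (d * q) ^ l mod (d * q) mod d))
      (\<lambda>l m. dec (c div (d * q) ^ (2 * t + (l * k + m)) mod (d * q) mod q)) u'
     = (\<Sum>l<t. w l * of_bool (?A r (J l) \<noteq> (\<Sum>m<k. u' m * Y l m)))" for r u'
    unfolding wdist_def using c(2) by (intro sum.cong) auto
  then have uopt: "\<forall>i<n. \<forall>u'. (\<Sum>l<t. w l * of_bool (?A i (J l) \<noteq> (\<Sum>m<k. u i m * Y l m)))
        \<le> (\<Sum>l<t. w l * of_bool (?A i (J l) \<noteq> (\<Sum>m<k. u' m * Y l m)))"
    using u(1) unfolding sample_opt_def by simp
  have "real cost \<le> real (vcost n d k ?A u Vf)" using u(2) by simp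
  also have "\<dots> \<le> (1 + \<epsilon>) * real (vcost n d k ?A Uf Vf)"
    using JwY(2)[THEN spec, THEN mp, OF uopt] by (simp add: vcost_eq)
  also have "vcost n d k ?A Uf Vf = l0_rank_opt k A"
    unfolding UV(3)[symmetric] l0_norm_residual[OF A UV(1,2)] vcost_eq Uf_def Vf_def ..
  finally show ?thesis .
qed

section \<open>Running time and word size\<close>

text \<open>With \<open>t = M * k * k\<close> the exponent is
  \<open>M * k * \<epsilon>^2 / 144\<close>: one factor \<open>k\<close> cancels, the other pays for
  \<open>q ^ k\<close>. Logarithms are avoided by \<open>128 \<le> exp 7\<close>,
  \<open>q \<le> exp q\<close> and \<open>1 / \<epsilon> \<le> exp (1 / \<epsilon>)\<close>, and
  \<open>7 + 1 / \<epsilon> + k * q\<close> is at most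
  \<open>k * (8 + q) / \<epsilon>\<close>.\<close>

lemma sample_size_suffices:
  fixes \<epsilon> :: real
  assumes eps: "0 < \<epsilon>" "\<epsilon> < 1" and k: "0 < k" and M: "144 * (8 + real q) / \<epsilon> ^ 3 \<le> real M"
  shows "128 * real q ^ k / \<epsilon> \<le> exp (real (M * k * k) * \<epsilon>\<^sup>2 / (144 * real k))"
proof -
  have k1: "1 \<le> real k" using k by simp
  have inv1: "1 \<le> 1 / \<epsilon>" using eps by simp
  have "144 * (8 + real q) \<le> real M * \<epsilon> ^ 3" using M eps by (simp add: divide_le_eq)
  then have "(8 + real q) / \<epsilon> \<le> real M * \<epsilon>\<^sup>2 / 144"
    by (simp add: pos_divide_le_eq[OF eps(1)] power2_eq_square power3_eq_cube mult_ac)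
  then have "real k * ((8 + real q) / \<epsilon>) \<le> real k * (real M * \<epsilon>\<^sup>2 / 144)" by (intro mult_left_mono) auto
  also have "\<dots> = real (M * k * k) * \<epsilon>\<^sup>2 / (144 * real k)" using k by simp
  finally have 1: "real k * ((8 + real q) * (1 / \<epsilon>)) \<le> real (M * k * k) * \<epsilon>\<^sup>2 / (144 * real k)" by simp
  have "7 + 1 / \<epsilon> + real k * real q \<le> real k * ((8 + real q) * (1 / \<epsilon>))"
  proof -
    have "7 + 1 / \<epsilon> \<le> 8 * (1 / \<epsilon>)" using inv1 by linarith
    also have "\<dots> \<le> real k * (8 * (1 / \<epsilon>))" using mult_right_mono[OF k1, of "8 * (1 / \<epsilon>)"] inv1 by linarith
    moreover have "real k * real q \<le> real k * (real q * (1 / \<epsilon>))"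
      using mult_left_mono[OF inv1, of "real q"] by (intro mult_left_mono) auto
    ultimately show ?thesis unfolding distrib_left distrib_right by linarith
  qed
  with 1 have 2: "exp (7 + 1 / \<epsilon> + real k * real q) \<le> exp (real (M * k * k) * \<epsilon>\<^sup>2 / (144 * real k))" by simp
  have e7: "128 \<le> exp (7 :: real)"
  proof -
    have "(2 :: real) ^ 7 \<le> exp 1 ^ 7" using exp_ge_add_one_self[of 1] by (intro power_mono) auto
    then show ?thesis by (simp flip: exp_of_nat_mult)
  qed
  have eq: "real q ^ k \<le> exp (real k * real q)"
  proof -
    have "real q \<le> exp (real q)" using exp_ge_add_one_self[of "real q"] by linarith
    then have "real q ^ k \<le> exp (real q) ^ k" by (intro power_mono) auto
    then show ?thesis by (simp flip: exp_of_nat_mult)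
  qed
  have ee: "1 / \<epsilon> \<le> exp (1 / \<epsilon>)" using exp_ge_add_one_self[of "1 / \<epsilon>"] by linarith
  have "128 * (1 / \<epsilon>) * real q ^ k \<le> exp 7 * exp (1 / \<epsilon>) * exp (real k * real q)"
    using e7 ee eq eps by (intro mult_mono mult_nonneg_nonneg) auto
  also have "\<dots> = exp (7 + 1 / \<epsilon> + real k * real q)" by (simp only: exp_add)
  finally have "128 * (1 / \<epsilon>) * real q ^ k \<le> exp (7 + 1 / \<epsilon> + real k * real q)" .
  with 2 have "128 * (1 / \<epsilon>) * real q ^ k \<le> exp (real (M * k * k) * \<epsilon>\<^sup>2 / (144 * real k))" by (rule order_trans[rotated])
  then show ?thesis by simp
qed

text \<open>All numbers in a run are bounded by \<open>y ^ 6\<close> for a \<open>y\<close> that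
  dominates the dimensions and constants. Taking \<open>y = w * (n + d + k)\<close>, the exponent
  \<open>w \<ge> 10\<close> of the word bound suffices.\<close>

lemma words_large:
  fixes n d k M q :: nat
  assumes pos: "0 < n" "0 < d" "0 < k" and w: "w = M + q + 10" and W: "W = (w * (n + d + k)) ^ w"
  shows "\<exists>y. n + 2 \<le> y \<and> d + 2 \<le> y \<and> k + 2 \<le> y \<and> M \<le> y \<and> q \<le> y \<and> y ^ 6 < W"
proof -
  define y where "y = w * (n + d + k)"
  have y: "10 * (n + d + k) \<le> y" "(M + q) * 1 \<le> y"
    unfolding y_def w using pos by (intro mult_le_mono; simp)+
  then have y': "10 * n + 10 * d + 10 * k \<le> y" "M + q \<le> y" by simp_all
  then have "1 < y" using pos by linarith
  then have "y ^ 6 < y ^ w" using w by (intro power_strict_increasing) auto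
  then show ?thesis
    unfolding W y_def[symmetric] using pos y' by (intro exI[of _ y] conjI) linarith+
qed

lemma poly_le_pow6:
  fixes y :: nat
  assumes "2 \<le> y"
  shows "y \<le> y ^ 6" "y * y \<le> y ^ 6" "y * y + 1 \<le> y ^ 6" "y * y * y \<le> y ^ 6" "y * y * y * y \<le> y ^ 6"
    "y * y * y * y + 1 \<le> y ^ 6" "y * (y * y + 1) \<le> y ^ 6" "y * (y * y * y * y + 1) \<le> y ^ 6"
proof -
  have p: "y ^ i \<le> y ^ j" if "i \<le> j" for i j using that assms by (intro power_increasing) auto
  have s: "y ^ i + 1 \<le> y ^ Suc i" for i
  proof -
    have "1 \<le> y ^ i" using assms by simp
    then have "y ^ i + 1 \<le> 2 * y ^ i" by linarith
    also have "\<dots> \<le> y * y ^ i" using assms by (intro mult_le_mono1)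
    finally show ?thesis by simp
  qed
  have e: "y * y = y ^ 2" "y * y * y = y ^ 3" "y * y * y * y = y ^ 4" by (simp_all add: eval_nat_numeral)
  have "y * (y ^ 2 + 1) \<le> y * y ^ Suc 2" "y * (y ^ 4 + 1) \<le> y * y ^ Suc 4" by (intro mult_le_mono2 s)+
  then have "y * (y ^ 2 + 1) \<le> y ^ 4" "y * (y ^ 4 + 1) \<le> y ^ 6" by (simp_all flip: power_Suc)
  moreover have "y * (y * y + 1) = y * (y ^ 2 + 1)" "y * (y * y * y * y + 1) = y * (y ^ 4 + 1)"
    by (simp_all add: eval_nat_numeral)
  ultimately show "y * (y * y + 1) \<le> y ^ 6" "y * (y * y * y * y + 1) \<le> y ^ 6"
    using p[of 4 6] by linarith+
  show "y \<le> y ^ 6" using p[of 1 6] by simp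
  show "y * y \<le> y ^ 6" unfolding e(1) by (rule p) simp
  show "y * y * y \<le> y ^ 6" unfolding e(2) by (rule p) simp
  show "y * y * y * y \<le> y ^ 6" unfolding e(3) by (rule p) simp
  show "y * y + 1 \<le> y ^ 6" unfolding e(1) using s[of 2] p[of 3 6] by simp
  show "y * y * y * y + 1 \<le> y ^ 6" unfolding e(3) using s[of 4] p[of 5 6] by simp
qed

text \<open>\<open>t\<close> is at most \<open>y ^ 3\<close>, so the largest quantity,
  \<open>n * (t * d + 1)\<close>, is at most \<open>y * (y ^ 4 + 1)\<close>; this is what requires
  the sixth power.\<close>

lemma word_bounds:
  fixes n d k M q t N :: nat
  assumes pos: "0 < n" "0 < d" "0 < k" and w: "w = M + q + 10" and W: "W = (w * (n + d + k)) ^ w"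
    and t: "t = M * k * k" and N: "N = t * (k + 2)"
  shows "q * q < W" "n < W" "d < W" "k + 2 < W" "M < W" "M * k < W" "t < W" "t * k < W" "N + 1 < W" "d * q < W"
    "n * k < W" "d * k < W" "n * d + 1 < W" "t * d + 1 < W" "n * (t * d + 1) < W" "d * (n * d + 1) < W" "d * d < W"
proof -
  obtain y where y: "n + 2 \<le> y" "d + 2 \<le> y" "k + 2 \<le> y" "M \<le> y" "q \<le> y" "y ^ 6 < W"
    using words_large[OF pos w W] by blast
  have le: "n \<le> y" "d \<le> y" "k \<le> y" "2 \<le> y" using y by linarith+
  note P = poly_le_pow6[OF le(4)]
  have ty: "t \<le> y * y * y" unfolding t by (intro mult_le_mono le y)
  have tk: "t * k \<le> y * y * y * y" "t * d \<le> y * y * y * y" "t * (k + 2) \<le> y * y * y * y"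
    by (intro mult_le_mono ty le y)+
  have q2: "q * q \<le> y * y" "M * k \<le> y * y" "d * q \<le> y * y" "n * k \<le> y * y" "d * k \<le> y * y" "n * d \<le> y * y" "d * d \<le> y * y"
    by (intro mult_le_mono le y)+
  have "n * (t * d + 1) \<le> y * (y * y * y * y + 1)" "d * (n * d + 1) \<le> y * (y * y + 1)"
    by (intro mult_le_mono add_right_mono le tk q2)+
  then show "n * (t * d + 1) < W" "d * (n * d + 1) < W" using P y(6) by linarith+
  show "q * q < W" "n < W" "d < W" "k + 2 < W" "M < W" "M * k < W" "t < W" "t * k < W" "d * q < W"
    "n * k < W" "d * k < W" "n * d + 1 < W" "t * d + 1 < W" "d * d < W"
    using P y le ty tk q2 by linarith+
  show "N + 1 < W" unfolding N using P y(6) tk(3) by linarith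
qed

lemma guess_time_bound:
  fixes n d k t :: nat
  assumes pos: "0 < n" "0 < d" "0 < k" "0 < t" "0 < (q::nat)"
    and r: "\<And>k L. r k L = q ^ k * (L * (50 * k + 72) + 47 * k + 100) + 20"
  shows "40 * t + 40 * (t * k) + n * (r k t + 19) + 42 * (n * k) + 30 * n
     + d * (r k n + 19) + d * (40 * k + 30) + 190 \<le> 1100 * (n * d * t * k * q ^ k)"
proof -
  define Q where "Q = q ^ k"
  have Q: "1 \<le> Q" using pos by (simp add: Q_def)
  \<comment> \<open>All terms are multiples of at most \<open>L * k * Q\<close>, and
    \<open>50 + 72 + 47 + 100 + 20 + 19 = 308\<close>.\<close>
  have rb: "r k L + 19 \<le> 308 * (L * k * Q)" if "1 \<le> L" for L
  proof -
    have "L * 1 \<le> L * k" "1 * k \<le> L * k" "1 * 1 \<le> L * k" using that pos by (intro mult_le_mono; simp)+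
    then have Lk: "L \<le> L * k" "k \<le> L * k" "1 \<le> L * k" by simp_all
    have "L * (50 * k + 72) = 50 * (L * k) + 72 * L" by (simp add: algebra_simps)
    with Lk have "L * (50 * k + 72) + 47 * k + 100 \<le> 269 * (L * k)"
      by linarith
    then have "Q * (L * (50 * k + 72) + 47 * k + 100) \<le> Q * (269 * (L * k))" by (rule mult_le_mono2)
    moreover have "1 * 1 \<le> Q * (L * k)" using Q Lk(3) by (intro mult_le_mono)
    moreover have "Q * (269 * (L * k)) = 269 * (Q * (L * k))" "308 * (L * k * Q) = 308 * (Q * (L * k))" by simp_all
    moreover have "a + 20 + 19 \<le> c" if "a \<le> b" "1 * 1 \<le> e" "b = 269 * e" "c = 308 * e" for a b c e :: nat
      using that by linarith
    ultimately show ?thesis unfolding r Q_def[symmetric] by blast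
  qed
  have n1: "1 \<le> n" "1 \<le> d" "1 \<le> k" "1 \<le> t" using pos by simp_all
  define Z where "Z = n * d * t * k * Q"
  have m: "x1 * x2 * x3 * x4 * x5 \<le> Z" if "x1 \<le> n" "x2 \<le> d" "x3 \<le> t" "x4 \<le> k" "x5 \<le> Q" for x1 x2 x3 x4 x5
    unfolding Z_def using that by (intro mult_le_mono)
  have "t \<le> Z" "t * k \<le> Z" "n * k \<le> Z" "n \<le> Z" "d * k \<le> Z" "d \<le> Z" "1 \<le> Z"
    using m[of 1 1 t 1 1] m[of 1 1 t k 1] m[of n 1 1 k 1] m[of n 1 1 1 1] m[of 1 d 1 k 1] m[of 1 d 1 1 1] m[of 1 1 1 1 1] n1 Q by simp_all
  moreover have "n * (r k t + 19) \<le> 308 * Z"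
  proof -
    have "n * (r k t + 19) \<le> n * (308 * (t * k * Q))" by (intro mult_le_mono2 rb n1)
    also have "\<dots> = 308 * (n * 1 * t * k * Q)" by (simp add: mult_ac)
    also have "\<dots> \<le> 308 * Z" by (intro mult_le_mono2 m) (use n1 in auto)
    finally show ?thesis .
  qed
  moreover have "d * (r k n + 19) \<le> 308 * Z"
  proof -
    have "d * (r k n + 19) \<le> d * (308 * (n * k * Q))" by (intro mult_le_mono2 rb n1)
    also have "\<dots> = 308 * (n * d * 1 * k * Q)" by (simp add: mult_ac)
    also have "\<dots> \<le> 308 * Z" by (intro mult_le_mono2 m) (use n1 in auto)
    finally show ?thesis .
  qed
  moreover have "d * (40 * k + 30) = 40 * (d * k) + 30 * d" by (simp add: algebra_simps)
  \<comment> \<open>The coefficients \<open>40 + 40 + 308 + 42 + 30 + 308 + 40 + 30 + 190\<close>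
    add up to 1028.\<close>
  ultimately show ?thesis unfolding Q_def[symmetric] Z_def[symmetric] by linarith
qed

lemma self_le_power: "x \<le> d ^ x" if "2 \<le> d" for x d :: nat
proof -
  have "x \<le> 2 ^ x" using less_exp[of x] by simp
  also have "\<dots> \<le> d ^ x" using that by (rule power_mono) simp
  finally show ?thesis .
qed

text \<open>The leading constant may depend on \<open>q\<close> but not on \<open>\<epsilon>\<close>
  or \<open>k\<close>, so \<open>M\<close>, \<open>q ^ k\<close> and \<open>q ^ N\<close> have to
  disappear into the exponent. This works by \<open>x \<le> d ^ x\<close>, which needs
  \<open>d \<ge> 2\<close>, a consequence of \<open>0 < k < d\<close>.\<close>

lemma total_time_bound:
  fixes n d k t N M q G :: nat
  assumes pos: "0 < n" "0 < k" "k < d" "0 < M" "0 < q"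
    and t: "t = M * k * k" and N: "N = t * (k + 2)" and G: "G \<le> 1100 * (n * d * t * k * q ^ k)"
  shows "(d * q) ^ N * (G + (N + 2) * 24 + 2) + 6 * (q * q) + 60
    \<le> (1300 + 6 * (q * q)) * n * d ^ (4 + M + q * k + (1 + q) * N)"
proof -
  define Z where "Z = n * d * t * k * q ^ k"
  have d: "2 \<le> d" using pos by simp
  have t0: "1 \<le> t" using pos by (simp add: t)
  have tk: "t * k * 1 \<le> t * k * (n * d * q ^ k)" using pos by (intro mult_le_mono2) (simp add: Suc_le_eq)
  then have tkZ: "t * k \<le> Z" by (simp add: Z_def mult_ac)
  have "1 * 1 \<le> t * k" using t0 pos by (intro mult_le_mono) auto
  then have one: "1 \<le> t * k" by simp
  have "N \<le> 3 * (t * k)"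
  proof -
    have "t * (k + 2) \<le> t * (3 * k)" using pos by (intro mult_le_mono2) simp
    then show ?thesis by (simp add: N)
  qed
  have "G' + (N' + 2) * 24 + 2 \<le> 1240 * Z'" if "N' \<le> 3 * x" "G' \<le> 1100 * Z'" "x \<le> Z'" "1 \<le> x" for G' N' x Z' :: nat
  proof -
    have "G' + (N' + 2) * 24 + 2 = G' + 24 * N' + 50" by simp
    then show ?thesis using that by linarith
  qed
  from this[of N "t * k" G Z] have "G + (N + 2) * 24 + 2 \<le> 1240 * Z" using \<open>N \<le> 3 * (t * k)\<close> G tkZ one unfolding Z_def[symmetric] .
  then have "(d * q) ^ N * (G + (N + 2) * 24 + 2) \<le> (d * q) ^ N * (1240 * Z)" by (rule mult_le_mono2)
  then have a: "(d * q) ^ N * (G + (N + 2) * 24 + 2) \<le> 1240 * ((d * q) ^ N * Z)" by (simp only: mult.left_commute)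
  have "1 * 1 \<le> (d * q) ^ N * Z"
  proof (intro mult_le_mono)
    show "1 \<le> (d * q) ^ N" using pos by (simp add: Suc_le_eq)
    show "1 \<le> Z" using one tkZ by linarith
  qed
  then have "(60 + 6 * (q * q)) * 1 \<le> (60 + 6 * (q * q)) * ((d * q) ^ N * Z)" by (intro mult_le_mono2) simp
  then have b: "60 + 6 * (q * q) \<le> (60 + 6 * (q * q)) * ((d * q) ^ N * Z)" by (simp only: mult_1_right)
  have "a + Q + 60 \<le> (1300 + Q) * Y" if "a \<le> 1240 * Y" "60 + Q \<le> (60 + Q) * Y" for a Q Y :: nat
  proof -
    have "(1300 + Q) * Y = 1240 * Y + (60 + Q) * Y" by (simp add: algebra_simps)
    with that show ?thesis by linarith
  qed
  from this[OF a b] have "(d * q) ^ N * (G + (N + 2) * 24 + 2) + 6 * (q * q) + 60 \<le> (1300 + 6 * (q * q)) * ((d * q) ^ N * Z)" .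
  also have "(d * q) ^ N * Z \<le> n * d ^ (4 + M + q * k + (1 + q) * N)"
  proof -
    have q: "q \<le> d ^ q" "M \<le> d ^ M" using d by (auto intro: self_le_power)
    have kd: "k \<le> d" using pos by simp
    have "(d * q) ^ N \<le> (d * d ^ q) ^ N" using q by (intro power_mono mult_le_mono2) auto
    moreover have "t \<le> d ^ M * d * d" unfolding t by (intro mult_le_mono q kd)
    moreover have "q ^ k \<le> (d ^ q) ^ k" using q by (intro power_mono) auto
    \<comment> \<open>The four free factors \<open>d\<close> are the one in \<open>Z\<close>, two
      for the factors \<open>k\<close> in \<open>t\<close>, and one for the remaining
      \<open>k\<close>.\<close>
    ultimately have "(d * q) ^ N * Z \<le> (d * d ^ q) ^ N * (n * d * (d ^ M * d * d) * d * (d ^ q) ^ k)"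
      unfolding Z_def using kd by (intro mult_le_mono) auto
    also have "\<dots> = n * d ^ (4 + M + q * k + (1 + q) * N)"
    proof -
      have "(d * d ^ q) ^ N = d ^ ((1 + q) * N)" by (simp only: power_mult power_add power_one_right)
      moreover have "(d ^ q) ^ k = d ^ (q * k)" by (simp only: power_mult)
      ultimately show ?thesis by (simp add: power_add eval_nat_numeral mult_ac)
    qed
    finally show ?thesis .
  qed
  then have "(1300 + 6 * (q * q)) * ((d * q) ^ N * Z) \<le> (1300 + 6 * (q * q)) * (n * d ^ (4 + M + q * k + (1 + q) * N))"
    by (rule mult_le_mono2)
  finally show ?thesis by (simp only: mult.assoc)
qed

text \<open>The cubic growth comes from \<open>N = M * k * k * (k + 2)\<close>, at most
  \<open>3 * M * k^3\<close>, where \<open>M\<close> is at most \<open>c / \<epsilon>^3\<close>; the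
  summand 1 in \<open>c\<close> covers the rounding in \<open>M\<close>. The other terms are
  dominated because \<open>k / \<epsilon>\<close> is at least 1.\<close>

lemma exponent_bound:
  fixes \<epsilon> :: real
  assumes eps: "0 < \<epsilon>" "\<epsilon> < 1" and k: "0 < k" and M: "real M \<le> 144 * (8 + real q) / \<epsilon> ^ 3 + 1"
    and N: "N = M * k * k * (k + 2)" and c: "c = 144 * (8 + real q) + 1"
  shows "real (4 + M + q * k + (1 + q) * N) \<le> (4 + c + real q + (1 + real q) * (3 * c)) * (real k / \<epsilon>) ^ 3"
proof -
  define x where "x = real k / \<epsilon>"
  have k1: "1 \<le> real k" using k by simp
  have "real k * 1 \<le> real k * (1 / \<epsilon>)" using eps by (intro mult_left_mono) auto
  then have kx: "real k \<le> x" by (simp add: x_def)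
  then have x1: "1 \<le> x" using k1 by linarith
  have x3: "1 \<le> x ^ 3" using x1 by (rule one_le_power)
  have "x ^ 1 \<le> x ^ 3" using x1 by (intro power_increasing) auto
  then have kx3: "real k \<le> x ^ 3" using kx by simp
  have e3: "1 \<le> 1 / \<epsilon> ^ 3" using eps by (simp add: power_le_one)
  have Mc: "real M \<le> c * (1 / \<epsilon> ^ 3)" using M e3 by (simp add: c algebra_simps add_divide_distrib)
  have c0: "0 \<le> c" by (simp add: c)
  have "(1 / \<epsilon>) ^ 3 \<le> x ^ 3" using k1 eps by (intro power_mono) (auto simp: x_def divide_right_mono)
  then have "c * (1 / \<epsilon> ^ 3) \<le> c * x ^ 3" using c0 by (intro mult_left_mono) (auto simp: power_one_over)
  then have Mx: "real M \<le> c * x ^ 3" using Mc by linarith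
  have "real N \<le> 3 * c * x ^ 3"
  proof -
    have "real N = real M * (real k * real k * (real k + 2))" by (simp add: N algebra_simps)
    also have "\<dots> \<le> (c * (1 / \<epsilon> ^ 3)) * (real k * real k * (3 * real k))"
      using k1 Mc c0 by (intro mult_mono) auto
    also have "\<dots> = 3 * c * x ^ 3" by (simp add: x_def power_divide power3_eq_cube)
    finally show ?thesis .
  qed
  then have "(1 + real q) * real N \<le> (1 + real q) * (3 * c * x ^ 3)" by (intro mult_left_mono) auto
  moreover have "real q * real k \<le> real q * x ^ 3" using kx3 by (intro mult_left_mono) auto
  moreover have "(4 + c + real q + (1 + real q) * (3 * c)) * x ^ 3
     = 4 * x ^ 3 + c * x ^ 3 + real q * x ^ 3 + (1 + real q) * (3 * c * x ^ 3)"
    by (simp only: distrib_right mult.assoc)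
  moreover have "real (4 + M + q * k + (1 + q) * N) = 4 + real M + real q * real k + (1 + real q) * real N"
    by (simp add: distrib_right)
  ultimately show ?thesis unfolding x_def[symmetric] using Mx x3 by linarith
qed

lemma exec_of_runs:
  assumes "runs W c s T Q" obtains t s' where "exec W c s t s'" "t \<le> T" "Q s'"
  using assms unfolding runs_def by blast

lemma stores_mat_of_fun:
  "\<forall>i<n. \<forall>j<k. s x (i * k + j) = enc (u i j) \<Longrightarrow> stores_mat enc s x (mat n k (\<lambda>(i, j). u i j))"
  by (simp add: stores_mat_def)

theorem theorem1p3:
  fixes enc :: "'a::{finite,field} \<Rightarrow> nat"
  assumes "field_encoding enc"
  shows "\<exists>(P :: real poly) (C :: real). \<forall>\<epsilon>::real. 0 < \<epsilon> \<longrightarrow> \<epsilon> < 1 \<longrightarrow>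
    (\<exists>prog. l0_rank_approx_algorithm enc (1 + \<epsilon>)
       (\<lambda>n d k. C * real n * real d powr poly P (real k / \<epsilon>)) prog)"
proof -
  define q where "q = CARD('a)"
  define c where "c = 144 * (8 + real q) + 1"
  define c' where "c' = 4 + c + real q + (1 + real q) * (3 * c)"
  \<comment> \<open>\<open>P\<close> and \<open>C\<close> are fixed before \<open>\<epsilon>\<close>
    and depend on \<open>q\<close> only; the dependence on \<open>\<epsilon>\<close> sits in the
    constant \<open>M\<close> of the program.\<close>
  define P where "P = monom c' 3"
  define C where "C = 1300 + 6 * real (q * q)"
  have c': "1 \<le> c'" by (simp add: c'_def c_def)
  have q0: "0 < q" unfolding q_def by simp
  have "\<exists>prog. l0_rank_approx_algorithm enc (1 + \<epsilon>)
       (\<lambda>n d k. C * real n * real d powr poly P (real k / \<epsilon>)) prog" if eps: "0 < \<epsilon>" "\<epsilon> < 1" for \<epsilon> :: real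
  proof -
    define M where "M = nat \<lceil>144 * (8 + real q) / \<epsilon> ^ 3\<rceil>"
    define w where "w = M + q + 10"
    have Mpos: "0 < 144 * (8 + real q) / \<epsilon> ^ 3" using eps by simp
    have M: "144 * (8 + real q) / \<epsilon> ^ 3 \<le> real M" unfolding M_def by (rule real_nat_ceiling_ge)
    have M': "real M \<le> 144 * (8 + real q) / \<epsilon> ^ 3 + 1" unfolding M_def using Mpos by linarith
    have M0: "0 < M" using M Mpos by linarith
    \<comment> \<open>The program and \<open>w\<close> are chosen before the instance. The locale
      can be entered only afterwards, because its word bound \<open>W\<close> varies with the
      instance.\<close>
    show ?thesis
      unfolding l0_rank_approx_algorithm_def
    proof (rule exI[of _ "field_machine.prog enc q M"], rule exI[of _ w], intro allI ballI impI)
      fix n d k :: nat and A :: "'a mat"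
      assume A: "A \<in> carrier_mat n d" and pos: "0 < n" "0 < d" "0 < k"
      define W where "W = (w * (n + d + k)) ^ w"
      define t where "t = M * k * k"
      define N where "N = t * (k + 2)"
      note wb = word_bounds[OF pos w_def W_def t_def N_def]
      interpret field_machine enc q W
        using assms wb(1) by unfold_locales (simp_all add: q_def)
      let ?s = "input_state enc A k"
      let ?A = "\<lambda>i j. A $$ (i, j)"
      let ?T = "C * real n * real d powr poly P (real k / \<epsilon>)"
      have x1: "1 \<le> real k / \<epsilon>" using pos eps by (simp add: le_divide_eq)
      have s: "?s ''n'' 0 = n" "?s ''d'' 0 = d" "?s ''k'' 0 = k" "\<forall>m. ?s ''G'' m = 0" "\<forall>m. ?s ''H'' m = 0"
        "\<forall>m. ?s ''U'' m = 0" "\<forall>m. ?s ''V'' m = 0" "stores ?s ''A'' n d ?A"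
        using A index_less by (auto simp: input_state_def)
      let ?goal = "\<lambda>t s'. exec W (prog M) ?s t s' \<and> real t \<le> ?T \<and> (\<exists>U\<in>carrier_mat n k. \<exists>V\<in>carrier_mat k d.
          stores_mat enc s' ''U'' U \<and> stores_mat enc s' ''V'' V \<and> real (l0_norm (A - U * V)) \<le> (1 + \<epsilon>) * real (l0_rank_opt k A))"
      have fin: "\<exists>t s'. ?goal t s'"
        if "exec W (prog M) ?s t s'" "t \<le> T" "real T \<le> ?T"
          "stores s' ''U'' n k u" "stores s' ''V'' k d v"
          "real (vcost n d k ?A u v) \<le> (1 + \<epsilon>) * real (l0_rank_opt k A)" for t T s' u v
      proof -
        let ?U = "mat n k (\<lambda>(i, m). u i m)" and ?V = "mat k d (\<lambda>(m, j). v m j)"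
        have "l0_norm (A - ?U * ?V) = vcost n d k ?A u v"
          unfolding l0_norm_residual[OF A mat_carrier mat_carrier] vcost_eq
          by (intro sum.cong refl arg_cong[of _ _ card] Collect_cong conj_cong) simp_all
        moreover have "stores_mat enc s' ''U'' ?U" "stores_mat enc s' ''V'' ?V"
          using that(4,5) by (auto intro: stores_mat_of_fun)
        moreover have "real t \<le> ?T" using that(2,3) by linarith
        moreover have "?U \<in> carrier_mat n k" "?V \<in> carrier_mat k d" by simp_all
        ultimately show ?thesis using that(1,6) by metis
      qed
      have "\<exists>t s'. ?goal t s'"
      proof (cases "k < d")
        case True
        have sz: "sizes k n t d" "sizes k d n d" using wb unfolding sizes_def by simp_all
        have kW: "n * d + 1 < W" "k + 2 < W" using wb by simp_all
        obtain tm s' u v where run: "exec W (prog M) ?s tm s'"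
          "tm \<le> (d * q) ^ N * (guess_time n d k t + (N + 2) * 24 + 2) + 6 * (q * q) + 60"
          "stores s' ''U'' n k u" "stores s' ''V'' k d v"
          "\<forall>c<(d * q) ^ N. \<exists>u'. sample_opt n d k t ?A (\<lambda>i. c div (d * q) ^ i mod (d * q)) u' \<and>
             (\<forall>v'. vcost n d k ?A u v \<le> vcost n d k ?A u' v')"
          by (rule exec_of_runs[OF runs_prog_main[OF s(1-3,8,4,5) True t_def N_def sz wb(9,10) kW(1) pos(2) wb(5,6) kW(2)]]) blast
        have t0: "0 < t" using M0 pos by (simp add: t_def)
        have good: "real (vcost n d k ?A u v) \<le> (1 + \<epsilon>) * real (l0_rank_opt k A)"
          using run(5) sample_size_suffices[OF eps pos(3) M]
          by (intro best_guess_good[OF A eps pos(3,2) t0]) (simp_all add: t_def N_def)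
        have "guess_time n d k t \<le> 1100 * (n * d * t * k * q ^ k)"
          unfolding guess_time_def by (rule guess_time_bound[OF pos t0 q0]) (simp add: row_time_def)
        from total_time_bound[OF pos(1,3) True M0 q0 t_def N_def this]
        have "real ((d * q) ^ N * (guess_time n d k t + (N + 2) * 24 + 2) + 6 * (q * q) + 60)
          \<le> real ((1300 + 6 * (q * q)) * n * d ^ (4 + M + q * k + (1 + q) * N))" by (simp only: of_nat_le_iff)
        also have "\<dots> = C * real n * real d ^ (4 + M + q * k + (1 + q) * N)" by (simp add: C_def)
        also have "\<dots> \<le> ?T"
        proof (intro mult_left_mono)
          have "real d ^ (4 + M + q * k + (1 + q) * N) = real d powr real (4 + M + q * k + (1 + q) * N)"
            using pos by (subst powr_realpow) auto
          also have "\<dots> \<le> real d powr poly P (real k / \<epsilon>)"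
          proof (rule powr_mono)
            show "real (4 + M + q * k + (1 + q) * N) \<le> poly P (real k / \<epsilon>)"
              using exponent_bound[OF eps pos(3) M' _ c_def, of N] unfolding P_def poly_monom c'_def
              by (simp only: N_def t_def)
          qed (use pos in simp)
          finally show "real d ^ (4 + M + q * k + (1 + q) * N) \<le> real d powr poly P (real k / \<epsilon>)" .
        qed (simp add: C_def)
        finally show ?thesis by (rule fin[OF run(1,2) _ run(3,4) good])
      next
        case False
        then have dk: "d \<le> k" by simp
        have kW: "k < W" "n * d < W" using wb by simp_all
        define u where "u i m = (if m < d then A $$ (i, m) else 0)" for i m
        define v :: "nat \<Rightarrow> nat \<Rightarrow> 'a" where "v m j = (if m = j then 1 else 0)" for m j
        obtain tm s' where run: "exec W (prog M) ?s tm s'" "tm \<le> n * (60 * d + 60) + 60 * d + 70"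
          "stores s' ''U'' n k u" "stores s' ''V'' k d v"
          by (rule exec_of_runs[OF runs_prog_trivial[OF s(1-3,6,7,8) dk kW(1) wb(11) kW(2) wb(2,17), of M, folded u_def v_def]]) blast
        have "(\<Sum>m<k. u i m * v m j) = A $$ (i, j)" if "j < d" for i j
        proof -
          have "(\<Sum>m<k. u i m * v m j) = (\<Sum>m<k. if m = j then u i m else 0)"
            by (intro sum.cong) (auto simp: v_def)
          also have "\<dots> = u i j" using that False by (subst sum.delta) auto
          finally show ?thesis using that by (simp add: u_def)
        qed
        then have "vcost n d k ?A u v = 0" unfolding vcost_eq by auto
        then have good: "real (vcost n d k ?A u v) \<le> (1 + \<epsilon>) * real (l0_rank_opt k A)" using eps by simp
        have "real (n * (60 * d + 60) + 60 * d + 70) \<le> 250 * real n * real d"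
        proof -
          have "1 * 1 \<le> n * d" "n * 1 \<le> n * d" "1 * d \<le> n * d" using pos by (intro mult_le_mono; simp)+
          then have "n \<le> n * d" "d \<le> n * d" "1 \<le> n * d" by simp_all
          moreover have "n * (60 * d + 60) = 60 * (n * d) + 60 * n" by (simp add: algebra_simps)
          ultimately have "n * (60 * d + 60) + 60 * d + 70 \<le> 250 * (n * d)" by linarith
          then have "real (n * (60 * d + 60) + 60 * d + 70) \<le> real (250 * (n * d))" by (simp only: of_nat_le_iff)
          then show ?thesis by simp
        qed
        also have "\<dots> \<le> C * real n * real d" by (intro mult_right_mono) (simp_all add: C_def)
        also have "\<dots> \<le> ?T"
        proof (intro mult_left_mono)
          \<comment> \<open>The exact case needs an exponent of at least 1, which holds since both
            factors are at least 1.\<close>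
          have "1 * 1 \<le> c' * (real k / \<epsilon>) ^ 3" using c' one_le_power[OF x1, of 3] by (intro mult_mono) auto
          then have "real d powr 1 \<le> real d powr poly P (real k / \<epsilon>)"
            unfolding P_def poly_monom using pos by (intro powr_mono) auto
          then show "real d \<le> real d powr poly P (real k / \<epsilon>)" using pos by simp
        qed (simp add: C_def)
        finally show ?thesis by (rule fin[OF run(1,2) _ run(3,4) good])
      qed
      then show "\<exists>t s'. exec ((w * (n + d + k)) ^ w) (prog M) ?s t s' \<and> real t \<le> ?T \<and>
         (\<exists>U\<in>carrier_mat n k. \<exists>V\<in>carrier_mat k d. stores_mat enc s' ''U'' U \<and> stores_mat enc s' ''V'' V \<and>
           real (l0_norm (A - U * V)) \<le> (1 + \<epsilon>) * real (l0_rank_opt k A))"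
        unfolding W_def .
    qed
  qed
  then show ?thesis by blast
qed

end
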